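(* Let $s_j=\sigma_j+it_j$ ($j=1,2,3$) with $s_1+s_3\ne1$ and $\sigma_1\ge0$, and let $y\ge x\ge1$ and $C>1$. Suppose $\sigma_3>\max\{0,2-\sigma_1-\sigma_2\}$, $|t_3|\le 2\pi x/C-|t_1|$, and either ($t_1,t_3\ge0$, $(t_1,t_3)\ne(0,0)$) or ($t_1,t_3\le0$, $(t_1,t_3)\ne(0,0)$). Then $$\begin{aligned}\zeta_{AV,2}(s_1,s_2,s_3)&=\sum_{n\le x}\sum_{n<m\le y}\frac{1}{m^{s_1}n^{s_2}(m+n)^{s_3}}+\frac{y^{1-s_1}}{s_1+s_3-1}\sum_{n\le x}\frac{1}{n^{s_2}(y+n)^{s_3}}\\&\quad+\frac{s_3}{s_1+s_3-1}\sum_{n\le x}\frac{1}{n^{s_2-1}}\int_y^\infty\frac{du}{u^{s_1}(u+n)^{s_3+1}}+\frac{2^{-s_3}}{s_1+s_3-1}\sum_{n>x}\frac{1}{n^{s_1+s_2+s_3-1}}\\&\quad+\frac{s_3}{s_1+s_3-1}\sum_{n>x}\frac{1}{n^{s_2-1}}\int_n^\infty\frac{du}{u^{s_1}(u+n)^{s_3+1}}+\begin{cases}O(x^{-\sigma_1-\sigma_3})&(\sigma_2>1),\\O(x^{-\sigma_1-\sigma_3}\log x)&(\sigma_2=1),\\O(x^{1-\sigma_1-\sigma_2-\sigma_3})&(\sigma_2<1),\end{cases}\end{aligned}$$ where $m,n$ range over positive integers and the implied constants depend on $s_1,s_2,\sigma_3$ and $C$.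
   Context: Write $s_j=\sigma_j+it_j$ with $\sigma_j,t_j\in\mathbb{R}$; complex powers use principal branches ($u^{s}=e^{s\log u}$ for $u>0$). The Apostol–Vu double zeta-function is $\zeta_{AV,2}(s_1,s_2,s_3)=\sum_{m=1}^\infty\sum_{n<m}m^{-s_1}n^{-s_2}(m+n)^{-s_3}$ (positive integers $n<m$), absolutely convergent for $\sigma_1+\sigma_3>1$, $\sigma_1+\sigma_2+\sigma_3>2$, and extended meromorphically to $\mathbb{C}^3$ (singularities only on $s_1+s_3=1-l$, $s_1+s_2+s_3=2-l$, $l\in\mathbb{Z}_{\ge0}$); $\zeta_{AV,2}$ denotes this continuation.
   Formalization: For σ₂=1 the error is proved as O(x^{-σ₁-σ₃}(1+log x)) instead of O(x^{-σ₁-σ₃} log x): the latter fails near x=1, where log x→0 but the error cannot vanish for all y (the double sum jumps at y=2); for x≥2 the two bounds are equivalent. *)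

theory Defs
  imports "HOL-Analysis.Analysis"
begin

text \<open>Complement of the singular hyperplanes s1+s3 = 1-l, s1+s2+s3 = 2-l (l >= 0).\<close>
definition AV2_dom :: "(complex \<times> complex \<times> complex) set" where
  "AV2_dom = {(a, b, c). \<forall>l::nat. a + c \<noteq> 1 - of_nat l \<and> a + b + c \<noteq> 2 - of_nat l}"

definition AV2_series :: "complex \<Rightarrow> complex \<Rightarrow> complex \<Rightarrow> complex" where
  "AV2_series a b c =
     infsum (\<lambda>(m::nat, n::nat). 1 / (of_nat m powr a * of_nat n powr b * of_nat (m + n) powr c))
            {(m, n). 0 < n \<and> n < m}"

text \<open>Holomorphy in three complex variables: continuous and holomorphic in each
  variable separately (equivalent to joint holomorphy by Osgood/Hartogs).\<close>
definition holo3 :: "(complex \<Rightarrow> complex \<Rightarrow> complex \<Rightarrow> complex) \<Rightarrow> (complex \<times> complex \<times> complex) set \<Rightarrow> bool" where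
  "holo3 f D \<longleftrightarrow> open D \<and> continuous_on D (\<lambda>(a, b, c). f a b c) \<and>
     (\<forall>(a, b, c) \<in> D. (\<lambda>z. f z b c) field_differentiable (at a) \<and>
                       (\<lambda>z. f a z c) field_differentiable (at b) \<and>
                       (\<lambda>z. f a b z) field_differentiable (at c))"

text \<open>The meromorphic continuation of the Apostol--Vu double zeta-function: the unique
  holomorphic function on AV2_dom agreeing with the series on the region of absolute
  convergence (set to 0 off AV2_dom, where it is singular).\<close>
definition zeta_AV2 :: "complex \<Rightarrow> complex \<Rightarrow> complex \<Rightarrow> complex" where
  "zeta_AV2 = (THE f. holo3 f AV2_dom \<and> (\<forall>a b c. (a, b, c) \<notin> AV2_dom \<longrightarrow> f a b c = 0) \<and>
      (\<forall>a b c. Re a + Re c > 1 \<and> Re a + Re b + Re c > 2 \<longrightarrow> f a b c = AV2_series a b c))"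

end

theory Submission
  imports Defs "HOL-Complex_Analysis.Complex_Analysis"
begin

text \<open>For fixed n apply Euler--Maclaurin summation to the sum over m of
  m powr (- s1) * (m + n) powr (- s3). By homogeneity, each integration by parts of the remainder
  improves its decay by a power of n, so that summing over n continues the double series
  past the region of convergence; a function that is holomorphic off the singular hyperplanes and
  agrees with the series is unique, because moving s1 to the right reaches the region of
  convergence while the removed points on such a line are countable.

  The approximate formula comes from the first-order expansion at m = y for n up to x, and at
  m = n for n above x. Its remainder is an integral of the sawtooth function
  against f' = (l - rho) f, where l = - i (t1 / u + t3 / (u + n)) and norm l is at most
  2 pi / C < 2 pi. In place of the Fourier series of the sawtooth we use the periodic
  solution v of v' + l v = l (frac u - 1/2), which is bounded together with its l-derivative
  uniformly for such l: the function v(l(u), u) f(u) is then an approximate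
  primitive, with an error controlled by the total variation of l and of the modulus of f.\<close>

section \<open>Integrals of powers over half-lines\<close>

text \<open>The difficulty is uniformity in t3. The remainder integrals carry the factors s1 and s3,
  and |s3| may be of the order of x, so an absolute estimate loses a factor x. Further integrations
  by parts, each costing a factor of size |s3| / y, do not recover it. Cancellation against the
  sawtooth has to be used, and this is possible as long as the frequency of the kernel stays below 2
  pi.

  A second obstacle is that the hypotheses give Re (s1 + s3) > 0 and Re (s1 + s2 + s3) > 2 only, so
  that the series over m may diverge while the sum over n of its regularised values still converges.
  The estimate therefore works with \<open>ktail\<close> in place of the inner series. The deeper
  continuations serve a different end: \<open>zeta_AV2\<close> is a definite description, so a
  holomorphic function on all of \<open>AV2_dom\<close> has to be constructed before anything can be
  said about a value of \<open>zeta_AV2\<close>.\<close>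

definition kern :: "real \<Rightarrow> complex \<Rightarrow> complex \<Rightarrow> real \<Rightarrow> complex" where
  "kern r a c u = of_real u powr (-a) * of_real (u + r) powr (-c)"

text \<open>The weight P is either 1 or a periodic Bernoulli function, and r is the inner summation
  index n. Taking r = 0 and c = 0 leaves integrals of pure powers, so the same lemmas also serve the
  Riemann zeta-function and the power sums in the error terms.\<close>

definition kint :: "(real \<Rightarrow> real) \<Rightarrow> real \<Rightarrow> complex \<Rightarrow> complex \<Rightarrow> real \<Rightarrow> complex" where
  "kint P r a c y = (LBINT u:{y..}. of_real (P u) * kern r a c u)"

lemma norm_kern:
  assumes "0 < u" "0 \<le> r"
  shows "norm (kern r a c u) = u powr (- Re a) * (u + r) powr (- Re c)"
  using assms by (simp add: kern_def norm_mult norm_powr_real_powr)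

lemma powr_sum_le:
  fixes u r g :: real
  assumes "0 < u" "0 \<le> r" "r \<le> u"
  shows "(u + r) powr (-g) \<le> 2 powr \<bar>g\<bar> * u powr (-g)"
proof (cases "g \<ge> 0")
  case True
  have "(u + r) powr (-g) \<le> u powr (-g)"
    using True assms by (intro powr_mono2') auto
  also have "\<dots> \<le> 2 powr \<bar>g\<bar> * u powr (-g)"
    using ge_one_powr_ge_zero[of 2 "\<bar>g\<bar>"] by (simp add: mult_le_cancel_right1)
  finally show ?thesis .
next
  case False
  have "(u + r) powr (-g) \<le> (2 * u) powr (-g)"
    using False assms by (intro powr_mono2) auto
  also have "\<dots> = 2 powr \<bar>g\<bar> * u powr (-g)"
    using False assms by (simp add: powr_mult)
  finally show ?thesis .
qed

text \<open>For r \<le> u the quantity u + r lies between u and 2 u, so both factors merge into one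
  power of u whatever the sign of Re c. Convergence at infinity is thus governed by Re (a + c)
  alone.\<close>

lemma norm_kern_le:
  assumes "0 < u" "0 \<le> r" "r \<le> u"
  shows "norm (kern r a c u) \<le> 2 powr \<bar>Re c\<bar> * u powr (- Re (a + c))"
proof -
  have "norm (kern r a c u) \<le> u powr (- Re a) * (2 powr \<bar>Re c\<bar> * u powr (- Re c))"
    using assms powr_sum_le[OF assms, of "Re c"] by (simp add: norm_kern mult_left_mono)
  also have "\<dots> = 2 powr \<bar>Re c\<bar> * u powr (- Re (a + c))"
    by (simp add: powr_add [symmetric] algebra_simps)
  finally show ?thesis .
qed

lemma of_real_powr_vector_derivative:
  assumes "0 < u + r"
  shows "((\<lambda>u. complex_of_real (u + r) powr s) has_vector_derivative
           s * of_real (u + r) powr (s - 1)) (at u within A)"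
proof -
  have "((\<lambda>z. (z + of_real r) powr s) has_field_derivative
           s * (of_real u + of_real r) powr (s - 1)) (at (of_real u))"
    by (rule derivative_eq_intros refl | use assms in \<open>simp flip: of_real_add\<close>)+
  from has_vector_derivative_real_field[OF this] show ?thesis
    by simp
qed

lemma kern_has_vector_derivative:
  assumes "0 < u" "0 \<le> r"
  shows "(kern r a c has_vector_derivative
           (- a * kern r (a + 1) c u - c * kern r a (c + 1) u)) (at u within A)"
proof -
  have "0 < u + r" "0 < u + 0" using assms by auto
  from of_real_powr_vector_derivative[OF this(1), of "-c" A]
    of_real_powr_vector_derivative[OF this(2), of "-a" A]
  have "((\<lambda>u. of_real u powr (-a) * of_real (u + r) powr (-c)) has_vector_derivative
     of_real u powr (-a) * (- c * of_real (u + r) powr (- c - 1)) +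
     (- a * of_real u powr (-a - 1)) * of_real (u + r) powr (- c)) (at u within A)"
    by (intro has_vector_derivative_mult) auto
  then show ?thesis
    unfolding kern_def minus_add_distrib
    by (rule has_vector_derivative_eq_rhs) (simp add: mult_ac)
qed

lemma continuous_on_kern:
  assumes "0 \<le> r" "\<And>u. u \<in> A \<Longrightarrow> 0 < u"
  shows "continuous_on A (kern r a c)"
  unfolding continuous_on_eq_continuous_within
  by (intro ballI has_vector_derivative_continuous[OF kern_has_vector_derivative] assms)

lemma set_integral_powr_atLeast:
  fixes s y :: real
  assumes "1 < s" "0 < y"
  shows "set_integrable lborel {y..} (\<lambda>u. u powr (-s))"
    and "(LBINT u:{y..}. u powr (-s)) = y powr (1 - s) / (s - 1)"
proof -
  have "((\<lambda>u. u powr (-s)) has_integral -(y powr (- s + 1)) / (-s + 1)) {y..}"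
    using assms by (intro has_integral_powr_to_inf) auto
  then have hi: "((\<lambda>u. u powr (-s)) has_integral y powr (1 - s) / (s - 1)) {y..}"
    using assms by (simp add: field_simps minus_divide_right)
  show si: "set_integrable lborel {y..} (\<lambda>u. u powr (-s))"
  proof -
    have "set_integrable lebesgue {y..} (\<lambda>u. u powr (-s))"
      by (rule nonnegative_absolutely_integrable_1) (use hi in auto)
    then show ?thesis
      unfolding set_integrable_def
      by (subst (asm) integrable_completion) auto
  qed
  show "(LBINT u:{y..}. u powr (-s)) = y powr (1 - s) / (s - 1)"
    using hi set_borel_integral_eq_integral(2)[OF si] by (simp add: integral_unique)
qed

lemma kern_integrable:
  assumes P: "P \<in> borel_measurable borel" "\<And>u. \<bar>P u\<bar> \<le> B"
    and "0 < y" "0 \<le> r" "r \<le> y" "1 < Re (a + c)"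
  shows "set_integrable lborel {y..} (\<lambda>u. of_real (P u) * kern r a c u)"
    and "norm (kint P r a c y) \<le>
           B * 2 powr \<bar>Re c\<bar> * (y powr (1 - Re (a + c)) / (Re (a + c) - 1))"
proof -
  let ?s = "Re (a + c)"
  have B0: "0 \<le> B" using P(2)[of 0] by linarith
  have meas: "set_borel_measurable lborel {y..} (kern r a c)"
    unfolding set_borel_measurable_def measurable_lborel2
    by (rule borel_measurable_continuous_on_indicator)
       (use assms in \<open>auto intro!: continuous_on_kern\<close>)
  have meas2: "set_borel_measurable lborel {y..} (\<lambda>u. of_real (P u) * kern r a c u)"
  proof -
    have "(\<lambda>u. complex_of_real (P u) * (indicator {y..} u *\<^sub>R kern r a c u)) \<in> borel_measurable lborel"
      using meas P(1) unfolding set_borel_measurable_def by (intro borel_measurable_times) auto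
    then show ?thesis
      unfolding set_borel_measurable_def by (simp add: scaleR_conv_of_real mult_ac)
  qed
  have dom: "set_integrable lborel {y..} (\<lambda>u. (B * 2 powr \<bar>Re c\<bar>) * u powr (- ?s))"
    using set_integral_powr_atLeast(1)[of ?s y] assms by simp
  have le: "norm (of_real (P u) * kern r a c u) \<le> (B * 2 powr \<bar>Re c\<bar>) * u powr (- ?s)"
    if "u \<ge> y" for u
  proof -
    have "norm (of_real (P u) * kern r a c u) \<le> B * (2 powr \<bar>Re c\<bar> * u powr (- ?s))"
      unfolding norm_mult norm_of_real
      by (rule mult_mono) (use P(2) norm_kern_le[of u r a c] assms that B0 in auto)
    then show ?thesis by (simp add: mult_ac)
  qed
  show si: "set_integrable lborel {y..} (\<lambda>u. of_real (P u) * kern r a c u)"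
  proof (rule set_integrable_bound[OF dom meas2], intro AE_I2 impI)
    fix u assume "u \<in> {y..}"
    then have u: "y \<le> u" by simp
    have "B * 2 powr \<bar>Re c\<bar> * u powr (- ?s) \<ge> 0" using B0 by simp
    then show "norm (of_real (P u) * kern r a c u) \<le> norm (B * 2 powr \<bar>Re c\<bar> * u powr (- ?s))"
      using le[OF u] by simp
  qed
  have "norm (kint P r a c y) \<le> (LBINT u:{y..}. norm (of_real (P u) * kern r a c u))"
    unfolding kint_def by (rule set_integral_norm_bound[OF si])
  also have "\<dots> \<le> (LBINT u:{y..}. (B * 2 powr \<bar>Re c\<bar>) * u powr (- ?s))"
    by (rule set_integral_mono) (use si dom le in \<open>auto intro: set_integrable_norm\<close>)
  also have "\<dots> = B * 2 powr \<bar>Re c\<bar> * (y powr (1 - ?s) / (?s - 1))"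
    using set_integral_powr_atLeast(2)[of ?s y] assms by simp
  finally show "norm (kint P r a c y) \<le> B * 2 powr \<bar>Re c\<bar> * (y powr (1 - ?s) / (?s - 1))" .
qed

section \<open>Calculus with exceptional points at the integers\<close>

lemma finite_Ints_Int_Icc: "finite (\<int> \<inter> {a..b::real})"
proof (rule finite_subset)
  show "\<int> \<inter> {a..b} \<subseteq> of_int ` {\<lfloor>a\<rfloor>..\<lceil>b\<rceil>}"
    by (auto simp: Ints_def image_iff intro!: bexI) linarith+
qed auto

text \<open>The primitives to come involve the floor function and are differentiable only off the
  integers. A compact interval contains finitely many integers, and continuity carries the primitive
  across them.\<close>

lemma FTC_off_Ints:
  fixes F f :: "real \<Rightarrow> complex"
  assumes "a \<le> b" "continuous_on {a..b} F"
    and "\<And>u. a < u \<Longrightarrow> u < b \<Longrightarrow> u \<notin> \<int> \<Longrightarrow> (F has_vector_derivative f u) (at u)"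
    and "set_integrable lborel {a..b} f"
  shows "(LBINT u:{a..b}. f u) = F b - F a"
proof -
  have "(f has_integral (F b - F a)) {a..b}"
    by (rule fundamental_theorem_of_calculus_interior_strong[of "\<int> \<inter> {a..b}"])
       (use assms finite_Ints_Int_Icc in auto)
  then show ?thesis
    using set_borel_integral_eq_integral(2)[OF assms(4)] by (simp add: integral_unique)
qed

lemma FTC_off_Ints_at_top:
  fixes F f :: "real \<Rightarrow> complex"
  assumes "continuous_on {a..} F"
    and "\<And>u. a < u \<Longrightarrow> u \<notin> \<int> \<Longrightarrow> (F has_vector_derivative f u) (at u)"
    and si: "set_integrable lborel {a..} f"
    and "(F \<longlongrightarrow> 0) at_top"
  shows "(LBINT u:{a..}. f u) = - F a"
proof -
  have lim: "((\<lambda>b. LBINT u:{a..b}. f u) \<longlongrightarrow> (LBINT u:{a..}. f u)) at_top"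
    by (rule tendsto_set_lebesgue_integral_at_top[OF _ si]) auto
  have "((\<lambda>b. F b - F a) \<longlongrightarrow> 0 - F a) at_top"
    by (intro tendsto_intros assms)
  moreover have "\<forall>\<^sub>F b in at_top. F b - F a = (LBINT u:{a..b}. f u)"
    using eventually_ge_at_top[of a]
  proof eventually_elim
    case (elim b)
    show ?case
      by (rule FTC_off_Ints[symmetric])
         (use elim assms in \<open>auto intro: continuous_on_subset set_integrable_subset[OF si]\<close>)
  qed
  ultimately have "((\<lambda>b. LBINT u:{a..b}. f u) \<longlongrightarrow> 0 - F a) at_top"
    by (rule Lim_transform_eventually)
  with lim show ?thesis
    using tendsto_unique[OF trivial_limit_at_top_linorder] by force
qed

text \<open>Here \<open>k m\<close> is the formula for the function on the m-th unit interval. The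
  jump of the floor is harmless because the formulas to the left and to the right of an integer
  agree there.\<close>

lemma continuous_on_floor_paste:
  fixes k :: "int \<Rightarrow> real \<Rightarrow> 'a::topological_space"
  assumes cont: "\<And>m. M \<le> m \<Longrightarrow> continuous_on {of_int m..of_int m + 1} (k m)"
    and match: "\<And>m. M \<le> m \<Longrightarrow> k m (of_int m + 1) = k (m + 1) (of_int m + 1)"
  shows "continuous_on {of_int M..} (\<lambda>u. k \<lfloor>u\<rfloor> u)"
proof -
  define F where "F = (\<lambda>u. k \<lfloor>u\<rfloor> u)"
  have Fm: "F u = k m u" if "M \<le> m" "u \<in> {of_int m..of_int m + 1}" for m u
  proof (cases "u = of_int m + 1")
    case True
    have "\<lfloor>real_of_int m + 1\<rfloor> = m + 1" by linarith
    then show ?thesis using True match[OF that(1)] by (simp add: F_def)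
  next
    case False
    then have "\<lfloor>u\<rfloor> = m" using that by (intro floor_unique) auto
    then show ?thesis by (simp add: F_def)
  qed
  have cF: "continuous_on {of_int m..of_int m + 1} F" if "M \<le> m" for m
    using cont[OF that] by (rule continuous_on_eq) (use Fm[OF that] in simp)
  have "continuous (at u within {of_int M..}) F" if "u \<in> {of_int M..}" for u
  proof (cases "\<lfloor>u\<rfloor> = M")
    case True
    have "at u within {of_int M..} = at u within ({of_int M..} \<inter> {..<of_int M + 1})"
      by (rule at_within_nhd[of _ "{..<of_int M + 1}"]) (use True in \<open>auto simp: floor_eq_iff\<close>)
    moreover have "{of_int M..} \<inter> {..<of_int M + 1} \<subseteq> {of_int M..of_int M + (1::real)}" by auto
    moreover have "u \<in> {of_int M..} \<inter> {..<of_int M + 1}" using True that by (auto simp: floor_eq_iff)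
    ultimately show ?thesis
      using continuous_on_subset[OF cF[of M]] unfolding continuous_on_eq_continuous_within by simp
  next
    case False
    define m where "m = \<lfloor>u\<rfloor>"
    have m: "M < m" "of_int m \<le> u" "u < of_int m + 1"
    proof -
      have "M \<le> \<lfloor>u\<rfloor>" using that by (simp add: le_floor_iff)
      then show "M < m" using False by (simp add: m_def)
    qed (simp_all add: m_def)
    \<comment> \<open>The point u may be the integer m itself, where two intervals meet, so both are
      joined to obtain a full neighbourhood. At the left end M only one side is present, which is
      why that case is separate.\<close>
    have "continuous_on ({of_int (m - 1)..of_int (m - 1) + 1} \<union> {of_int m..of_int m + 1}) F"
      by (rule continuous_on_closed_Un) (use m in \<open>auto intro!: cF simp del: of_int_diff\<close>)
    also have "{of_int (m - 1)..of_int (m - 1) + 1} \<union> {of_int m..of_int m + (1::real)} =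
        {of_int m - 1..of_int m + 1}" by auto
    finally have "continuous_on {of_int m - 1<..<of_int m + (1::real)} F"
      by (rule continuous_on_subset) auto
    then have "isCont F u"
      using m by (auto simp: continuous_on_eq_continuous_at)
    then show ?thesis by (rule continuous_at_imp_continuous_at_within)
  qed
  then show ?thesis unfolding F_def continuous_on_eq_continuous_within by blast
qed

lemma eventually_floor_eq:
  assumes "u \<notin> \<int>"
  shows "\<forall>\<^sub>F v in nhds (u::real). \<lfloor>v\<rfloor> = \<lfloor>u\<rfloor>"
proof -
  have "of_int \<lfloor>u\<rfloor> \<noteq> u" using assms by (metis Ints_of_int)
  then have "of_int \<lfloor>u\<rfloor> < u" "u < of_int \<lfloor>u\<rfloor> + 1" by linarith+
  then have "\<forall>\<^sub>F v in nhds u. v \<in> {of_int \<lfloor>u\<rfloor><..<of_int \<lfloor>u\<rfloor> + 1}"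
    by (intro eventually_nhds_in_open) auto
  then show ?thesis by eventually_elim (auto simp: floor_eq_iff)
qed

lemma has_vector_derivative_floor:
  assumes "u \<notin> \<int>" "(k \<lfloor>u\<rfloor> has_vector_derivative D) (at u)"
  shows "((\<lambda>v. k \<lfloor>v\<rfloor> v) has_vector_derivative D) (at (u::real))"
proof -
  obtain S where S: "open S" "u \<in> S" "\<And>v. v \<in> S \<Longrightarrow> \<lfloor>v\<rfloor> = \<lfloor>u\<rfloor>"
    using eventually_floor_eq[OF assms(1)] unfolding eventually_nhds by blast
  show ?thesis
    by (rule has_vector_derivative_transform_within_open[OF assms(2) S(1,2)]) (use S(3) in auto)
qed

section \<open>Euler--Maclaurin summation\<close>

text \<open>These are the Bernoulli polynomials B_(k+1) / (k+1)!, encoded as successive primitives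
  normalised to mean zero on [0, 1].\<close>

primrec bern :: "nat \<Rightarrow> real \<Rightarrow> real" where
  "bern 0 v = v - 1 / 2"
| "bern (Suc k) v = integral {0..v} (bern k) - integral {0..1} (\<lambda>w. integral {0..w} (bern k))"

definition per_bern :: "nat \<Rightarrow> real \<Rightarrow> real" where
  "per_bern k u = bern k (frac u)"

lemma continuous_on_bern: "continuous_on {0..1} (bern k)"
proof (induction k)
  case (Suc k)
  then show ?case
    by (auto intro!: continuous_intros indefinite_integral_continuous_1 integrable_continuous_real)
qed (auto intro!: continuous_intros)

lemma bern_derivative:
  assumes "v \<in> {0..1}"
  shows "(bern (Suc k) has_vector_derivative bern k v) (at v within {0..1})"
proof -
  have "((\<lambda>v. integral {0..v} (bern k) - integral {0..1} (\<lambda>w. integral {0..w} (bern k)))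
      has_vector_derivative bern k v - 0) (at v within {0..1})"
    by (intro has_vector_derivative_diff has_vector_derivative_const
          integral_has_vector_derivative[OF continuous_on_bern assms])
  moreover have "bern (Suc k) = (\<lambda>v. integral {0..v} (bern k) - integral {0..1} (\<lambda>w. integral {0..w} (bern k)))"
    by (simp add: fun_eq_iff)
  ultimately show ?thesis by simp
qed

lemma integral_bern: "integral {0..1} (bern k) = 0"
proof (cases k)
  case 0
  have "((\<lambda>v. v - 1 / 2) has_integral ((1^2/2 - 1/2) - (0^2/2 - 0/2::real))) {0..1}"
    by (rule fundamental_theorem_of_calculus)
       (auto intro!: derivative_eq_intros simp: has_real_derivative_iff_has_vector_derivative [symmetric])
  moreover have "bern 0 = (\<lambda>v. v - 1 / 2)" by (simp add: fun_eq_iff)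
  ultimately show ?thesis using 0 by (simp add: integral_unique)
next
  case (Suc j)
  have "(\<lambda>w. integral {0..w} (bern j)) integrable_on {0..1}"
    by (intro integrable_continuous_real indefinite_integral_continuous_1 continuous_on_bern)
  then have "integral {0..1} (\<lambda>v. integral {0..v} (bern j) - integral {0..1} (\<lambda>w. integral {0..w} (bern j))) = 0"
    by (subst integral_diff) auto
  moreover have "bern (Suc j) = (\<lambda>v. integral {0..v} (bern j) - integral {0..1} (\<lambda>w. integral {0..w} (bern j)))"
    by (simp add: fun_eq_iff)
  ultimately show ?thesis using Suc by simp
qed

text \<open>The difference of the end values is the integral of \<open>bern k\<close>, which
  vanishes. This makes the periodic extension continuous from index 1 on; at index 0 it is the
  sawtooth, which jumps.\<close>

lemma bern_Suc_1: "bern (Suc k) 1 = bern (Suc k) 0"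
  using integral_bern[of k] by simp

lemma bern_bounded: "\<exists>B. \<forall>v\<in>{0..1}. \<bar>bern k v\<bar> \<le> B"
  using compact_imp_bounded[OF compact_continuous_image[OF continuous_on_bern compact_Icc]]
  by (auto simp: bounded_iff)

lemma per_bern_bounded: "\<exists>B. \<forall>u. \<bar>per_bern k u\<bar> \<le> B"
proof -
  obtain B where B: "\<And>v. v \<in> {0..1} \<Longrightarrow> \<bar>bern k v\<bar> \<le> B" using bern_bounded by blast
  have "frac u \<in> {0..1}" for u :: real using frac_lt_1[of u] by simp
  then show ?thesis using B unfolding per_bern_def by blast
qed

lemma per_bern_0: "per_bern 0 u = frac u - 1 / 2" by (simp add: per_bern_def)

lemma per_bern_0_bound: "\<bar>per_bern 0 u\<bar> \<le> 1 / 2"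
  using frac_lt_1[of u] frac_ge_0[of u] unfolding per_bern_0 abs_le_iff by linarith

lemma per_bern_floor: "per_bern k u = bern k (u - of_int \<lfloor>u\<rfloor>)"
  by (simp add: per_bern_def frac_def)

lemma per_bern_of_nat: "per_bern k (of_nat n) = bern k 0"
  by (simp add: per_bern_floor)

lemma continuous_on_per_bern_Suc: "continuous_on {0..} (per_bern (Suc k))"
proof -
  have "continuous_on {of_int 0..} (\<lambda>u. (\<lambda>m u. bern (Suc k) (u - of_int m)) \<lfloor>u\<rfloor> u)"
    by (rule continuous_on_floor_paste)
       (auto intro!: continuous_on_compose2[OF continuous_on_bern[of "Suc k"]] continuous_intros
          simp: bern_Suc_1 simp del: bern.simps)
  then show ?thesis by (simp add: per_bern_floor[abs_def])
qed

lemma per_bern_Suc_derivative: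
  assumes "u \<notin> \<int>"
  shows "(per_bern (Suc k) has_vector_derivative per_bern k u) (at u)"
proof -
  let ?m = "\<lfloor>u\<rfloor>"
  have "of_int ?m \<noteq> u" using assms by (metis Ints_of_int)
  then have u: "of_int ?m < u" "u < of_int ?m + 1" by linarith+
  then have v: "u - of_int ?m \<in> {0<..<1}" by (simp, linarith)
  then have "(bern (Suc k) has_vector_derivative bern k (u - of_int ?m)) (at (u - of_int ?m))"
    using bern_derivative[of "u - of_int ?m" k] at_within_interior[of "u - of_int ?m" "{0..1::real}"]
    by (auto simp del: bern.simps)
  then have "((\<lambda>u. bern (Suc k) (u - of_int ?m)) has_vector_derivative
       1 *\<^sub>R bern k (u - of_int ?m)) (at u)"
    by (intro vector_diff_chain_at[unfolded o_def, of "\<lambda>u. u - of_int ?m" 1])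
       (auto intro!: derivative_eq_intros simp del: bern.simps)
  from has_vector_derivative_floor[OF assms, of "\<lambda>m u. bern (Suc k) (u - of_int m)", OF this]
  show ?thesis by (simp add: per_bern_floor[abs_def] del: bern.simps)
qed

lemma per_bern_measurable [measurable]: "per_bern k \<in> borel_measurable borel"
proof -
  \<comment> \<open>Continuity of \<open>bern k\<close> is known on [0, 1] only; the indicator
    yields a Borel function on the whole line, and the fractional part always lands where it equals
    1.\<close>
  have "(\<lambda>v. indicator {0..1} v *\<^sub>R bern k v) \<in> borel_measurable borel"
    by (intro borel_measurable_continuous_on_indicator continuous_on_bern) auto
  then have "(\<lambda>u. indicator {0..1} (u - of_int \<lfloor>u\<rfloor>) *\<^sub>R bern k (u - of_int \<lfloor>u\<rfloor>)) \<in> borel_measurable borel"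
    by (rule measurable_compose[rotated]) measurable
  moreover have "(\<lambda>u. indicator {0..1} (u - of_int \<lfloor>u\<rfloor>) *\<^sub>R bern k (u - of_int \<lfloor>u\<rfloor>)) = per_bern k"
  proof
    fix u :: real
    have "0 \<le> frac u" "frac u \<le> 1" using frac_lt_1[of u] by simp_all
    then show "indicator {0..1} (u - of_int \<lfloor>u\<rfloor>) *\<^sub>R bern k (u - of_int \<lfloor>u\<rfloor>) = per_bern k u"
      by (simp add: per_bern_floor frac_def)
  qed
  ultimately show ?thesis by simp
qed

lemma kern_tendsto_0:
  assumes "0 \<le> r" "0 < Re (a + c)"
  shows "(kern r a c \<longlongrightarrow> 0) at_top"
proof (rule Lim_null_comparison)
  show "\<forall>\<^sub>F u in at_top. norm (kern r a c u) \<le> 2 powr \<bar>Re c\<bar> * u powr (- Re (a + c))"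
    using eventually_ge_at_top[of "max 1 r"]
    by eventually_elim (intro norm_kern_le, use assms in auto)
  have "((\<lambda>u. u powr (- Re (a + c))) \<longlongrightarrow> 0) at_top"
    by (rule tendsto_neg_powr) (use assms in \<open>auto simp: filterlim_ident\<close>)
  from tendsto_mult_left[OF this] show "((\<lambda>u. 2 powr \<bar>Re c\<bar> * u powr (- Re (a + c))) \<longlongrightarrow> 0) at_top"
    by simp
qed

lemma bounded_mult_tendsto_0:
  fixes f :: "real \<Rightarrow> complex"
  assumes "(f \<longlongrightarrow> 0) F" "\<And>u. \<bar>P u\<bar> \<le> B"
  shows "((\<lambda>u. of_real (P u) * f u) \<longlongrightarrow> 0) F"
proof (rule Lim_null_comparison)
  show "\<forall>\<^sub>F u in F. norm (of_real (P u) * f u) \<le> B * norm (f u)"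
    by (intro always_eventually allI) (simp add: norm_mult assms mult_right_mono)
  show "((\<lambda>u. B * norm (f u)) \<longlongrightarrow> 0) F"
    using tendsto_mult_left[OF tendsto_norm_zero[OF assms(1)], of B] by simp
qed

text \<open>One Euler-Maclaurin step. The weight is replaced by its bounded primitive, and
  differentiating the kernel raises a or c by one, so the new integrals converge one unit further to
  the left in Re (a + c).\<close>

lemma kint_ibp:
  assumes y: "0 < y" "0 \<le> r" "r \<le> y" and ac: "1 < Re (a + c)"
  shows "kint (per_bern k) r a c y = - of_real (per_bern (Suc k) y) * kern r a c y
     + a * kint (per_bern (Suc k)) r (a + 1) c y + c * kint (per_bern (Suc k)) r a (c + 1) y"
proof -
  obtain B0 where B0: "\<And>u. \<bar>per_bern k u\<bar> \<le> B0" using per_bern_bounded by blast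
  obtain B1 where B1: "\<And>u. \<bar>per_bern (Suc k) u\<bar> \<le> B1" using per_bern_bounded by blast
  let ?K = "\<lambda>a c u. of_real (per_bern (Suc k) u) * kern r a c u"
  let ?f = "\<lambda>u. of_real (per_bern k u) * kern r a c u - (a * ?K (a + 1) c u + c * ?K a (c + 1) u)"
  note i0 = kern_integrable(1)[OF per_bern_measurable B0 y ac]
  have i1: "set_integrable lborel {y..} (\<lambda>u. a * ?K (a + 1) c u)"
    using kern_integrable(1)[OF per_bern_measurable B1 y, of "a + 1" c] ac by auto
  have i2: "set_integrable lborel {y..} (\<lambda>u. c * ?K a (c + 1) u)"
    using kern_integrable(1)[OF per_bern_measurable B1 y, of a "c + 1"] ac by auto
  have "(LBINT u:{y..}. ?f u) = - ?K a c y"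
  proof (rule FTC_off_Ints_at_top)
    show "continuous_on {y..} (?K a c)"
      by (intro continuous_intros continuous_on_kern)
         (use y in \<open>auto intro: continuous_on_subset[OF continuous_on_per_bern_Suc]\<close>)
    show "(?K a c has_vector_derivative ?f u) (at u)" if "y < u" "u \<notin> \<int>" for u
    proof -
      have "(?K a c has_vector_derivative
         of_real (per_bern (Suc k) u) * (- a * kern r (a + 1) c u - c * kern r a (c + 1) u)
         + of_real (per_bern k u) * kern r a c u) (at u)"
        by (intro has_vector_derivative_mult kern_has_vector_derivative
              has_vector_derivative_of_real)
           (use y that per_bern_Suc_derivative in
              \<open>auto simp: has_real_derivative_iff_has_vector_derivative\<close>)
      then show ?thesis by (rule has_vector_derivative_eq_rhs) (simp add: algebra_simps)
    qed
    show "set_integrable lborel {y..} ?f"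
      by (intro set_integral_diff set_integral_add i0 i1 i2)
    show "(?K a c \<longlongrightarrow> 0) at_top"
      by (intro bounded_mult_tendsto_0[OF kern_tendsto_0 B1]) (use y ac in auto)
  qed
  moreover have "(LBINT u:{y..}. ?f u) = kint (per_bern k) r a c y
      - (a * kint (per_bern (Suc k)) r (a + 1) c y + c * kint (per_bern (Suc k)) r a (c + 1) y)"
    unfolding kint_def
    by (simp only: set_integral_diff(2)[OF i0 set_integral_add(1)[OF i1 i2]]
         set_integral_add(2)[OF i1 i2] set_integral_mult_right)
  ultimately show ?thesis by (simp add: algebra_simps)
qed

text \<open>The integral of the kernel over the half-line, continued to Re (a + c) > 0 off a + c =
  1. It arises from differentiating the product of u to the power 1 - a and u + r to the power -c,
  and then writing u = (u + r) - r. Its two summands become the main terms of the approximate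
  formula.\<close>

definition kreg :: "real \<Rightarrow> complex \<Rightarrow> complex \<Rightarrow> real \<Rightarrow> complex" where
  "kreg r a c y = (of_real y powr (1 - a) * of_real (y + r) powr (- c)
     + c * of_real r * kint (\<lambda>_. 1) r a (c + 1) y) / (a + c - 1)"

lemma kint_split:
  assumes P: "P \<in> borel_measurable borel" "\<And>u. \<bar>P u\<bar> \<le> B"
    and "0 < y" "0 \<le> r" "r \<le> y" "1 < Re (a + c)" "y \<le> z"
  shows "kint P r a c y = (LBINT u:{y..z}. of_real (P u) * kern r a c u) + kint P r a c z"
proof -
  note si = kern_integrable(1)[OF assms(1-6)]
  have "set_integrable lborel {y..z} (\<lambda>u. of_real (P u) * kern r a c u)"
    by (rule set_integrable_subset[OF si]) auto
  moreover have i2: "set_integrable lborel {z<..} (\<lambda>u. of_real (P u) * kern r a c u)"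
    by (rule set_integrable_subset[OF si]) (use \<open>y \<le> z\<close> in auto)
  moreover have "{y..} = {y..z} \<union> {z<..}" using \<open>y \<le> z\<close> by auto
  ultimately have "kint P r a c y = (LBINT u:{y..z}. of_real (P u) * kern r a c u)
        + (LBINT u:{z<..}. of_real (P u) * kern r a c u)"
    unfolding kint_def by (metis (no_types, lifting) set_integral_Un disjoint_iff atLeastAtMost_iff
        greaterThan_iff not_le)
  also have "(LBINT u:{z<..}. of_real (P u) * kern r a c u) = kint P r a c z"
    unfolding kint_def
  proof (rule set_integral_cong_set)
    have "set_integrable lborel {z..} (\<lambda>u. of_real (P u) * kern r a c u)"
      by (rule set_integrable_subset[OF si]) (use \<open>y \<le> z\<close> in auto)
    then show "set_borel_measurable lborel {z..} (\<lambda>u. of_real (P u) * kern r a c u)"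
      unfolding set_borel_measurable_def set_integrable_def by (rule borel_measurable_integrable)
    show "set_borel_measurable lborel {z<..} (\<lambda>u. of_real (P u) * kern r a c u)"
      using i2 unfolding set_borel_measurable_def set_integrable_def by (rule borel_measurable_integrable)
    show "AE u in lborel. (u \<in> {z..}) = (u \<in> {z<..})"
      using AE_lborel_singleton[of z] by eventually_elim auto
  qed
  finally show ?thesis .
qed

lemma kint_tendsto_0:
  assumes "P \<in> borel_measurable borel" "\<And>u. \<bar>P u\<bar> \<le> B"
    and "0 \<le> r" "1 < Re (a + c)"
  shows "(kint P r a c \<longlongrightarrow> 0) at_top"
proof (rule Lim_null_comparison)
  let ?s = "Re (a + c)"
  show "\<forall>\<^sub>F y in at_top. norm (kint P r a c y) \<le>
      B * 2 powr \<bar>Re c\<bar> * (y powr (- (?s - 1)) / (?s - 1))"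
    using eventually_ge_at_top[of "max 1 r"]
  proof eventually_elim
    case (elim y)
    then show ?case
      using kern_integrable(2)[of P B y r a c] assms by simp
  qed
  have "((\<lambda>u. u powr (- (?s - 1))) \<longlongrightarrow> 0) at_top"
    by (rule tendsto_neg_powr) (use assms in \<open>auto simp: filterlim_ident\<close>)
  from tendsto_mult_left[OF tendsto_divide_zero[OF this]]
  show "((\<lambda>y. B * 2 powr \<bar>Re c\<bar> * (y powr (- (?s - 1)) / (?s - 1))) \<longlongrightarrow> 0) at_top"
    by simp
qed

lemma kern_shift_a:
  assumes "0 < u" shows "kern r (a - 1) c u = of_real u * kern r a c u"
proof -
  have "complex_of_real u powr (1 + -a) = of_real u * of_real u powr (-a)"
    unfolding powr_add using assms by simp
  then show ?thesis by (simp add: kern_def)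
qed

lemma kern_shift_c:
  assumes "0 < u" "0 \<le> r" shows "kern r a c u = of_real (u + r) * kern r a (c + 1) u"
proof -
  have "complex_of_real (u + r) powr (1 + -(c+1)) = of_real (u + r) * of_real (u + r) powr (-(c+1))"
    unfolding powr_add using assms by simp
  then show ?thesis by (simp add: kern_def)
qed

text \<open>Up to sign \<open>kreg r a c\<close> is a primitive of the kernel in y. This holds also
  where the integral over the half-line diverges, so the starting point can be moved throughout Re
  (a + c) > 0.\<close>

lemma kreg_split:
  assumes y: "0 < y" "0 \<le> r" "r \<le> y" "y \<le> z" and ac: "0 < Re (a + c)" "a + c \<noteq> 1"
  shows "kreg r a c y = (LBINT u:{y..z}. kern r a c u) + kreg r a c z"
proof -
  let ?f = "\<lambda>u. (1 - a - c) * kern r a c u + c * of_real r * kern r a (c + 1) u"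
  have cont: "continuous_on {y..z} (kern r a' c')" for a' c'
    by (rule continuous_on_kern) (use y in auto)
  have i: "set_integrable lborel {y..z} (kern r a' c')" for a' c'
    by (rule borel_integrable_atLeastAtMost'[OF cont])
  have "(LBINT u:{y..z}. ?f u) = kern r (a - 1) c z - kern r (a - 1) c y"
  proof (rule FTC_off_Ints[OF \<open>y \<le> z\<close> cont])
    show "(kern r (a - 1) c has_vector_derivative ?f u) (at u)" if "y < u" for u
    proof -
      have "(kern r (a - 1) c has_vector_derivative
          - (a - 1) * kern r a c u - c * kern r (a - 1) (c + 1) u) (at u)"
        using kern_has_vector_derivative[of u r "a - 1" c] that y by simp
      moreover have "kern r (a - 1) (c + 1) u = kern r a c u - of_real r * kern r a (c + 1) u"
        using kern_shift_a[of u r a "c + 1"] kern_shift_c[of u r a c] that y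
        by (simp add: algebra_simps)
      then have "- (a - 1) * kern r a c u - c * kern r (a - 1) (c + 1) u = ?f u"
        by (simp only:) (simp add: algebra_simps)
      ultimately show ?thesis
        by simp
    qed
    show "set_integrable lborel {y..z} ?f"
      by (intro set_integral_add set_integrable_mult_right) (use i in auto)
  qed
  also have "(LBINT u:{y..z}. ?f u) = (1 - a - c) * (LBINT u:{y..z}. kern r a c u)
      + c * of_real r * (LBINT u:{y..z}. kern r a (c + 1) u)"
    by (subst set_integral_add(2)) (use i in auto)
  finally have eq: "(a + c - 1) * (LBINT u:{y..z}. kern r a c u) = kern r (a - 1) c y - kern r (a - 1) c z
      + c * of_real r * (LBINT u:{y..z}. kern r a (c + 1) u)"
    by (simp add: algebra_simps)
  have "kint (\<lambda>_. 1) r a (c + 1) y = (LBINT u:{y..z}. kern r a (c + 1) u) + kint (\<lambda>_. 1) r a (c + 1) z"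
    using kint_split[of "\<lambda>_. 1" 1 y r a "c + 1" z] y ac by simp
  moreover have kr: "(a + c - 1) * kreg r a c t = kern r (a - 1) c t + c * of_real r * kint (\<lambda>_. 1) r a (c + 1) t" for t
    using ac(2) unfolding kreg_def by (simp add: kern_def)
  ultimately have "(a + c - 1) * kreg r a c y = (a + c - 1) * ((LBINT u:{y..z}. kern r a c u) + kreg r a c z)"
    unfolding distrib_left kr eq by (simp add: algebra_simps)
  then show ?thesis using ac(2) by simp
qed

lemma kreg_tendsto_0:
  assumes "0 \<le> r" "1 < Re (a + c)"
  shows "(kreg r a c \<longlongrightarrow> 0) at_top"
proof -
  have "((\<lambda>y. (kern r (a - 1) c y + c * of_real r * kint (\<lambda>_. 1) r a (c + 1) y) / (a + c - 1))
      \<longlongrightarrow> (0 + c * of_real r * 0) / (a + c - 1)) at_top"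
    by (intro tendsto_intros kern_tendsto_0 kint_tendsto_0[of _ 1]) (use assms in \<open>auto dest: arg_cong[of _ _ Re]\<close>)
  then show ?thesis by (simp add: kreg_def[abs_def] kern_def)
qed

text \<open>Both sides change by the same finite integral when y moves to the right, and both tend
  to 0 at infinity.\<close>

lemma kint_eq_kreg:
  assumes "0 < y" "0 \<le> r" "r \<le> y" "1 < Re (a + c)"
  shows "kint (\<lambda>_. 1) r a c y = kreg r a c y"
proof -
  have "((\<lambda>z. kint (\<lambda>_. 1) r a c z - kreg r a c z) \<longlongrightarrow> 0 - 0) (at_top :: real filter)"
    by (intro tendsto_intros kreg_tendsto_0 kint_tendsto_0[of _ 1]) (use assms in auto)
  moreover have "\<forall>\<^sub>F z in at_top. kint (\<lambda>_. 1) r a c z - kreg r a c z = kint (\<lambda>_. 1) r a c y - kreg r a c y"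
    using eventually_ge_at_top[of y]
  proof eventually_elim
    case (elim z)
    have "a + c \<noteq> 1" using assms(4) by (auto dest: arg_cong[of _ _ Re])
    then show ?case using kint_split[of "\<lambda>_. 1" 1 y r a c z] kreg_split[of y r z a c] elim assms
      by simp
  qed
  ultimately have "((\<lambda>_. kint (\<lambda>_. 1) r a c y - kreg r a c y) \<longlongrightarrow> 0) (at_top :: real filter)"
    by (simp add: tendsto_cong)
  then have "kint (\<lambda>_. 1) r a c y - kreg r a c y = 0"
    by (simp add: tendsto_const_iff)
  then show ?thesis by simp
qed

text \<open>The sum of kern over the integers above y, with the integral that occurs in Euler--Maclaurin
  summation replaced by its analytic continuation kreg; it makes sense for Re (a + c) > 0.\<close>

definition ktail :: "real \<Rightarrow> complex \<Rightarrow> complex \<Rightarrow> real \<Rightarrow> complex" where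
  "ktail r a c y = kreg r a c y + of_real (per_bern 0 y) * kern r a c y
     - a * kint (per_bern 0) r (a + 1) c y - c * kint (per_bern 0) r a (c + 1) y"

text \<open>Euler-Maclaurin summation on a finite interval, arranged so that only the regularised
  integral \<open>kreg\<close> and absolutely convergent sawtooth integrals occur. It makes
  \<open>ktail\<close> behave like a tail sum even when no such sum converges.\<close>

lemma ktail_split:
  assumes y: "0 < y" "0 \<le> r" "r \<le> y" "y \<le> z" and ac: "0 < Re (a + c)" "a + c \<noteq> 1"
  shows "ktail r a c y = (\<Sum>m\<in>{nat \<lfloor>y\<rfloor><..nat \<lfloor>z\<rfloor>}. kern r a c (of_nat m)) + ktail r a c z"
proof -
  let ?D = "\<lambda>u. - a * kern r (a + 1) c u - c * kern r a (c + 1) u"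
  \<comment> \<open>At m + 1 the partial sum gains one value of the kernel while the coefficient of
    the sawtooth drops from 1/2 to -1/2; the two jumps cancel, so F is continuous.\<close>
  define k where "k = (\<lambda>m u. (\<Sum>j\<in>{nat \<lfloor>y\<rfloor><..nat m}. kern r a c (of_nat j))
     + of_real (bern 0 (u - of_int m)) * kern r a c u)"
  define F where "F = (\<lambda>u. k \<lfloor>u\<rfloor> u)"
  have F: "F u = (\<Sum>j\<in>{nat \<lfloor>y\<rfloor><..nat \<lfloor>u\<rfloor>}. kern r a c (of_nat j))
     + of_real (per_bern 0 u) * kern r a c u" for u
    by (simp add: F_def k_def per_bern_floor)
  have y0: "0 \<le> \<lfloor>y\<rfloor>" using y by simp
  let ?f = "\<lambda>u. kern r a c u + of_real (per_bern 0 u) * ?D u"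
  have cont: "continuous_on {y..z} (kern r a' c')" for a' c'
    by (rule continuous_on_kern) (use y in auto)
  have i: "set_integrable lborel {y..z} (kern r a' c')" for a' c'
    by (rule borel_integrable_atLeastAtMost'[OF cont])
  have ip: "set_integrable lborel {y..z} (\<lambda>u. of_real (per_bern 0 u) * kern r a' c' u)"
    if "1 < Re (a' + c')" for a' c'
    by (rule set_integrable_subset[OF kern_integrable(1)[OF per_bern_measurable per_bern_0_bound y(1-3) that]]) auto
  have i1: "set_integrable lborel {y..z} (\<lambda>u. of_real (per_bern 0 u) * kern r (a + 1) c u)"
    and i2: "set_integrable lborel {y..z} (\<lambda>u. of_real (per_bern 0 u) * kern r a (c + 1) u)"
    by (rule ip; use ac in simp)+
  have f_eq: "?f = (\<lambda>u. kern r a c u - (a * (of_real (per_bern 0 u) * kern r (a + 1) c u)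
       + c * (of_real (per_bern 0 u) * kern r a (c + 1) u)))"
    by (auto simp: algebra_simps)
  have si: "set_integrable lborel {y..z} ?f"
    unfolding f_eq by (intro set_integral_diff set_integral_add set_integrable_mult_right) (use i i1 i2 in auto)
  have "(LBINT u:{y..z}. ?f u) = F z - F y"
  proof (rule FTC_off_Ints[OF \<open>y \<le> z\<close> _ _ si])
    have "continuous_on ({y..z} \<inter> {of_int \<lfloor>y\<rfloor>..}) F"
    \<comment> \<open>The kernel need not be continuous at u = 0. If y lies in the first unit
      interval, the pasting starts at 1 and the piece from y to 1 is treated by hand.\<close>
    proof (cases "\<lfloor>y\<rfloor> = 0")
      case False
      have "continuous_on {of_int \<lfloor>y\<rfloor>..} F"
        unfolding F_def
      proof (rule continuous_on_floor_paste)
        fix m assume m: "\<lfloor>y\<rfloor> \<le> m"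
        with False y0 have "0 < m" by linarith
        show "continuous_on {of_int m..of_int m + 1} (k m)"
          unfolding k_def bern.simps
          by (intro continuous_intros continuous_on_kern)
             (use \<open>0 < m\<close> y in \<open>auto simp flip: of_int_0_less_iff\<close>)
        have "{nat \<lfloor>y\<rfloor><..nat (m + 1)} = insert (nat (m + 1)) {nat \<lfloor>y\<rfloor><..nat m}"
          using m y0 \<open>0 < m\<close> by (auto simp: nat_add_distrib)
        then show "k m (of_int m + 1) = k (m + 1) (of_int m + 1)"
          using m y0 \<open>0 < m\<close> by (simp add: k_def field_simps)
      qed
      then show ?thesis by (rule continuous_on_subset) auto
    next
      case True
      have "continuous_on {y..1} (k 0)"
        unfolding k_def bern.simps
        by (intro continuous_intros continuous_on_kern) (use y in auto)
      then have c1: "continuous_on ({y..z} \<inter> {y..1}) F"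
      proof (rule continuous_on_eq[OF continuous_on_subset])
        fix u assume u: "u \<in> {y..z} \<inter> {y..1}"
        show "k 0 u = F u"
        proof (cases "u = 1")
          case True
          moreover have "{0<..Suc 0} = {1}" by auto
          ultimately show ?thesis using \<open>\<lfloor>y\<rfloor> = 0\<close>
            by (simp add: F_def k_def field_simps)
        next
          case False
          then have "\<lfloor>u\<rfloor> = 0" using u y by (auto simp: floor_eq_iff)
          then show ?thesis by (simp add: F_def)
        qed
      qed auto
      have "continuous_on {of_int 1..} F"
        unfolding F_def
      proof (rule continuous_on_floor_paste)
        fix m :: int assume m: "1 \<le> m"
        show "continuous_on {of_int m..of_int m + 1} (k m)"
          unfolding k_def bern.simps
          by (intro continuous_intros continuous_on_kern) (use m y in \<open>auto simp flip: of_int_1_le_iff\<close>)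
        have "{nat \<lfloor>y\<rfloor><..nat (m + 1)} = insert (nat (m + 1)) {nat \<lfloor>y\<rfloor><..nat m}"
          using m True by auto
        then show "k m (of_int m + 1) = k (m + 1) (of_int m + 1)"
          using m True by (simp add: k_def field_simps)
      qed
      then have c2: "continuous_on ({y..z} \<inter> {1..}) F"
        by (rule continuous_on_subset) auto
      have "continuous_on ({y..z} \<inter> {y..1} \<union> {y..z} \<inter> {1..}) F"
        by (rule continuous_on_closed_Un[OF _ _ c1 c2]) auto
      then show ?thesis by (rule continuous_on_subset) (use y in auto)
    qed
    then show "continuous_on {y..z} F"
      by (rule continuous_on_subset) (use y in \<open>auto simp: le_floor_iff intro: order_trans[OF of_int_floor_le]\<close>)
  next
    fix u assume u: "y < u" "u < z" "u \<notin> \<int>"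
    have "(k \<lfloor>u\<rfloor> has_vector_derivative
        0 + (of_real (bern 0 (u - of_int \<lfloor>u\<rfloor>)) * ?D u + of_real 1 * kern r a c u)) (at u)"
      unfolding k_def bern.simps
      by (intro has_vector_derivative_mult kern_has_vector_derivative has_vector_derivative_add
              has_vector_derivative_of_real has_vector_derivative_const)
         (use y u in \<open>auto intro!: derivative_eq_intros\<close>)
    from has_vector_derivative_floor[where k = k, OF u(3) this]
    show "(F has_vector_derivative ?f u) (at u)"
      unfolding F_def per_bern_floor
      by (rule has_vector_derivative_eq_rhs) (simp add: algebra_simps)
  qed
  moreover define I0 where "I0 = (LBINT u:{y..z}. kern r a c u)"
  define I1 where "I1 = (LBINT u:{y..z}. of_real (per_bern 0 u) * kern r (a + 1) c u)"
  define I2 where "I2 = (LBINT u:{y..z}. of_real (per_bern 0 u) * kern r a (c + 1) u)"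
  have "(LBINT u:{y..z}. ?f u) = I0 - (a * I1 + c * I2)"
    unfolding f_eq I0_def I1_def I2_def
    by (subst set_integral_diff(2)) (use i i1 i2 in \<open>auto simp: set_integral_add\<close>)
  ultimately have "F z - F y = I0 - (a * I1 + c * I2)"
    by simp
  moreover have "kint (per_bern 0) r (a + 1) c y = I1 + kint (per_bern 0) r (a + 1) c z"
    unfolding I1_def by (rule kint_split[OF per_bern_measurable per_bern_0_bound]) (use y ac in auto)
  moreover have "kint (per_bern 0) r a (c + 1) y = I2 + kint (per_bern 0) r a (c + 1) z"
    unfolding I2_def by (rule kint_split[OF per_bern_measurable per_bern_0_bound]) (use y ac in auto)
  moreover have "kreg r a c y = I0 + kreg r a c z"
    unfolding I0_def by (rule kreg_split[OF y ac])
  ultimately show ?thesis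
    unfolding ktail_def F by (simp add: algebra_simps)
qed

section \<open>Holomorphy in three variables and parameter integrals\<close>

text \<open>A bound for h itself suffices: Cauchy's inequality turns it into a bound for the
  derivative, hence for the difference quotients, and dominated convergence applies along every
  sequence tending to z.\<close>

lemma integral_field_differentiable:
  fixes h :: "'x \<Rightarrow> complex \<Rightarrow> complex"
  assumes e: "0 < e" and hol: "\<And>x. x \<in> space M \<Longrightarrow> h x holomorphic_on ball z e"
    and meas: "\<And>w. w \<in> ball z e \<Longrightarrow> (\<lambda>x. h x w) \<in> borel_measurable M"
    and W: "integrable M W" "\<And>x w. x \<in> space M \<Longrightarrow> w \<in> ball z e \<Longrightarrow> norm (h x w) \<le> W x"
  shows "(\<lambda>w. \<integral>x. h x w \<partial>M) field_differentiable (at z)"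
proof -
  let ?D = "\<lambda>x. deriv (h x) z"
  let ?q = "\<lambda>w x. (h x w - h x z) / (w - z)"
  have z: "z \<in> ball z e" using e by simp
  have int: "integrable M (\<lambda>x. h x w)" if "w \<in> ball z e" for w
    by (rule Bochner_Integration.integrable_bound[OF W(1) meas[OF that]])
       (use W(2) that in \<open>fastforce intro!: AE_I2\<close>)
  have der: "(h x has_field_derivative deriv (h x) w) (at w)" if "x \<in> space M" "w \<in> ball z e" for x w
    using holomorphic_derivI[OF hol open_ball] that by blast
  \<comment> \<open>A disc of radius e / 4 about a point of the ball of radius e / 2 stays inside
    the ball of radius e; this gives the constant 4 / e.\<close>
  have db: "norm (deriv (h x) w) \<le> 4 / e * W x" if x: "x \<in> space M" and w: "w \<in> ball z (e / 2)" for x w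
  proof -
    have sub: "cball w (e / 4) \<subseteq> ball z e"
    proof
      fix v assume "v \<in> cball w (e / 4)"
      then show "v \<in> ball z e"
        using w dist_triangle[of z v w] e by (simp add: dist_commute)
    qed
    have "norm ((deriv ^^ 1) (h x) w) \<le> fact 1 * W x / (e / 4) ^ 1"
    proof (rule Cauchy_inequality)
      show "h x holomorphic_on ball w (e / 4)" "continuous_on (cball w (e / 4)) (h x)"
        using sub ball_subset_cball[of w "e/4"] holomorphic_on_subset[OF hol[OF x]]
          holomorphic_on_imp_continuous_on by blast+
      show "norm (h x v) \<le> W x" if "norm (w - v) = e / 4" for v
        using that W(2)[OF x, of v] sub by (auto simp: dist_norm)
    qed (use e in auto)
    then show ?thesis by (simp add: field_simps)
  qed
  have qb: "norm (?q w x) \<le> 4 / e * W x" if "x \<in> space M" "w \<in> ball z (e / 2) - {z}" for x w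
  proof -
    have "norm (h x w - h x z) \<le> 4 / e * W x * norm (w - z)"
    proof (rule field_differentiable_bound[OF convex_ball[of z "e/2"]])
      show "(h x has_field_derivative deriv (h x) v) (at v within ball z (e / 2))"
        if "v \<in> ball z (e / 2)" for v
        using der[of x v] that \<open>x \<in> space M\<close> e by (auto intro: has_field_derivative_at_within)
    qed (use that db e in auto)
    then show ?thesis using that by (simp add: norm_divide field_simps)
  qed
  have lim: "((\<lambda>w. ?q w x) \<longlongrightarrow> ?D x) (at z)" if "x \<in> space M" for x
    using der[OF that z] unfolding has_field_derivative_iff .
  have "((\<lambda>w. ((\<integral>x. h x w \<partial>M) - (\<integral>x. h x z \<partial>M)) / (w - z)) \<longlongrightarrow> (\<integral>x. ?D x \<partial>M)) (at z within ball z (e / 2))"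
    unfolding tendsto_at_iff_sequentially o_def
  proof (intro allI impI)
    fix X assume X: "\<forall>i. X i \<in> ball z (e / 2) - {z}" "X \<longlonglongrightarrow> z"
    have Xe: "X i \<in> ball z e" for i using X(1) e by (auto dest!: spec[of _ i])
    have flt: "filterlim X (at z) sequentially"
      using X by (auto simp: filterlim_at)
    have ql: "(\<lambda>i. ?q (X i) x) \<longlonglongrightarrow> ?D x" if "x \<in> space M" for x
      by (rule filterlim_compose[OF lim[OF that] flt])
    have qm: "?q (X i) \<in> borel_measurable M" for i
      using meas[OF Xe[of i]] meas[OF z] by measurable
    have "(\<lambda>i. \<integral>x. ?q (X i) x \<partial>M) \<longlonglongrightarrow> (\<integral>x. ?D x \<partial>M)"
    proof (rule integral_dominated_convergence)
      show "?D \<in> borel_measurable M"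
        by (rule borel_measurable_LIMSEQ_metric[OF qm ql])
      show "integrable M (\<lambda>x. 4 / e * W x)" using W(1) by simp
      show "AE x in M. (\<lambda>i. ?q (X i) x) \<longlonglongrightarrow> ?D x" using ql by auto
      show "AE x in M. norm (?q (X i) x) \<le> 4 / e * W x" for i
        using qb X(1) by auto
    qed (rule qm)
    moreover have "(\<integral>x. ?q (X i) x \<partial>M) = ((\<integral>x. h x (X i) \<partial>M) - (\<integral>x. h x z \<partial>M)) / (X i - z)" for i
      unfolding integral_divide_zero using int[OF Xe[of i]] int[OF z] by simp
    ultimately show "(\<lambda>i. ((\<integral>x. h x (X i) \<partial>M) - (\<integral>x. h x z \<partial>M)) / (X i - z)) \<longlonglongrightarrow> (\<integral>x. ?D x \<partial>M)"
      by (simp only:)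
  qed
  then have "((\<lambda>w. \<integral>x. h x w \<partial>M) has_field_derivative (\<integral>x. ?D x \<partial>M)) (at z)"
    using at_within_open[of z "ball z (e / 2)"] e by (simp add: has_field_derivative_iff)
  then show ?thesis by (auto simp: field_differentiable_def)
qed

lemma holo3I:
  assumes "open D" "continuous_on D (\<lambda>(a, b, c). f a b c)"
    and "\<And>a b c. (a, b, c) \<in> D \<Longrightarrow> (\<lambda>z. f z b c) field_differentiable (at a)"
    and "\<And>a b c. (a, b, c) \<in> D \<Longrightarrow> (\<lambda>z. f a z c) field_differentiable (at b)"
    and "\<And>a b c. (a, b, c) \<in> D \<Longrightarrow> (\<lambda>z. f a b z) field_differentiable (at c)"
  shows "holo3 f D"
  using assms unfolding holo3_def by blast

lemma holo3D:
  assumes "holo3 f D"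
  shows "open D" "continuous_on D (\<lambda>p. f (fst p) (fst (snd p)) (snd (snd p)))"
    "(a, b, c) \<in> D \<Longrightarrow> (\<lambda>z. f z b c) field_differentiable (at a)"
    "(a, b, c) \<in> D \<Longrightarrow> (\<lambda>z. f a z c) field_differentiable (at b)"
    "(a, b, c) \<in> D \<Longrightarrow> (\<lambda>z. f a b z) field_differentiable (at c)"
  using assms unfolding holo3_def by (auto simp: case_prod_unfold)

lemma holo3_const [intro]: "open D \<Longrightarrow> holo3 (\<lambda>a b c. k) D"
  unfolding holo3_def by (simp add: case_prod_unfold)

lemma holo3_proj:
  assumes "open D"
  shows "holo3 (\<lambda>a b c. a) D" "holo3 (\<lambda>a b c. b) D" "holo3 (\<lambda>a b c. c) D"
  using assms unfolding holo3_def case_prod_unfold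
  by (simp_all add: continuous_on_fst continuous_on_snd continuous_on_id)

lemma holo3_add:
  assumes "holo3 f D" "holo3 g D"
  shows "holo3 (\<lambda>a b c. f a b c + g a b c) D"
proof (rule holo3I)
  note f' = holo3D[OF assms(1)] and g' = holo3D[OF assms(2)]
  show "open D" by (rule f'(1))
  show "continuous_on D (\<lambda>(a, b, c). f a b c + g a b c)"
    unfolding case_prod_unfold by (intro continuous_intros f'(2) g'(2))
  fix a b c assume p: "(a, b, c) \<in> D"
  show "(\<lambda>z. f z b c + g z b c) field_differentiable (at a)"
    "(\<lambda>z. f a z c + g a z c) field_differentiable (at b)"
    "(\<lambda>z. f a b z + g a b z) field_differentiable (at c)"
    by (intro field_differentiable_add f'(3-5)[OF p] g'(3-5)[OF p])+
qed

lemma holo3_diff: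
  assumes "holo3 f D" "holo3 g D"
  shows "holo3 (\<lambda>a b c. f a b c - g a b c) D"
proof (rule holo3I)
  note f' = holo3D[OF assms(1)] and g' = holo3D[OF assms(2)]
  show "open D" by (rule f'(1))
  show "continuous_on D (\<lambda>(a, b, c). f a b c - g a b c)"
    unfolding case_prod_unfold by (intro continuous_intros f'(2) g'(2))
  fix a b c assume p: "(a, b, c) \<in> D"
  show "(\<lambda>z. f z b c - g z b c) field_differentiable (at a)"
    "(\<lambda>z. f a z c - g a z c) field_differentiable (at b)"
    "(\<lambda>z. f a b z - g a b z) field_differentiable (at c)"
    by (intro field_differentiable_diff f'(3-5)[OF p] g'(3-5)[OF p])+
qed

lemma holo3_mult:
  assumes "holo3 f D" "holo3 g D"
  shows "holo3 (\<lambda>a b c. f a b c * g a b c) D"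
proof (rule holo3I)
  note f' = holo3D[OF assms(1)] and g' = holo3D[OF assms(2)]
  show "open D" by (rule f'(1))
  show "continuous_on D (\<lambda>(a, b, c). f a b c * g a b c)"
    unfolding case_prod_unfold by (intro continuous_intros f'(2) g'(2))
  fix a b c assume p: "(a, b, c) \<in> D"
  show "(\<lambda>z. f z b c * g z b c) field_differentiable (at a)"
    "(\<lambda>z. f a z c * g a z c) field_differentiable (at b)"
    "(\<lambda>z. f a b z * g a b z) field_differentiable (at c)"
    by (intro field_differentiable_mult f'(3-5)[OF p] g'(3-5)[OF p])+
qed

text \<open>The rules for inverses, for powers with a fixed base and for zeta values at a linear
  form in the variables are all instances of composition with a function of one variable.\<close>

lemma holo3_compose:
  assumes g: "g holomorphic_on U" "open U" and f: "holo3 f D"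
    and sub: "\<And>a b c. (a, b, c) \<in> D \<Longrightarrow> f a b c \<in> U"
  shows "holo3 (\<lambda>a b c. g (f a b c)) D"
proof (rule holo3I)
  note f' = holo3D[OF f]
  show "open D" by (rule f'(1))
  have "continuous_on D (\<lambda>p. g (f (fst p) (fst (snd p)) (snd (snd p))))"
    by (rule continuous_on_compose2[OF holomorphic_on_imp_continuous_on[OF g(1)] f'(2)])
       (use sub in auto)
  then show "continuous_on D (\<lambda>(a, b, c). g (f a b c))" by (simp add: case_prod_unfold)
  fix a b c assume p: "(a, b, c) \<in> D"
  have "g field_differentiable (at (f a b c))"
    using g sub[OF p] holomorphic_on_imp_differentiable_at by blast
  then show "(\<lambda>z. g (f z b c)) field_differentiable (at a)" "(\<lambda>z. g (f a z c)) field_differentiable (at b)"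
    "(\<lambda>z. g (f a b z)) field_differentiable (at c)"
    using field_differentiable_compose[OF f'(3)[OF p], of g]
      field_differentiable_compose[OF f'(4)[OF p], of g]
      field_differentiable_compose[OF f'(5)[OF p], of g] unfolding o_def by simp_all
qed

lemma holo3_inverse:
  assumes "holo3 f D" "\<And>a b c. (a, b, c) \<in> D \<Longrightarrow> f a b c \<noteq> 0"
  shows "holo3 (\<lambda>a b c. inverse (f a b c)) D"
  by (rule holo3_compose[of inverse "- {0}"]) (use assms in \<open>auto intro!: holomorphic_intros\<close>)

lemma holo3_divide:
  assumes "holo3 f D" "holo3 g D" "\<And>a b c. (a, b, c) \<in> D \<Longrightarrow> g a b c \<noteq> 0"
  shows "holo3 (\<lambda>a b c. f a b c / g a b c) D"
  unfolding divide_inverse by (intro holo3_mult holo3_inverse assms)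

lemma holo3_powr_right:
  assumes "holo3 f D" "w \<noteq> 0"
  shows "holo3 (\<lambda>a b c. w powr (f a b c)) D"
  by (rule holo3_compose[of "\<lambda>z. w powr z" UNIV]) (use assms in \<open>auto intro!: holomorphic_intros\<close>)

lemma holo3_subset:
  assumes "holo3 f D" "open E" "E \<subseteq> D"
  shows "holo3 f E"
  using assms unfolding holo3_def by (auto intro: continuous_on_subset)

text \<open>Each integration by parts evaluates the next function at a + 1 or c + 1, so holomorphy
  has to be transported along such translations.\<close>

lemma holo3_shift:
  assumes f: "holo3 f E" and D: "open D"
    and sub: "\<And>a b c. (a, b, c) \<in> D \<Longrightarrow> (a + i, b + j, c + k) \<in> E"
  shows "holo3 (\<lambda>a b c. f (a + i) (b + j) (c + k)) D"
proof (rule holo3I[OF D])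
  note f' = holo3D[OF f]
  have "continuous_on D (\<lambda>p. (\<lambda>p. f (fst p) (fst (snd p)) (snd (snd p)))
      (fst p + i, fst (snd p) + j, snd (snd p) + k))"
    by (rule continuous_on_compose2[OF f'(2)]) (use sub in \<open>auto intro!: continuous_intros\<close>)
  then show "continuous_on D (\<lambda>(a, b, c). f (a + i) (b + j) (c + k))"
    by (simp add: case_prod_unfold)
  have sh: "(\<lambda>z. g (z + s)) field_differentiable (at t)" if "g field_differentiable (at (t + s))"
    for g and s t :: complex
  proof -
    have "(\<lambda>z. z + s) field_differentiable (at t)" by (intro derivative_intros)
    from field_differentiable_compose[OF this that] show ?thesis by (simp add: o_def)
  qed
  fix a b c assume "(a, b, c) \<in> D"
  from f'(3-5)[OF sub[OF this]]
  show "(\<lambda>z. f (z + i) (b + j) (c + k)) field_differentiable (at a)"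
    "(\<lambda>z. f (a + i) (z + j) (c + k)) field_differentiable (at b)"
    "(\<lambda>z. f (a + i) (b + j) (z + k)) field_differentiable (at c)"
    by (auto intro: sh)
qed

lemma holo3_cong:
  assumes f: "holo3 f D" and eq: "\<And>a b c. (a, b, c) \<in> D \<Longrightarrow> f a b c = g a b c"
  shows "holo3 g D"
proof (rule holo3I)
  note f' = holo3D[OF f]
  show "open D" by (rule f'(1))
  show "continuous_on D (\<lambda>(a, b, c). g a b c)"
    by (rule continuous_on_eq[OF f'(2)]) (use eq in auto)
  fix a b c assume p: "(a, b, c) \<in> D"
  have o: "open {z. (z, b, c) \<in> D}" "open {z. (a, z, c) \<in> D}" "open {z. (a, b, z) \<in> D}"
    using f'(1) by (auto intro!: open_vimage[unfolded vimage_def] continuous_intros)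
  have tr: "F field_differentiable (at t) \<Longrightarrow> open S \<Longrightarrow> t \<in> S \<Longrightarrow> (\<And>z. z \<in> S \<Longrightarrow> F z = G z)
      \<Longrightarrow> G field_differentiable (at t)" for F G :: "complex \<Rightarrow> complex" and S t
    unfolding field_differentiable_def using has_field_derivative_transform_within_open by blast
  show "(\<lambda>z. g z b c) field_differentiable (at a)"
    by (rule tr[OF f'(3)[OF p] o(1)]) (use p eq in auto)
  show "(\<lambda>z. g a z c) field_differentiable (at b)"
    by (rule tr[OF f'(4)[OF p] o(2)]) (use p eq in auto)
  show "(\<lambda>z. g a b z) field_differentiable (at c)"
    by (rule tr[OF f'(5)[OF p] o(3)]) (use p eq in auto)
qed

lemma holo3_local:
  assumes "open D" "\<And>p. p \<in> D \<Longrightarrow> \<exists>E. p \<in> E \<and> E \<subseteq> D \<and> holo3 f E"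
  shows "holo3 f D"
proof (rule holo3I[OF \<open>open D\<close>])
  show "continuous_on D (\<lambda>(a, b, c). f a b c)"
    unfolding continuous_on_eq_continuous_at[OF \<open>open D\<close>]
  proof
    fix p assume "p \<in> D"
    then obtain E where E: "p \<in> E" "holo3 f E" using assms(2) by blast
    from holo3D[OF E(2)] E(1) show "isCont (\<lambda>(a, b, c). f a b c) p"
      by (simp add: case_prod_unfold continuous_on_eq_continuous_at)
  qed
  fix a b c assume "(a, b, c) \<in> D"
  then obtain E where E: "(a, b, c) \<in> E" "holo3 f E" using assms(2) by blast
  from holo3D(3-5)[OF E(2,1)]
  show "(\<lambda>z. f z b c) field_differentiable (at a)" "(\<lambda>z. f a z c) field_differentiable (at b)"
    "(\<lambda>z. f a b z) field_differentiable (at c)" by simp_all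
qed

text \<open>Domination is demanded only near each point, since no single majorant works up to the
  boundary of the region of convergence. With counting measure the same lemma covers infinite
  sums.\<close>

lemma holo3_integral:
  fixes h :: "'x \<Rightarrow> complex \<Rightarrow> complex \<Rightarrow> complex \<Rightarrow> complex"
  assumes D: "open D" and hol: "\<And>x. x \<in> space M \<Longrightarrow> holo3 (h x) D"
    and meas: "\<And>a b c. (a, b, c) \<in> D \<Longrightarrow> (\<lambda>x. h x a b c) \<in> borel_measurable M"
    and dom: "\<And>p. p \<in> D \<Longrightarrow> \<exists>E W. open E \<and> p \<in> E \<and> E \<subseteq> D \<and> integrable M W \<and>
       (\<forall>x\<in>space M. \<forall>(a, b, c)\<in>E. norm (h x a b c) \<le> W x)"
  shows "holo3 (\<lambda>a b c. \<integral>x. h x a b c \<partial>M) D"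
proof (rule holo3I[OF D])
  have "isCont (\<lambda>p. \<integral>x. h x (fst p) (fst (snd p)) (snd (snd p)) \<partial>M) p" if p: "p \<in> D" for p
  proof -
    from dom[OF p] obtain E W where E: "open E" "p \<in> E" "E \<subseteq> D" "integrable M W"
      and W0: "\<forall>x\<in>space M. \<forall>(a, b, c)\<in>E. norm (h x a b c) \<le> W x"
      by (elim exE conjE)
    have W: "norm (h x a b c) \<le> W x" if "x \<in> space M" "(a, b, c) \<in> E" for x a b c
      using bspec[OF bspec[OF W0 that(1)] that(2)] by simp
    have "continuous (at p within E) (\<lambda>p. \<integral>x. h x (fst p) (fst (snd p)) (snd (snd p)) \<partial>M)"
      unfolding continuous_within_sequentially o_def
    proof (intro allI impI; elim conjE)
      fix X assume X: "\<forall>n. X n \<in> E" "X \<longlonglongrightarrow> p"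
      show "(\<lambda>n. \<integral>x. h x (fst (X n)) (fst (snd (X n))) (snd (snd (X n))) \<partial>M)
          \<longlonglongrightarrow> (\<integral>x. h x (fst p) (fst (snd p)) (snd (snd p)) \<partial>M)"
      proof (rule integral_dominated_convergence[OF _ _ E(4)])
        show "(\<lambda>x. h x (fst p) (fst (snd p)) (snd (snd p))) \<in> borel_measurable M"
          using p by (intro meas) auto
        show "(\<lambda>x. h x (fst (X n)) (fst (snd (X n))) (snd (snd (X n)))) \<in> borel_measurable M" for n
          using X(1) E(3) by (intro meas) auto
        show "AE x in M. norm (h x (fst (X n)) (fst (snd (X n))) (snd (snd (X n)))) \<le> W x" for n
          using X(1) by (intro AE_I2 W) auto
        show "AE x in M. (\<lambda>n. h x (fst (X n)) (fst (snd (X n))) (snd (snd (X n))))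
           \<longlonglongrightarrow> h x (fst p) (fst (snd p)) (snd (snd p))"
        proof (rule AE_I2)
          fix x assume "x \<in> space M"
          from holo3D(2)[OF hol[OF this]] p D
          have "isCont (\<lambda>p. h x (fst p) (fst (snd p)) (snd (snd p))) p"
            by (simp add: continuous_on_eq_continuous_at)
          from isCont_tendsto_compose[OF this X(2)]
          show "(\<lambda>n. h x (fst (X n)) (fst (snd (X n))) (snd (snd (X n))))
             \<longlonglongrightarrow> h x (fst p) (fst (snd p)) (snd (snd p))" .
        qed
      qed
    qed
    then show ?thesis using at_within_open[OF E(2,1)] by simp
  qed
  then show "continuous_on D (\<lambda>(a, b, c). \<integral>x. h x a b c \<partial>M)"
    by (simp add: continuous_on_eq_continuous_at[OF D] case_prod_unfold)
next
  fix a b c assume p: "(a, b, c) \<in> D"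
  from dom[OF p] obtain E W where E: "open E" "(a, b, c) \<in> E" "E \<subseteq> D"
    and W1: "integrable M W" and W0: "\<forall>x\<in>space M. \<forall>(a, b, c)\<in>E. norm (h x a b c) \<le> W x"
    by (elim exE conjE)
  have W2: "norm (h x a b c) \<le> W x" if "x \<in> space M" "(a, b, c) \<in> E" for x a b c
    using bspec[OF bspec[OF W0 that(1)] that(2)] by simp
  note W = W1 W2
  obtain e where e: "0 < e" "ball (a, b, c) e \<subseteq> E"
    using E open_contains_ball by blast
  have in1: "z \<in> ball a e \<Longrightarrow> (z, b, c) \<in> E" and in2: "z \<in> ball b e \<Longrightarrow> (a, z, c) \<in> E"
    and in3: "z \<in> ball c e \<Longrightarrow> (a, b, z) \<in> E" for z
    using e by (auto intro!: subsetD[OF e(2)] simp: dist_Pair_Pair)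
  have D1: "z \<in> ball a e \<Longrightarrow> (z, b, c) \<in> D" and D2: "z \<in> ball b e \<Longrightarrow> (a, z, c) \<in> D"
    and D3: "z \<in> ball c e \<Longrightarrow> (a, b, z) \<in> D" for z
    using in1 in2 in3 E(3) by blast+
  show "(\<lambda>z. \<integral>x. h x z b c \<partial>M) field_differentiable (at a)"
  proof (rule integral_field_differentiable[OF e(1) _ _ W(1)])
    show "(\<lambda>z. h x z b c) holomorphic_on ball a e" if "x \<in> space M" for x
      unfolding holomorphic_on_def
      using holo3D(3)[OF hol[OF that] D1] field_differentiable_at_within by blast
  qed (use meas D1 W(2) in1 in auto)
  show "(\<lambda>z. \<integral>x. h x a z c \<partial>M) field_differentiable (at b)"
  proof (rule integral_field_differentiable[OF e(1) _ _ W(1)])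
    show "(\<lambda>z. h x a z c) holomorphic_on ball b e" if "x \<in> space M" for x
      unfolding holomorphic_on_def
      using holo3D(4)[OF hol[OF that] D2] field_differentiable_at_within by blast
  qed (use meas D2 W(2) in2 in auto)
  show "(\<lambda>z. \<integral>x. h x a b z \<partial>M) field_differentiable (at c)"
  proof (rule integral_field_differentiable[OF e(1) _ _ W(1)])
    show "(\<lambda>z. h x a b z) holomorphic_on ball c e" if "x \<in> space M" for x
      unfolding holomorphic_on_def
      using holo3D(5)[OF hol[OF that] D3] field_differentiable_at_within by blast
  qed (use meas D3 W(2) in3 in auto)
qed

section \<open>Analytic continuation by integration by parts\<close>

lemma powr_summable_on:
  assumes "1 < s"
  shows "(\<lambda>n::nat. real n powr (- s)) summable_on A"
proof -
  have "summable (\<lambda>n::nat. real n powr (- s))"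
    using assms by (subst summable_real_powr_iff) auto
  then have "(\<lambda>n::nat. real n powr (- s)) summable_on UNIV"
    by (intro norm_summable_imp_summable_on) simp
  then show ?thesis by (rule summable_on_subset_banach) auto
qed

lemma summable_on_powr_bound:
  fixes f :: "nat \<Rightarrow> complex"
  assumes "1 < s" "\<And>n. n \<in> A \<Longrightarrow> norm (f n) \<le> B * real n powr (- s)"
  shows "(\<lambda>n. norm (f n)) summable_on A" "f summable_on A"
proof -
  have "(\<lambda>n. B * real n powr (- s)) summable_on A"
    by (intro summable_on_cmult_right powr_summable_on assms)
  then show "(\<lambda>n. norm (f n)) summable_on A"
    by (rule summable_on_comparison_test) (use assms in auto)
  then show "f summable_on A" by (rule abs_summable_summable)
qed

lemma ktail_tendsto_0:
  assumes "0 \<le> r" "1 < Re (a + c)"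
  shows "(ktail r a c \<longlongrightarrow> 0) at_top"
proof -
  have "((\<lambda>y. kreg r a c y + of_real (per_bern 0 y) * kern r a c y
     - a * kint (per_bern 0) r (a + 1) c y - c * kint (per_bern 0) r a (c + 1) y) \<longlongrightarrow> 0 + 0 - a * 0 - c * 0) at_top"
    by (intro tendsto_intros kreg_tendsto_0 bounded_mult_tendsto_0[OF kern_tendsto_0 per_bern_0_bound]
          kint_tendsto_0[OF per_bern_measurable per_bern_0_bound]) (use assms in auto)
  then show ?thesis by (simp add: ktail_def[abs_def])
qed

text \<open>By \<open>ktail_split\<close> the difference of two values of \<open>ktail\<close> is a
  finite sum, and \<open>ktail\<close> tends to 0 when Re (a + c) > 1. There it is the genuine tail,
  starting strictly above n.\<close>

lemma kern_has_sum:
  assumes r: "0 \<le> r" "r \<le> real n" and n: "0 < n" and ac: "1 < Re (a + c)"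
  shows "((\<lambda>m. kern r a c (of_nat m)) has_sum ktail r a c (of_nat n)) {n<..}"
    and "(\<lambda>m. norm (kern r a c (of_nat m))) summable_on {n<..}"
proof -
  let ?f = "\<lambda>m. kern r a c (real m)"
  let ?g = "\<lambda>m. if n < m then ?f m else 0"
  have bnd: "norm (?f m) \<le> 2 powr \<bar>Re c\<bar> * real m powr (- Re (a + c))" if "m \<in> {n<..}" for m
    by (rule norm_kern_le) (use that r n in auto)
  show "(\<lambda>m. norm (?f m)) summable_on {n<..}"
    using summable_on_powr_bound(1)[OF ac bnd] .
  have s: "?f summable_on {n<..}"
    using summable_on_powr_bound(2)[OF ac bnd] .
  have "(?g has_sum infsum ?f {n<..}) UNIV"
    using has_sum_infsum[OF s] by (rule has_sum_cong_neutral[THEN iffD1, rotated -1]) auto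
  then have "?g sums infsum ?f {n<..}" by (rule has_sum_imp_sums)
  then have lim1: "(\<lambda>N. sum ?g {..<Suc N}) \<longlonglongrightarrow> infsum ?f {n<..}"
    unfolding sums_def by (rule LIMSEQ_Suc)
  have ev: "\<forall>\<^sub>F N in sequentially. ktail r a c (real n) - ktail r a c (real N) = sum ?g {..<Suc N}"
    using eventually_ge_at_top[of n]
  proof eventually_elim
    case (elim N)
    have ac': "a + c \<noteq> 1" "0 < Re (a + c)" using ac by (auto dest: arg_cong[of _ _ Re])
    have "sum ?g {..<Suc N} = sum ?f {n<..N}"
      by (rule sum.mono_neutral_cong_right) auto
    then show ?case using ktail_split[of "real n" r "real N" a c] ac' elim r n by simp
  qed
  have "(\<lambda>N. ktail r a c (real n) - ktail r a c (real N)) \<longlonglongrightarrow> ktail r a c (real n) - 0"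
    by (intro tendsto_intros filterlim_compose[OF ktail_tendsto_0 filterlim_real_sequentially] r ac)
  from Lim_transform_eventually[OF this ev] have "infsum ?f {n<..} = ktail r a c (real n) - 0"
    by (rule LIMSEQ_unique[OF lim1])
  then show "(?f has_sum ktail r a c (of_nat n)) {n<..}"
    using has_sum_infsum[OF s] by simp
qed

text \<open>The first argument K of zeta_rem, kreg_cont and ksum_cont counts integrations by parts: on the
  region of convergence the value does not depend on K, but each step extends the domain of
  holomorphy one unit to the left.\<close>

primrec zeta_rem :: "nat \<Rightarrow> nat \<Rightarrow> complex \<Rightarrow> complex" where
  "zeta_rem 0 k s = kint (per_bern k) 0 s 0 1"
| "zeta_rem (Suc K) k s = - of_real (bern (Suc k) 0) + s * zeta_rem K (Suc k) (s + 1)"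

text \<open>The Riemann zeta-function by Euler-Maclaurin summation from 1. The constant 1 / 2 is the
  term n = 1 combined with the boundary value -1/2 of the sawtooth.\<close>

definition zeta_cont :: "nat \<Rightarrow> complex \<Rightarrow> complex" where
  "zeta_cont K s = 1 / (s - 1) + 1 / 2 - s * zeta_rem K 0 (s + 1)"

lemma zeta_rem_eq:
  assumes "1 < Re s" shows "zeta_rem K k s = zeta_rem 0 k s"
  using assms
proof (induction K arbitrary: k s)
  case (Suc K)
  have "per_bern (Suc k) 1 = bern (Suc k) 0" using per_bern_of_nat[of "Suc k" 1] by simp
  moreover have "kern 0 s 0 1 = 1" by (simp add: kern_def)
  ultimately show ?case
    using Suc.IH[of "s + 1" "Suc k"] Suc.prems kint_ibp[of 1 0 s 0 k] by simp
qed simp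

lemma zeta_cont_has_sum:
  assumes "1 < Re s"
  shows "((\<lambda>n::nat. of_nat n powr (- s)) has_sum zeta_cont K s) {1..}"
proof -
  have kern0: "kern 0 s 0 (of_nat n) = of_nat n powr (- s)" if "0 < n" for n :: nat
    using that by (simp add: kern_def)
  have "((\<lambda>m. kern 0 s 0 (of_nat m)) has_sum ktail 0 s 0 (of_nat 1)) {1<..}"
    by (rule kern_has_sum) (use assms in auto)
  moreover have "((\<lambda>m. kern 0 s 0 (of_nat m)) has_sum ktail 0 s 0 (of_nat 1)) {1<..} =
      ((\<lambda>m::nat. of_nat m powr (- s)) has_sum ktail 0 s 0 (of_nat 1)) {1<..}"
    by (rule has_sum_cong) (simp add: kern0)
  ultimately have "((\<lambda>m::nat. of_nat m powr (- s)) has_sum ktail 0 s 0 1) {1<..}"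
    by simp
  then have "((\<lambda>m::nat. of_nat m powr (- s)) has_sum (of_nat 1 powr (- s) + ktail 0 s 0 1)) (insert 1 {1<..})"
    by (intro has_sum_insert) auto
  moreover have "insert 1 {1<..} = {1::nat..}" by auto
  moreover have "of_nat 1 powr (- s) + ktail 0 s 0 1 = zeta_cont K s"
    unfolding zeta_cont_def using zeta_rem_eq[of "s + 1" K 0] assms
    by (simp add: ktail_def kreg_def kern_def per_bern_0)
  ultimately show ?thesis by simp
qed

section \<open>Holomorphy of the remainder integrals and of their sums over n\<close>

lemma closed_range_minus_of_nat: "closed (range (\<lambda>l::nat. w - of_nat l :: complex))"
proof -
  have "closed ((\<lambda>z. w - z) -` (of_nat ` UNIV))"
    by (intro continuous_closed_vimage closed_of_nat_image) (auto intro!: continuous_intros)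
  moreover have "(\<lambda>z. w - z) -` (of_nat ` UNIV) = range (\<lambda>l::nat. w - of_nat l)"
    by (auto simp: image_iff algebra_simps)
  ultimately show ?thesis by simp
qed

lemma holo3_minus: "holo3 f D \<Longrightarrow> holo3 (\<lambda>a b c. - f a b c) D"
  by (rule holo3_compose[of uminus UNIV]) (auto intro!: holomorphic_intros)

text \<open>The restriction on Re c keeps the factor 2 to the power |Re c| from
  \<open>norm_kern_le\<close> bounded on the neighbourhoods used for domination.\<close>

lemma open_AV_slab:
  "open {(a, b, c). x < Re (a + c) \<and> y < Re (a + b + c) \<and> \<bar>Re c\<bar> < z}"
proof -
  have "{(a, b, c). x < Re (a + c) \<and> y < Re (a + b + c) \<and> \<bar>Re c\<bar> < z} =
    {p. x < Re (fst p + snd (snd p))} \<inter> {p. y < Re (fst p + fst (snd p) + snd (snd p))}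
     \<inter> {p. \<bar>Re (snd (snd p))\<bar> < z}" by auto
  then show ?thesis
    by (auto intro!: open_Int open_Collect_less continuous_intros)
qed

lemma holo3_kern:
  assumes "open D" "0 < u" "0 \<le> r"
  shows "holo3 (\<lambda>a b c. kern r a c u) D"
  unfolding kern_def
  by (intro holo3_mult holo3_powr_right holo3_minus holo3_proj assms)
     (use assms in \<open>simp_all flip: of_real_add\<close>)

lemma holo3_kint:
  assumes P: "P \<in> borel_measurable borel" "\<And>u. \<bar>P u\<bar> \<le> B" and y: "1 \<le> y" "0 \<le> r" "r \<le> y"
    and D: "open D" "\<And>a b c. (a, b, c) \<in> D \<Longrightarrow> 1 < Re (a + c)"
  shows "holo3 (\<lambda>a b c. kint P r a c y) D"
  unfolding kint_def set_lebesgue_integral_def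
proof (rule holo3_integral[OF D(1)])
  show "holo3 (\<lambda>a b c. indicator {y..} u *\<^sub>R (of_real (P u) * kern r a c u)) D" for u
  proof (cases "y \<le> u")
    case True
    then show ?thesis using y D by (auto intro!: holo3_mult holo3_kern)
  next
    case False
    then show ?thesis using D by (simp add: holo3_const)
  qed
  show "(\<lambda>u. indicator {y..} u *\<^sub>R (of_real (P u) * kern r a c u)) \<in> borel_measurable lborel"
    if "(a, b, c) \<in> D" for a b c
    using kern_integrable(1)[OF P, of y r a c] y D(2)[OF that]
    unfolding set_integrable_def by (intro borel_measurable_integrable) auto
  fix p assume "p \<in> D"
  then obtain a0 b0 c0 where p: "p = (a0, b0, c0)" "(a0, b0, c0) \<in> D" by (metis prod_cases3)
  \<comment> \<open>Half of the distance to the boundary Re (a + c) = 1: the point lies at 1 + 2 d,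
    and on E the integrand is dominated by a fixed multiple of the power with exponent -(1 +
    d).\<close>
  define d where "d = (Re (a0 + c0) - 1) / 2"
  have d: "0 < d" using D(2)[OF p(2)] by (simp add: d_def)
  define q where "q = \<bar>Re c0\<bar> + 1"
  define E where "E = D \<inter> {(a, b, c). 1 + d < Re (a + c) \<and> Re (a0 + b0 + c0) - 1 < Re (a + b + c) \<and> \<bar>Re c\<bar> < q}"
  define W where "W = (\<lambda>u. indicator {y..} u *\<^sub>R (B * 2 powr q * u powr (- (1 + d))))"
  have "integrable lborel W"
    unfolding W_def using set_integral_powr_atLeast(1)[of "1 + d" y] d y
    unfolding set_integrable_def[symmetric] by (intro set_integrable_mult_right) auto
  moreover have "open E" unfolding E_def by (intro open_Int D(1) open_AV_slab)
  moreover have "p \<in> E"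
    using p d unfolding E_def q_def by (auto simp: d_def field_simps)
  moreover have "norm (indicator {y..} u *\<^sub>R (of_real (P u) * kern r a c u)) \<le> W u"
    if "(a, b, c) \<in> E" for a b c u
  proof (cases "y \<le> u")
    case True
    have B0: "0 \<le> B" using P(2)[of 0] by linarith
    have "norm (kern r a c u) \<le> 2 powr \<bar>Re c\<bar> * u powr (- Re (a + c))"
      by (rule norm_kern_le) (use True y in auto)
    also have "\<dots> \<le> 2 powr q * u powr (- (1 + d))"
      using that True y by (intro mult_mono powr_mono) (auto simp: E_def)
    finally have "norm (of_real (P u) * kern r a c u) \<le> B * (2 powr q * u powr (- (1 + d)))"
      unfolding norm_mult norm_of_real by (intro mult_mono P(2) B0) auto
    then show ?thesis using True by (simp add: W_def mult_ac)
  qed (simp add: W_def)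
  ultimately show "\<exists>E W. open E \<and> p \<in> E \<and> E \<subseteq> D \<and> integrable lborel W \<and>
     (\<forall>u\<in>space lborel. \<forall>(a, b, c)\<in>E. norm (indicator {y..} u *\<^sub>R (of_real (P u) * kern r a c u)) \<le> W u)"
    unfolding E_def by (intro exI[of _ E] exI[of _ W]) (auto simp: E_def)
qed

text \<open>Starting the integral at n turns its size into a power of n. With the weight in b, the
  sum over n converges for Re (a + b + c) > 2, and raising a or c by one moves this boundary by one
  unit.\<close>

lemma kint_term_bound:
  assumes P: "P \<in> borel_measurable borel" "\<And>u. \<bar>P u\<bar> \<le> B" and n: "0 < n" and ac: "1 < Re (a + c)"
  shows "norm (of_nat n powr (- b) * kint P (real n) a c (real n)) \<le>
     B * 2 powr \<bar>Re c\<bar> / (Re (a + c) - 1) * real n powr (- (Re (a + b + c) - 1))"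
proof -
  have "norm (of_nat n powr (- b) * kint P (real n) a c (real n)) \<le>
     real n powr (- Re b) * (B * 2 powr \<bar>Re c\<bar> * (real n powr (1 - Re (a + c)) / (Re (a + c) - 1)))"
    unfolding norm_mult using kern_integrable(2)[OF P, of "real n" "real n" a c] n ac
    by (intro mult_mono) (auto simp: norm_powr_real_powr)
  also have "\<dots> = B * 2 powr \<bar>Re c\<bar> / (Re (a + c) - 1) * (real n powr (- Re b) * real n powr (1 - Re (a + c)))"
    by (simp add: field_simps)
  also have "real n powr (- Re b) * real n powr (1 - Re (a + c)) = real n powr (- (Re (a + b + c) - 1))"
    by (simp flip: powr_add) (simp add: algebra_simps)
  finally show ?thesis .
qed

lemma kint_sum_summable:
  assumes "P \<in> borel_measurable borel" "\<And>u. \<bar>P u\<bar> \<le> B" "1 < Re (a + c)" "2 < Re (a + b + c)"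
  shows "(\<lambda>n. norm (of_nat n powr (- b) * kint P (real n) a c (real n))) summable_on {1..}"
    "(\<lambda>n. of_nat n powr (- b) * kint P (real n) a c (real n)) summable_on {1..}"
  by (rule summable_on_powr_bound[of "Re (a + b + c) - 1", OF _ kint_term_bound[OF assms(1,2)]];
      use assms in simp)+

definition ksum :: "nat \<Rightarrow> complex \<Rightarrow> complex \<Rightarrow> complex \<Rightarrow> complex" where
  "ksum k a b c = (\<Sum>\<^sub>\<infinity>n\<in>{1..}. of_nat n powr (- b) * kint (per_bern k) (real n) a c (real n))"

lemma holo3_ksum:
  assumes D: "open D" "\<And>a b c. (a, b, c) \<in> D \<Longrightarrow> 1 < Re (a + c) \<and> 2 < Re (a + b + c)"
  shows "holo3 (ksum k) D"
proof -
  obtain B where B: "\<And>u. \<bar>per_bern k u\<bar> \<le> B" using per_bern_bounded by blast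
  have B0: "0 \<le> B" using B[of 0] by linarith
  let ?h = "\<lambda>n a b c. of_nat n powr (- b) * kint (per_bern k) (real n) a c (real n)"
  \<comment> \<open>The sum is read as an integral over counting measure; absolute convergence
    identifies the two notions afterwards.\<close>
  have "holo3 (\<lambda>a b c. \<integral>n. ?h n a b c \<partial>count_space {1::nat..}) D"
  proof (rule holo3_integral[OF D(1)])
    show "holo3 (?h n) D" if "n \<in> space (count_space {1..})" for n
      using that D by (intro holo3_mult holo3_powr_right holo3_minus holo3_proj
            holo3_kint[OF per_bern_measurable B]) auto
    fix p assume "p \<in> D"
    then obtain a0 b0 c0 where p: "p = (a0, b0, c0)" "(a0, b0, c0) \<in> D" by (metis prod_cases3)
    \<comment> \<open>Both margins matter: d bounds the factor 1 / (Re (a + c) - 1) of the term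
      estimate, and e makes the dominating series converge.\<close>
    define d where "d = (Re (a0 + c0) - 1) / 2"
    define e where "e = (Re (a0 + b0 + c0) - 2) / 2"
    have d: "0 < d" "0 < e" using D(2)[OF p(2)] by (auto simp: d_def e_def)
    define q where "q = \<bar>Re c0\<bar> + 1"
    define E where "E = D \<inter> {(a, b, c). 1 + d < Re (a + c) \<and> 2 + e < Re (a + b + c) \<and> \<bar>Re c\<bar> < q}"
    define W where "W = (\<lambda>n::nat. B * 2 powr q / d * real n powr (- (1 + e)))"
    have "W summable_on {1..}"
      unfolding W_def by (intro summable_on_cmult_right powr_summable_on) (use d in auto)
    then have "(\<lambda>n. norm (W n)) summable_on {1..}"
      by (rule summable_on_iff_abs_summable_on_real[THEN iffD1])
    then have "integrable (count_space {1..}) W"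
      by (rule abs_summable_equivalent[THEN iffD1, unfolded abs_summable_on_def])
    moreover have "open E" unfolding E_def by (intro open_Int D(1) open_AV_slab)
    moreover have "p \<in> E"
      using p d unfolding E_def q_def by (auto simp: d_def e_def field_simps)
    moreover have "norm (?h n a b c) \<le> W n" if "(a, b, c) \<in> E" "n \<in> {1..}" for a b c n
    proof -
      have ac: "1 < Re (a + c)" using that(1) d by (auto simp: E_def)
      have "norm (?h n a b c) \<le> B * 2 powr \<bar>Re c\<bar> / (Re (a + c) - 1) * real n powr (- (Re (a + b + c) - 1))"
        by (rule kint_term_bound[OF per_bern_measurable B _ ac]) (use that in auto)
      also have "\<dots> \<le> W n"
        unfolding W_def using that d B0
        by (intro mult_mono frac_le powr_mono mult_nonneg_nonneg divide_nonneg_pos) (auto simp: E_def)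
      finally show ?thesis .
    qed
    ultimately show "\<exists>E W. open E \<and> p \<in> E \<and> E \<subseteq> D \<and> integrable (count_space {1..}) W \<and>
       (\<forall>n\<in>space (count_space {1..}). \<forall>(a, b, c)\<in>E. norm (?h n a b c) \<le> W n)"
      by (intro exI[of _ E] exI[of _ W]) (auto simp: E_def)
  qed simp
  then show ?thesis
  proof (rule holo3_cong)
    fix a b c assume p: "(a, b, c) \<in> D"
    have "(\<lambda>n. norm (?h n a b c)) summable_on {1..}"
      using kint_sum_summable(1)[OF per_bern_measurable B] D(2)[OF p] by blast
    then have "infsetsum (\<lambda>n. ?h n a b c) {1..} = infsum (\<lambda>n. ?h n a b c) {1..}"
      using abs_summable_equivalent by (intro infsetsum_infsum) blast
    then show "(\<integral>n. ?h n a b c \<partial>count_space {1..}) = ksum k a b c"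
      by (simp add: infsetsum_def ksum_def)
  qed
qed

declare bern.simps(2) [simp del]


section \<open>The continuations for a given number of integrations by parts\<close>

lemma open_complement_minus_of_nat: "open {z. \<forall>l::nat. z \<noteq> w - of_nat l}" for w :: complex
proof -
  have "{z. \<forall>l::nat. z \<noteq> w - of_nat l} = - range (\<lambda>l::nat. w - of_nat l)" by auto
  then show ?thesis using closed_range_minus_of_nat by (simp add: open_Compl)
qed

lemma zeta_rem_holomorphic: "zeta_rem K k holomorphic_on {s. 1 - real K < Re s}"
proof (induction K arbitrary: k)
  case 0
  obtain B where B: "\<And>u. \<bar>per_bern k u\<bar> \<le> B" using per_bern_bounded by blast
  have "open {(a::complex, b::complex, c::complex). 1 < Re (a + c)}"
    unfolding case_prod_unfold by (intro open_Collect_less continuous_intros)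
  then have h: "holo3 (\<lambda>a b c. kint (per_bern k) 0 a c 1) {(a, b, c). 1 < Re (a + c)}"
    by (intro holo3_kint[OF per_bern_measurable B]) auto
  have "(\<lambda>s. kint (per_bern k) 0 s 0 1) field_differentiable (at s)" if "1 < Re s" for s
    using holo3D(3)[OF h, of s 0 0] that by simp
  then show ?case
    by (auto simp: holomorphic_on_def intro: field_differentiable_at_within)
next
  case (Suc K)
  have "(\<lambda>s. zeta_rem K (Suc k) (s + 1)) holomorphic_on {s. 1 - real (Suc K) < Re s}"
    by (rule holomorphic_on_compose_gen[of "\<lambda>s. s + 1" _ "zeta_rem K (Suc k)", unfolded o_def, OF _ Suc.IH])
       (auto intro!: holomorphic_intros)
  then show ?case by (auto intro!: holomorphic_intros)
qed

lemma zeta_cont_holomorphic: "zeta_cont K holomorphic_on {s. - real K < Re s \<and> s \<noteq> 1}"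
proof -
  have "(\<lambda>s. zeta_rem K 0 (s + 1)) holomorphic_on {s. - real K < Re s \<and> s \<noteq> 1}"
    by (rule holomorphic_on_compose_gen[of "\<lambda>s. s + 1" _ "zeta_rem K 0", unfolded o_def, OF _ zeta_rem_holomorphic])
       (auto intro!: holomorphic_intros)
  then show ?thesis unfolding zeta_cont_def[abs_def] by (auto intro!: holomorphic_intros)
qed

lemma open_zeta_cont_dom: "open {s. - real K < Re s \<and> s \<noteq> 1}"
proof -
  have "{s. - real K < Re s \<and> s \<noteq> 1} = {s. - real K < Re s} \<inter> - {1}" by auto
  moreover have "open ({s. - real K < Re s} \<inter> - {1})"
    by (intro open_Int open_halfspace_Re_gt open_Compl closed_singleton)
  ultimately show ?thesis by simp
qed

text \<open>The value of \<open>kreg\<close> at r = y = 1, which is what remains of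
  \<open>kreg (real n) a c (real n)\<close> after a power of n is scaled out. Each step replaces the
  integral with c + 1 by its own continuation, so the poles a + c = 1 - l enter one by one through
  the denominators.\<close>

primrec kreg_cont :: "nat \<Rightarrow> complex \<Rightarrow> complex \<Rightarrow> complex" where
  "kreg_cont 0 a c = (2 powr (- c) + c * kint (\<lambda>_. 1) 1 a (c + 1) 1) / (a + c - 1)"
| "kreg_cont (Suc K) a c = (2 powr (- c) + c * kreg_cont K a (c + 1)) / (a + c - 1)"

text \<open>Integration by parts carried out under the sum over n. The boundary term at u = n is a
  constant multiple of n to the power -(a + b + c), hence sums to a zeta value.\<close>

primrec ksum_cont :: "nat \<Rightarrow> nat \<Rightarrow> complex \<Rightarrow> complex \<Rightarrow> complex \<Rightarrow> complex" where
  "ksum_cont 0 k a b c = ksum k a b c"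
| "ksum_cont (Suc K) k a b c = - of_real (bern (Suc k) 0) * 2 powr (- c) * zeta_cont (Suc K) (a + b + c)
     + a * ksum_cont K (Suc k) (a + 1) b c + c * ksum_cont K (Suc k) a b (c + 1)"

text \<open>The sum over n of the weighted \<open>ktail\<close> started at n, evaluated piece by
  piece: by homogeneity the regularised integral gives the zeta value at a + b + c - 1, and the
  sawtooth value -1/2 at n gives the one at a + b + c.\<close>

definition AV_cont :: "nat \<Rightarrow> complex \<Rightarrow> complex \<Rightarrow> complex \<Rightarrow> complex" where
  "AV_cont K a b c = kreg_cont K a c * zeta_cont K (a + b + c - 1) - 2 powr (- c) / 2 * zeta_cont K (a + b + c)
     - a * ksum_cont K 0 (a + 1) b c - c * ksum_cont K 0 a b (c + 1)"

definition slab :: "real \<Rightarrow> real \<Rightarrow> (complex \<times> complex \<times> complex) set" where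
  "slab x y = {(a, b, c). x < Re (a + c) \<and> y < Re (a + b + c)} \<inter> AV2_dom"

lemma AV2_dom_iff:
  "(a, b, c) \<in> AV2_dom \<longleftrightarrow> (\<forall>l::nat. a + c \<noteq> 1 - of_nat l) \<and> (\<forall>l::nat. a + b + c \<noteq> 2 - of_nat l)"
  by (auto simp: AV2_dom_def)

lemma open_AV2_dom: "open AV2_dom"
proof -
  have "AV2_dom = (\<lambda>p. fst p + snd (snd p)) -` {z. \<forall>l::nat. z \<noteq> 1 - of_nat l}
     \<inter> (\<lambda>p. fst p + fst (snd p) + snd (snd p)) -` {z. \<forall>l::nat. z \<noteq> 2 - of_nat l}"
    by (auto simp: AV2_dom_def)
  also have "open \<dots>"
    by (intro open_Int open_vimage open_complement_minus_of_nat continuous_intros)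
  finally show ?thesis .
qed

lemma open_slab: "open (slab x y)"
proof -
  have "{(a, b, c). x < Re (a + c) \<and> y < Re (a + b + c)} =
    {p. x < Re (fst p + snd (snd p))} \<inter> {p. y < Re (fst p + fst (snd p) + snd (snd p))}" by auto
  then show ?thesis unfolding slab_def
    by (auto intro!: open_Int open_AV2_dom open_Collect_less continuous_intros)
qed

lemma minus_of_nat_shift:
  fixes z w :: complex
  assumes "\<forall>l::nat. z \<noteq> w - of_nat l"
  shows "z + 1 \<noteq> w - of_nat l"
proof
  assume "z + 1 = w - of_nat l"
  then have "z = w - of_nat (Suc l)" by (simp add: algebra_simps eq_diff_eq)
  with assms show False by blast
qed

lemma AV2_dom_shift:
  assumes "(a, b, c) \<in> AV2_dom"
  shows "(a + 1, b, c) \<in> AV2_dom" "(a, b, c + 1) \<in> AV2_dom"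
proof -
  have "\<forall>l::nat. a + c + 1 \<noteq> 1 - of_nat l" "\<forall>l::nat. a + b + c + 1 \<noteq> 2 - of_nat l"
    using assms minus_of_nat_shift[of "a + c" 1] minus_of_nat_shift[of "a + b + c" 2]
    unfolding AV2_dom_iff by blast+
  then show "(a + 1, b, c) \<in> AV2_dom" "(a, b, c + 1) \<in> AV2_dom"
    unfolding AV2_dom_iff by (simp_all add: add_ac)
qed

lemma AV2_dom_neq:
  assumes "(a, b, c) \<in> AV2_dom"
  shows "a + c \<noteq> 1" "a + b + c \<noteq> 2" "a + b + c \<noteq> 1"
proof -
  from assms have "a + c \<noteq> 1 - of_nat 0" "a + b + c \<noteq> 2 - of_nat 0" "a + b + c \<noteq> 2 - of_nat 1"
    unfolding AV2_dom_iff by blast+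
  then show "a + c \<noteq> 1" "a + b + c \<noteq> 2" "a + b + c \<noteq> 1" by simp_all
qed

lemma holo3_shift_a:
  assumes "holo3 f E" "open D" "\<And>a b c. (a, b, c) \<in> D \<Longrightarrow> (a + 1, b, c) \<in> E"
  shows "holo3 (\<lambda>a b c. f (a + 1) b c) D"
  using holo3_shift[OF assms(1,2), of 1 0 0] assms(3) by simp

lemma holo3_shift_c:
  assumes "holo3 f E" "open D" "\<And>a b c. (a, b, c) \<in> D \<Longrightarrow> (a, b, c + 1) \<in> E"
  shows "holo3 (\<lambda>a b c. f a b (c + 1)) D"
  using holo3_shift[OF assms(1,2), of 0 0 1] assms(3) by simp

lemma holo3_kreg_cont: "holo3 (\<lambda>a b c. kreg_cont K a c) (slab (- real K) y)"
proof (induction K)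
  case 0
  have "holo3 (\<lambda>a b c. kint (\<lambda>_. 1) 1 a (c + 1) 1) (slab 0 y)"
  proof (rule holo3_shift_c[of "\<lambda>a b c. kint (\<lambda>_. 1) 1 a c 1" "slab 1 (y + 1)"])
    show "holo3 (\<lambda>a b c. kint (\<lambda>_. 1) 1 a c 1) (slab 1 (y + 1))"
      by (rule holo3_kint[of _ 1]) (use open_slab in \<open>auto simp: slab_def\<close>)
  qed (use open_slab in \<open>auto simp: slab_def intro: AV2_dom_shift\<close>)
  then show ?case
    unfolding kreg_cont.simps
    by (intro holo3_divide holo3_add holo3_diff holo3_mult holo3_powr_right holo3_minus holo3_proj holo3_const)
       (use open_slab in \<open>auto simp: slab_def dest: AV2_dom_neq\<close>)
next
  case (Suc K)
  have "holo3 (\<lambda>a b c. kreg_cont K a (c + 1)) (slab (- real (Suc K)) y)"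
    by (rule holo3_shift_c[OF Suc.IH open_slab]) (auto simp: slab_def intro: AV2_dom_shift)
  then show ?case
    unfolding kreg_cont.simps
    by (intro holo3_divide holo3_add holo3_diff holo3_mult holo3_powr_right holo3_minus holo3_proj holo3_const)
       (use open_slab in \<open>auto simp: slab_def dest: AV2_dom_neq\<close>)
qed

lemma holo3_zeta_cont_comp:
  assumes "holo3 f D" "\<And>a b c. (a, b, c) \<in> D \<Longrightarrow> - real K < Re (f a b c) \<and> f a b c \<noteq> 1"
  shows "holo3 (\<lambda>a b c. zeta_cont K (f a b c)) D"
  by (rule holo3_compose[OF zeta_cont_holomorphic open_zeta_cont_dom assms(1)]) (use assms(2) in auto)

text \<open>The sums of remainder integrals become singular only through their zeta values, so only
  planes in a + b + c are removed. The planes in a + c belong to \<open>kreg_cont\<close>.\<close>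

definition tail_slab :: "nat \<Rightarrow> (complex \<times> complex \<times> complex) set" where
  "tail_slab K = {(a, b, c). 1 - real K < Re (a + c) \<and> 2 - real K < Re (a + b + c)
    \<and> (\<forall>l::nat. a + b + c \<noteq> 2 - of_nat l)}"

lemma open_tail_slab: "open (tail_slab K)"
proof -
  have "tail_slab K = {p. 1 - real K < Re (fst p + snd (snd p))}
     \<inter> {p. 2 - real K < Re (fst p + fst (snd p) + snd (snd p))}
     \<inter> (\<lambda>p. fst p + fst (snd p) + snd (snd p)) -` {z. \<forall>l::nat. z \<noteq> 2 - of_nat l}"
    by (auto simp: tail_slab_def)
  also have "open \<dots>"
    by (intro open_Int open_vimage open_Collect_less open_complement_minus_of_nat continuous_intros)
  finally show ?thesis .
qed

lemma tail_slab_shift: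
  assumes "(a, b, c) \<in> tail_slab (Suc K)"
  shows "(a + 1, b, c) \<in> tail_slab K" "(a, b, c + 1) \<in> tail_slab K"
proof -
  have "a + b + c + 1 \<noteq> 2 - of_nat l" for l :: nat
    using assms by (intro minus_of_nat_shift) (auto simp: tail_slab_def)
  then show "(a + 1, b, c) \<in> tail_slab K" "(a, b, c + 1) \<in> tail_slab K"
    using assms by (auto simp: tail_slab_def add_ac)
qed

lemma holo3_ksum_cont: "holo3 (ksum_cont K k) (tail_slab K)"
proof (induction K arbitrary: k)
  case 0
  have "holo3 (ksum k) (tail_slab 0)"
    by (rule holo3_ksum[OF open_tail_slab]) (auto simp: tail_slab_def)
  then show ?case by (rule holo3_cong) simp
next
  case (Suc K)
  let ?D = "tail_slab (Suc K)"
  have t1: "holo3 (\<lambda>a b c. ksum_cont K (Suc k) (a + 1) b c) ?D"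
    by (rule holo3_shift_a[OF Suc.IH open_tail_slab tail_slab_shift(1)])
  have t2: "holo3 (\<lambda>a b c. ksum_cont K (Suc k) a b (c + 1)) ?D"
    by (rule holo3_shift_c[OF Suc.IH open_tail_slab tail_slab_shift(2)])
  have z: "holo3 (\<lambda>a b c. zeta_cont (Suc K) (a + b + c)) ?D"
  proof (rule holo3_zeta_cont_comp)
    show "holo3 (\<lambda>a b c. a + b + c) ?D"
      by (intro holo3_add holo3_proj open_tail_slab)
    fix a b c assume p: "(a, b, c) \<in> ?D"
    then have "a + b + c \<noteq> 2 - of_nat 1" unfolding tail_slab_def by blast
    with p show "- real (Suc K) < Re (a + b + c) \<and> a + b + c \<noteq> 1" by (auto simp: tail_slab_def)
  qed
  have "holo3 (\<lambda>a b c. - of_real (bern (Suc k) 0) * 2 powr (- c) * zeta_cont (Suc K) (a + b + c)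
     + a * ksum_cont K (Suc k) (a + 1) b c + c * ksum_cont K (Suc k) a b (c + 1)) ?D"
    by (intro holo3_add holo3_mult t1 t2 z holo3_powr_right holo3_minus holo3_proj holo3_const open_tail_slab) auto
  then show ?case by (rule holo3_cong) simp
qed

lemma slab_shift_tail_slab:
  assumes "(a, b, c) \<in> slab (- real K) (1 - real K)"
  shows "(a + 1, b, c) \<in> tail_slab K" "(a, b, c + 1) \<in> tail_slab K"
proof -
  have "(a, b, c) \<in> AV2_dom" using assms by (simp add: slab_def)
  from AV2_dom_shift[OF this] show "(a + 1, b, c) \<in> tail_slab K" "(a, b, c + 1) \<in> tail_slab K"
    using assms unfolding slab_def tail_slab_def AV2_dom_iff by auto
qed

lemma holo3_AV_cont: "holo3 (AV_cont K) (slab (- real K) (1 - real K))"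
proof -
  let ?D = "slab (- real K) (1 - real K)"
  have o: "open ?D" by (rule open_slab)
  have t1: "holo3 (\<lambda>a b c. ksum_cont K 0 (a + 1) b c) ?D"
    by (rule holo3_shift_a[OF holo3_ksum_cont o slab_shift_tail_slab(1)])
  have t2: "holo3 (\<lambda>a b c. ksum_cont K 0 a b (c + 1)) ?D"
    by (rule holo3_shift_c[OF holo3_ksum_cont o slab_shift_tail_slab(2)])
  have z1: "holo3 (\<lambda>a b c. zeta_cont K (a + b + c - 1)) ?D"
  proof (rule holo3_zeta_cont_comp)
    show "holo3 (\<lambda>a b c. a + b + c - 1) ?D"
      by (intro holo3_diff holo3_add holo3_proj holo3_const o)
    fix a b c assume p: "(a, b, c) \<in> ?D"
    then have "a + b + c \<noteq> 2" using AV2_dom_neq(2) by (auto simp: slab_def)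
    then have "a + b + c - 1 \<noteq> 1" by (simp add: diff_eq_eq)
    then show "- real K < Re (a + b + c - 1) \<and> a + b + c - 1 \<noteq> 1"
      using p by (auto simp: slab_def)
  qed
  have z2: "holo3 (\<lambda>a b c. zeta_cont K (a + b + c)) ?D"
    by (rule holo3_zeta_cont_comp, intro holo3_diff holo3_add holo3_proj holo3_const o)
       (auto simp: slab_def dest: AV2_dom_neq)
  have p: "holo3 (\<lambda>a b c. 2 powr (- c) / 2) ?D"
    by (intro holo3_divide holo3_powr_right holo3_minus holo3_proj holo3_const o) auto
  show ?thesis unfolding AV_cont_def[abs_def]
    by (intro holo3_diff holo3_mult holo3_kreg_cont t1 t2 z1 z2 p holo3_proj o)
qed

section \<open>Agreement of the continuations with convergent sums\<close>

lemma kreg_cont_eq_kreg_cont_0: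
  assumes "0 < Re (a + c)" "a + c \<noteq> 1"
  shows "kreg_cont K a c = kreg_cont 0 a c"
  using assms
proof (induction K arbitrary: c)
  case (Suc K)
  have "kint (\<lambda>_. 1) 1 a (c + 1) 1 = kreg 1 a (c + 1) 1"
    by (rule kint_eq_kreg) (use Suc.prems in auto)
  also have "\<dots> = kreg_cont 0 a (c + 1)"
    unfolding kreg_def by (simp add: add.assoc)
  also have "\<dots> = kreg_cont K a (c + 1)"
    using Suc.prems by (intro Suc.IH[symmetric]) (auto dest: arg_cong[of _ _ Re])
  finally show ?case by simp
qed simp

lemma kern_scale_1:
  assumes "0 < n"
  shows "kern (real n) a c (real n) = 2 powr (- c) * of_nat n powr (- (a + c))"
proof -
  have "complex_of_real (real n + real n) powr (- c) = (2 * of_nat n) powr (- c)"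
    by simp
  also have "\<dots> = 2 powr (- c) * of_nat n powr (- c)"
    using powr_times_real[of 2 "of_nat n" "- c"] by simp
  finally have "kern (real n) a c (real n) = 2 powr (- c) * (of_nat n powr (- a) * of_nat n powr (- c))"
    unfolding kern_def by simp
  then show ?thesis by (simp flip: powr_add)
qed

text \<open>This is \<open>kint_ibp\<close> started at n and summed over n. The Bernoulli weight has
  the same value at all integers, so the boundary terms add up to a multiple of a zeta value; K is
  free because all \<open>zeta_cont K\<close> agree to the right of 1.\<close>

lemma ksum_ibp:
  assumes ac: "1 < Re (a + c)" "2 < Re (a + b + c)"
  shows "ksum k a b c = - of_real (bern (Suc k) 0) * 2 powr (- c) * zeta_cont K (a + b + c)
     + a * ksum (Suc k) (a + 1) b c + c * ksum (Suc k) a b (c + 1)"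
proof -
  obtain B where B: "\<And>u. \<bar>per_bern (Suc k) u\<bar> \<le> B" using per_bern_bounded by blast
  let ?I = "\<lambda>a c n. of_nat n powr (- b) * kint (per_bern (Suc k)) (real n) a c (real n)"
  have s1: "(?I (a + 1) c has_sum ksum (Suc k) (a + 1) b c) {1..}"
    unfolding ksum_def
    by (intro has_sum_infsum kint_sum_summable(2)[OF per_bern_measurable B]) (use ac in auto)
  have s2: "(?I a (c + 1) has_sum ksum (Suc k) a b (c + 1)) {1..}"
    unfolding ksum_def
    by (intro has_sum_infsum kint_sum_summable(2)[OF per_bern_measurable B]) (use ac in auto)
  have s3: "((\<lambda>n::nat. of_nat n powr (- (a + b + c))) has_sum zeta_cont K (a + b + c)) {1..}"
    by (rule zeta_cont_has_sum) (use ac in auto)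
  have "((\<lambda>n::nat. (- of_real (bern (Suc k) 0) * 2 powr (- c)) * of_nat n powr (- (a + b + c))
      + a * ?I (a + 1) c n + c * ?I a (c + 1) n) has_sum
     ((- of_real (bern (Suc k) 0) * 2 powr (- c)) * zeta_cont K (a + b + c)
      + a * ksum (Suc k) (a + 1) b c + c * ksum (Suc k) a b (c + 1))) {1..}"
    by (intro has_sum_add has_sum_cmult_right s1 s2 s3)
  moreover have eq: "of_nat n powr (- b) * kint (per_bern k) (real n) a c (real n) =
      (- of_real (bern (Suc k) 0) * 2 powr (- c)) * of_nat n powr (- (a + b + c))
      + a * ?I (a + 1) c n + c * ?I a (c + 1) n" if "n \<in> {1..}" for n
  proof -
    have n: "0 < n" using that by simp
    have "of_nat n powr (- (a + b + c)) = of_nat n powr (- b) * complex_of_nat n powr (- (a + c))"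
      by (simp flip: powr_add) (simp add: algebra_simps)
    then show ?thesis
      using kint_ibp[of "real n" "real n" a c k] n ac
      by (simp add: kern_scale_1 per_bern_of_nat ring_distribs del: bern.simps)
  qed
  ultimately show ?thesis
    unfolding ksum_def[of k] by (intro infsumI has_sum_cong[THEN iffD2, OF eq])
qed

lemma ksum_cont_eq_ksum:
  assumes "1 < Re (a + c)" "2 < Re (a + b + c)"
  shows "ksum_cont K k a b c = ksum k a b c"
  using assms
proof (induction K arbitrary: k a c)
  case (Suc K)
  have "ksum_cont K (Suc k) (a + 1) b c = ksum (Suc k) (a + 1) b c"
    "ksum_cont K (Suc k) a b (c + 1) = ksum (Suc k) a b (c + 1)"
    by (rule Suc.IH; use Suc.prems in auto)+
  then show ?case using ksum_ibp[OF Suc.prems, of k "Suc K"] by simp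
qed simp

text \<open>The substitution u = r x: the kernel is homogeneous of degree -(a + c) in u and r
  jointly. This is what makes the dependence on n a pure power.\<close>

lemma kint_scale:
  assumes r: "0 < r"
  shows "kint (\<lambda>_. 1) r a c r = of_real r powr (1 - (a + c)) * kint (\<lambda>_. 1) 1 a c 1"
proof -
  have k: "kern r a c (r * x) = of_real r powr (- (a + c)) * kern 1 a c x" if "1 \<le> x" for x
  proof -
    have "of_real (r * x) powr (-a) = of_real r powr (-a) * complex_of_real x powr (-a)"
      "of_real (r * x + r) powr (-c) = of_real r powr (-c) * complex_of_real (x + 1) powr (-c)"
      using powr_times_real[of "of_real r" "of_real x" "-a"]
        powr_times_real[of "of_real r" "of_real (x + 1)" "-c"] that r
      by (simp_all add: algebra_simps)
    then show ?thesis unfolding kern_def minus_add_distrib powr_add by simp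
  qed
  have "kint (\<lambda>_. 1) r a c r = \<bar>r\<bar> *\<^sub>R (\<integral>x. indicator {r..} (0 + r * x) *\<^sub>R kern r a c (0 + r * x) \<partial>lborel)"
    unfolding kint_def set_lebesgue_integral_def using r
    by (subst lborel_integral_real_affine[of r _ 0]) auto
  also have "(\<lambda>x. indicator {r..} (0 + r * x) *\<^sub>R kern r a c (0 + r * x)) =
     (\<lambda>x. of_real r powr (- (a + c)) * (indicator {1..} x *\<^sub>R (of_real 1 * kern 1 a c x)))"
    using r k by (auto simp: fun_eq_iff indicator_def)
  also have "\<bar>r\<bar> *\<^sub>R (\<integral>x. of_real r powr (- (a + c)) * (indicator {1..} x *\<^sub>R (of_real 1 * kern 1 a c x)) \<partial>lborel)
      = (of_real r * of_real r powr (- (a + c))) * kint (\<lambda>_. 1) 1 a c 1"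
    unfolding kint_def set_lebesgue_integral_def using r
    by (simp add: scaleR_conv_of_real)
  also have "of_real r * of_real r powr (- (a + c)) = complex_of_real r powr (1 + (- (a + c)))"
    unfolding powr_add using r by simp
  also have "1 + (- (a + c)) = 1 - (a + c)" by simp
  finally show ?thesis .
qed

lemma kreg_scale:
  assumes n: "0 < n"
  shows "kreg (real n) a c (real n) = of_nat n powr (1 - (a + c)) * kreg_cont 0 a c"
proof -
  have "complex_of_real (real n + real n) powr (- c) = 2 powr (- c) * of_nat n powr (- c)"
    using powr_times_real[of 2 "of_nat n" "- c"] by simp
  then have 1: "of_real (real n) powr (1 - a) * complex_of_real (real n + real n) powr (- c)
     = of_nat n powr (1 - (a + c)) * 2 powr (- c)"
    by (simp flip: powr_add add: algebra_simps)
  have "of_nat n powr (1 + (- (a + c))) = of_nat n * complex_of_nat n powr (- (a + c))"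
    unfolding powr_add using n by simp
  also have "1 + (- (a + c)) = 1 - (a + c)" by simp
  finally have eq: "of_nat n powr (1 - (a + c)) = of_nat n * complex_of_nat n powr (- (a + c))" .
  have 2: "complex_of_real (real n) * kint (\<lambda>_. 1) (real n) a (c + 1) (real n) =
     of_nat n powr (1 - (a + c)) * kint (\<lambda>_. 1) 1 a (c + 1) 1"
  proof -
    have "1 - (a + (c + 1)) = - (a + c)" by simp
    then have "kint (\<lambda>_. 1) (real n) a (c + 1) (real n) =
        of_nat n powr (- (a + c)) * kint (\<lambda>_. 1) 1 a (c + 1) 1"
      using kint_scale[of "real n" a "c + 1"] n by (simp only: of_real_of_nat_eq of_nat_0_less_iff)
    then show ?thesis using eq by (simp only: of_real_of_nat_eq mult.assoc)
  qed
  show ?thesis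
    unfolding kreg_def 1 kreg_cont.simps mult.assoc 2 by (simp add: algebra_simps)
qed

text \<open>With K = 0 this evaluates the sum over n already for Re (a + c) > 0, where the inner
  series over m may diverge and \<open>ktail\<close> stands in for it. The approximate formula
  starts from that case.\<close>

lemma AV_cont_has_sum:
  assumes ac: "0 < Re (a + c)" "a + c \<noteq> 1" "2 < Re (a + b + c)" and K: "K = 0 \<or> 1 < Re (a + c)"
  shows "((\<lambda>n. of_nat n powr (- b) * ktail (real n) a c (real n)) has_sum AV_cont K a b c) {1..}"
proof -
  let ?I = "\<lambda>a c n. of_nat n powr (- b) * kint (per_bern 0) (real n) a c (real n)"
  have s1: "(?I (a + 1) c has_sum ksum 0 (a + 1) b c) {1..}"
    unfolding ksum_def
    by (intro has_sum_infsum kint_sum_summable(2)[OF per_bern_measurable per_bern_0_bound]) (use ac in auto)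
  have s2: "(?I a (c + 1) has_sum ksum 0 a b (c + 1)) {1..}"
    unfolding ksum_def
    by (intro has_sum_infsum kint_sum_summable(2)[OF per_bern_measurable per_bern_0_bound]) (use ac in auto)
  have s3: "((\<lambda>n::nat. of_nat n powr (- (a + b + c))) has_sum zeta_cont K (a + b + c)) {1..}"
    by (rule zeta_cont_has_sum) (use ac in auto)
  have s4: "((\<lambda>n::nat. of_nat n powr (- (a + b + c - 1))) has_sum zeta_cont K (a + b + c - 1)) {1..}"
    by (rule zeta_cont_has_sum) (use ac in auto)
  have "((\<lambda>n::nat. kreg_cont 0 a c * of_nat n powr (- (a + b + c - 1)) +
      (- (2 powr (- c) / 2)) * of_nat n powr (- (a + b + c))
      + (- a) * ?I (a + 1) c n + (- c) * ?I a (c + 1) n) has_sum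
     (kreg_cont 0 a c * zeta_cont K (a + b + c - 1) + (- (2 powr (- c) / 2)) * zeta_cont K (a + b + c)
      + (- a) * ksum 0 (a + 1) b c + (- c) * ksum 0 a b (c + 1))) {1..}"
    by (intro has_sum_add has_sum_cmult_right s1 s2 s3 s4)
  also have "kreg_cont 0 a c * zeta_cont K (a + b + c - 1) + (- (2 powr (- c) / 2)) * zeta_cont K (a + b + c)
      + (- a) * ksum 0 (a + 1) b c + (- c) * ksum 0 a b (c + 1) = AV_cont K a b c"
  proof -
    have "ksum_cont K 0 (a + 1) b c = ksum 0 (a + 1) b c" "ksum_cont K 0 a b (c + 1) = ksum 0 a b (c + 1)"
      using K
      by (cases "K = 0"; (simp; fail)?; intro ksum_cont_eq_ksum; use ac in auto)+
    then show ?thesis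
      unfolding AV_cont_def using kreg_cont_eq_kreg_cont_0[OF ac(1,2), of K] by simp
  qed
  finally have "((\<lambda>n::nat. kreg_cont 0 a c * of_nat n powr (- (a + b + c - 1)) +
      (- (2 powr (- c) / 2)) * of_nat n powr (- (a + b + c))
      + (- a) * ?I (a + 1) c n + (- c) * ?I a (c + 1) n) has_sum AV_cont K a b c) {1..}" .
  moreover have eq: "of_nat n powr (- b) * ktail (real n) a c (real n) =
      kreg_cont 0 a c * of_nat n powr (- (a + b + c - 1)) +
      (- (2 powr (- c) / 2)) * of_nat n powr (- (a + b + c))
      + (- a) * ?I (a + 1) c n + (- c) * ?I a (c + 1) n" if "n \<in> {1..}" for n
  proof -
    have n: "0 < n" using that by simp
    have "of_nat n powr (- (a + b + c)) = of_nat n powr (- b) * complex_of_nat n powr (- (a + c))"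
      "of_nat n powr (- (a + b + c - 1)) = of_nat n powr (- b) * complex_of_nat n powr (1 - (a + c))"
      by (simp_all flip: powr_add) (simp_all add: algebra_simps)
    then show ?thesis
      unfolding ktail_def kreg_scale[OF n] kern_scale_1[OF n] per_bern_of_nat
      by (simp add: algebra_simps)
  qed
  ultimately show ?thesis
    by (intro has_sum_cong[THEN iffD2, OF eq])
qed

section \<open>Identification of the Apostol--Vu double zeta-function\<close>

text \<open>Summing over m first gives \<open>ktail\<close>, then summing over n gives
  \<open>AV_cont\<close>. The iterated sum equals the unordered double sum once the family is known
  to be absolutely summable.\<close>

lemma AV_cont_eq_series:
  assumes ac: "1 < Re a + Re c" "2 < Re a + Re b + Re c"
  shows "AV_cont K a b c = AV2_series a b c"
proof -
  let ?S = "Sigma {1::nat..} (\<lambda>n. {n<..})"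
  define f where "f = (\<lambda>(n::nat, m::nat). of_nat n powr (- b) * kern (real n) a c (of_nat m))"
  have ac1: "a + c \<noteq> 1" using ac by (auto dest: arg_cong[of _ _ Re])
  have inner: "((\<lambda>m. f (n, m)) has_sum of_nat n powr (- b) * ktail (real n) a c (real n)) {n<..}"
    if "n \<in> {1..}" for n
    unfolding f_def prod.case by (intro has_sum_cmult_right kern_has_sum(1)) (use that ac in auto)
  have inner_norm: "(\<lambda>m. norm (f (n, m))) summable_on {n<..}" if "n \<in> {1..}" for n
    using inner[OF that] by (intro summable_on_iff_abs_summable_on_complex[THEN iffD1]) (auto simp: summable_on_def)
  \<comment> \<open>The norm of a term is the term with the real exponents Re a, Re b, Re c. The
    same summation formulas at these exponents show that the iterated sum of the norms
    converges.\<close>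
  let ?a = "complex_of_real (Re a)" and ?b = "complex_of_real (Re b)" and ?c = "complex_of_real (Re c)"
  have pr: "complex_of_real t powr (- complex_of_real s) = of_real (t powr (- s))" if "0 \<le> t" for t s
    using that by (metis of_real_minus powr_of_real)
  have norm_inner: "complex_of_real (\<Sum>\<^sub>\<infinity>m\<in>{n<..}. norm (f (n, m))) =
      of_nat n powr (- ?b) * ktail (real n) ?a ?c (real n)" if n: "n \<in> {1..}" for n
  proof -
    have "((\<lambda>m. of_nat n powr (- ?b) * kern (real n) ?a ?c (of_nat m)) has_sum
       of_nat n powr (- ?b) * ktail (real n) ?a ?c (real n)) {n<..}"
      by (intro has_sum_cmult_right kern_has_sum(1)) (use n ac in auto)
    moreover have "of_nat n powr (- ?b) * kern (real n) ?a ?c (of_nat m) = of_real (norm (f (n, m)))"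
      if "m \<in> {n<..}" for m
    proof -
      have "complex_of_real (real n) powr (- ?b) = of_real (real n powr (- Re b))"
        "complex_of_real (real m) powr (- ?a) = of_real (real m powr (- Re a))"
        "complex_of_real (real m + real n) powr (- ?c) = of_real ((real m + real n) powr (- Re c))"
        by (rule pr, simp)+
      then show ?thesis
        using that n by (simp add: f_def norm_mult norm_kern norm_powr_real_powr kern_def)
    qed
    ultimately have "((\<lambda>m. complex_of_real (norm (f (n, m)))) has_sum
       of_nat n powr (- ?b) * ktail (real n) ?a ?c (real n)) {n<..}"
      by (subst has_sum_cong[of _ _ "\<lambda>m. of_nat n powr (- ?b) * kern (real n) ?a ?c (of_nat m)"]) simp_all
    from has_sum_unique[OF has_sum_of_real[OF has_sum_infsum[OF inner_norm[OF n]]] this]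
    show ?thesis .
  qed
  have "((\<lambda>n. of_nat n powr (- ?b) * ktail (real n) ?a ?c (real n)) has_sum AV_cont 0 ?a ?b ?c) {1..}"
    by (rule AV_cont_has_sum) (use ac in \<open>auto dest: arg_cong[of _ _ Re]\<close>)
  then have "(\<lambda>n. of_nat n powr (- ?b) * ktail (real n) ?a ?c (real n)) summable_on {1..}"
    by (auto simp: summable_on_def)
  then have "(\<lambda>n. norm (of_nat n powr (- ?b) * ktail (real n) ?a ?c (real n))) summable_on {1..}"
    by (rule summable_on_iff_abs_summable_on_complex[THEN iffD1])
  then have "(\<lambda>n. norm (\<Sum>\<^sub>\<infinity>m\<in>{n<..}. norm (f (n, m)))) summable_on {1..}"
    by (rule summable_on_cong[THEN iffD1, rotated]) (metis norm_inner norm_of_real real_norm_def)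
  then have "(\<lambda>p. norm (f p)) summable_on ?S"
    using inner_norm by (intro Infinite_Sum.abs_summable_on_Sigma_iff[THEN iffD2]) auto
  then have S: "f summable_on ?S" by (rule abs_summable_summable)
  have "AV2_series a b c = infsum f ?S"
  proof -
    have set_eq: "{(m, n). 0 < n \<and> n < m} = prod.swap ` ?S" by (auto simp: image_iff)
    show ?thesis
      unfolding AV2_series_def set_eq
      by (subst infsum_reindex)
         (auto intro!: infsum_cong simp: f_def kern_def powr_minus field_simps)
  qed
  also have "\<dots> = (\<Sum>\<^sub>\<infinity>n\<in>{1..}. \<Sum>\<^sub>\<infinity>m\<in>{n<..}. f (n, m))"
    by (rule infsum_Sigma_banach[OF S, symmetric])
  also have "\<dots> = (\<Sum>\<^sub>\<infinity>n\<in>{1..}. of_nat n powr (- b) * ktail (real n) a c (real n))"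
    by (intro infsum_cong infsumI inner)
  also have "\<dots> = AV_cont K a b c"
    by (intro infsumI AV_cont_has_sum) (use ac ac1 in auto)
  finally show ?thesis by simp
qed

lemma AV2_dom_conv:
  assumes "1 < Re a + Re c" "2 < Re a + Re b + Re c"
  shows "(a, b, c) \<in> AV2_dom"
  unfolding AV2_dom_iff using assms by (auto dest: arg_cong[of _ _ Re])

lemma holo3_identity:
  assumes f: "holo3 f (slab x y)" and xy: "x \<le> 1" "y \<le> 2"
    and zero: "\<And>a b c. 1 < Re a + Re c \<Longrightarrow> 2 < Re a + Re b + Re c \<Longrightarrow> f a b c = 0"
    and p: "(a, b, c) \<in> slab x y"
  shows "f a b c = 0"
proof -
  let ?H = "{z. x < Re (z + c) \<and> y < Re (z + b + c)}"
  let ?N = "range (\<lambda>l::nat. 1 - of_nat l - c) \<union> range (\<lambda>l::nat. 2 - of_nat l - b - c)"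
  let ?U = "{z. 1 < Re (z + c) \<and> 2 < Re (z + b + c)}"
  have slab_iff: "(z, b, c) \<in> slab x y \<longleftrightarrow> z \<in> ?H - ?N" for z
    by (auto simp: slab_def AV2_dom_iff algebra_simps image_iff)
  have H: "?H = {z. Re z > max (x - Re c) (y - Re b - Re c)}" by auto
  have U: "?U = {z. max (1 - Re c) (2 - Re b - Re c) < Re z}" by auto
  have "open (?H - ?N)"
  proof -
    have "?H - ?N = (\<lambda>z. (z, b, c)) -` slab x y" using slab_iff by auto
    also have "open \<dots>" by (intro open_vimage open_slab continuous_intros)
    finally show ?thesis .
  qed
  moreover have "connected (?H - ?N)"
    unfolding H by (intro connected_open_diff_countable)
      (simp_all add: open_halfspace_Re_gt convex_connected convex_halfspace_Re_gt del: max_less_iff_conj)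
  moreover have "open ?U" unfolding U by (rule open_halfspace_Re_gt)
  moreover have "of_real (max (1 - Re c) (2 - Re b - Re c) + 1) \<in> ?U" unfolding U mem_Collect_eq Re_complex_of_real by linarith
  then have "?U \<noteq> {}" by blast
  moreover have "?U \<subseteq> ?H - ?N"
  proof
    fix z assume z: "z \<in> ?U"
    then have "(z, b, c) \<in> slab x y"
      using AV2_dom_conv[of z c b] xy by (auto simp: slab_def)
    then show "z \<in> ?H - ?N" using slab_iff by blast
  qed
  moreover have "(\<lambda>z. f z b c) holomorphic_on (?H - ?N)"
    unfolding holomorphic_on_def using holo3D(3)[OF f] slab_iff field_differentiable_at_within by blast
  moreover have "f z b c = 0" if "z \<in> ?U" for z
    using zero that by auto
  moreover have "a \<in> ?H - ?N" using p slab_iff by blast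
  ultimately show ?thesis
    using analytic_continuation_open[of ?U "?H - ?N" "\<lambda>z. f z b c" "\<lambda>_. 0" a] by simp
qed

lemma AV_cont_unique:
  assumes f: "holo3 f (slab (- real K) (1 - real K))"
    and ser: "\<And>a b c. 1 < Re a + Re c \<Longrightarrow> 2 < Re a + Re b + Re c \<Longrightarrow> f a b c = AV2_series a b c"
    and p: "(a, b, c) \<in> slab (- real K) (1 - real K)"
  shows "f a b c = AV_cont K a b c"
proof -
  have "f a b c - AV_cont K a b c = 0"
    by (rule holo3_identity[OF holo3_diff[OF f holo3_AV_cont] _ _ _ p])
       (use ser AV_cont_eq_series in auto)
  then show ?thesis by simp
qed

lemma slab_mono: "x \<le> x' \<Longrightarrow> y \<le> y' \<Longrightarrow> slab x' y' \<subseteq> slab x y"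
  by (auto simp: slab_def)

lemma AV_cont_agree:
  assumes "(a, b, c) \<in> slab (- real K) (1 - real K)" "(a, b, c) \<in> slab (- real L) (1 - real L)"
  shows "AV_cont K a b c = AV_cont L a b c"
proof -
  have *: "AV_cont L a b c = AV_cont K a b c"
    if "K \<le> L" "(a, b, c) \<in> slab (- real K) (1 - real K)" for K L
    by (rule AV_cont_unique[OF holo3_subset[OF holo3_AV_cont[of L] open_slab] _ that(2)])
       (use that slab_mono AV_cont_eq_series in auto)
  show ?thesis using *[of K L] *[of L K] assms by (cases "K \<le> L") auto
qed

lemma AV2_dom_slab:
  assumes "(a, b, c) \<in> AV2_dom"
  shows "\<exists>K. (a, b, c) \<in> slab (- real K) (1 - real K)"
proof -
  obtain K where "max (- Re (a + c)) (1 - Re (a + b + c)) < real K"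
    using reals_Archimedean2 by blast
  then show ?thesis using assms by (intro exI[of _ K]) (auto simp: slab_def)
qed

text \<open>By \<open>AV_cont_agree\<close> the chosen K does not affect the value. The value 0 off
  the domain matches the normalisation in \<open>zeta_AV2\<close>, which is what allows the two
  functions to be equal everywhere.\<close>

definition AV_glued where
  "AV_glued a b c = (if (a, b, c) \<in> AV2_dom
     then AV_cont (SOME K. (a, b, c) \<in> slab (- real K) (1 - real K)) a b c else 0)"

lemma AV_glued_eq:
  assumes "(a, b, c) \<in> slab (- real K) (1 - real K)"
  shows "AV_glued a b c = AV_cont K a b c"
proof -
  have "(a, b, c) \<in> AV2_dom" using assms by (simp add: slab_def)
  then show ?thesis
    unfolding AV_glued_def using AV_cont_agree[OF someI_ex[OF AV2_dom_slab] assms] by simp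
qed

lemma AV_glued_eq_series:
  assumes "1 < Re a + Re c" "2 < Re a + Re b + Re c"
  shows "AV_glued a b c = AV2_series a b c"
proof -
  have "(a, b, c) \<in> slab (- real 0) (1 - real 0)"
    using AV2_dom_conv[OF assms] assms by (auto simp: slab_def)
  then show ?thesis using AV_glued_eq AV_cont_eq_series[OF assms] by metis
qed

lemma holo3_AV_glued: "holo3 AV_glued AV2_dom"
proof (rule holo3_local[OF open_AV2_dom])
  fix p assume "p \<in> AV2_dom"
  moreover obtain a b c where "p = (a, b, c)" by (metis prod_cases3)
  ultimately obtain K where "p \<in> slab (- real K) (1 - real K)" using AV2_dom_slab by blast
  moreover have "holo3 AV_glued (slab (- real K) (1 - real K))"
    by (rule holo3_cong[OF holo3_AV_cont]) (simp add: AV_glued_eq)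
  ultimately show "\<exists>E. p \<in> E \<and> E \<subseteq> AV2_dom \<and> holo3 AV_glued E"
    by (intro exI[of _ "slab (- real K) (1 - real K)"]) (auto simp: slab_def)
qed

lemma zeta_AV2_eq_AV_glued: "zeta_AV2 = AV_glued"
  unfolding zeta_AV2_def
proof (rule the_equality)
  show "holo3 AV_glued AV2_dom \<and> (\<forall>a b c. (a, b, c) \<notin> AV2_dom \<longrightarrow> AV_glued a b c = 0) \<and>
      (\<forall>a b c. Re a + Re c > 1 \<and> Re a + Re b + Re c > 2 \<longrightarrow> AV_glued a b c = AV2_series a b c)"
    using holo3_AV_glued AV_glued_eq_series by (auto simp: AV_glued_def)
  fix f assume f: "holo3 f AV2_dom \<and> (\<forall>a b c. (a, b, c) \<notin> AV2_dom \<longrightarrow> f a b c = 0) \<and>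
      (\<forall>a b c. Re a + Re c > 1 \<and> Re a + Re b + Re c > 2 \<longrightarrow> f a b c = AV2_series a b c)"
  show "f = AV_glued"
  proof (intro ext)
    fix a b c
    show "f a b c = AV_glued a b c"
    proof (cases "(a, b, c) \<in> AV2_dom")
      case True
      then obtain K where K: "(a, b, c) \<in> slab (- real K) (1 - real K)" using AV2_dom_slab by blast
      have "holo3 f (slab (- real K) (1 - real K))"
        using f by (intro holo3_subset[OF _ open_slab, of f AV2_dom]) (auto simp: slab_def)
      then have "f a b c = AV_cont K a b c"
        by (rule AV_cont_unique[OF _ _ K]) (use f in auto)
      then show ?thesis using AV_glued_eq[OF K] by simp
    next
      case False
      then show ?thesis using f by (simp add: AV_glued_def)
    qed
  qed
qed

text \<open>The conditions place the point in the slab for K = 0, so the value of the continuation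
  is a convergent sum over n with no further integration by parts.\<close>

lemma zeta_AV2_has_sum:
  assumes "0 < Re (a + c)" "a + c \<noteq> 1" "2 < Re (a + b + c)"
  shows "((\<lambda>n. of_nat n powr (- b) * ktail (real n) a c (real n)) has_sum zeta_AV2 a b c) {1..}"
proof -
  have "(a, b, c) \<in> AV2_dom"
    unfolding AV2_dom_iff
  proof (intro conjI allI)
    fix l :: nat
    show "a + c \<noteq> 1 - of_nat l"
    proof (cases l)
      case 0 then show ?thesis using assms(2) by simp
    next
      case (Suc j) then show ?thesis using assms(1) by (auto dest: arg_cong[of _ _ Re])
    qed
    show "a + b + c \<noteq> 2 - of_nat l" using assms(3) by (auto dest: arg_cong[of _ _ Re])
  qed
  then have "(a, b, c) \<in> slab (- real 0) (1 - real 0)" using assms by (auto simp: slab_def)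
  then show ?thesis
    using AV_cont_has_sum[OF assms, of 0] AV_glued_eq[of a b c 0] by (simp add: zeta_AV2_eq_AV_glued)
qed

section \<open>A periodic first-order equation\<close>

text \<open>An entire function. Expressing the periodic solution through it avoids division by l,
  which may be zero or arbitrarily small.\<close>

definition expm1_div :: "complex \<Rightarrow> complex" where
  "expm1_div z = (if z = 0 then 1 else (exp z - 1) / z)"

lemma expm1_div_holomorphic: "expm1_div holomorphic_on A"
proof -
  have "(\<lambda>z. if z = 0 then deriv exp 0 else (exp z - exp 0) / (z - 0)) holomorphic_on (UNIV :: complex set)"
    by (rule pole_lemma_open) (auto intro!: holomorphic_intros)
  moreover have "deriv exp (0 :: complex) = 1" by (intro DERIV_imp_deriv derivative_eq_intros) auto
  ultimately have "expm1_div holomorphic_on UNIV"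
    by (simp add: expm1_div_def[abs_def] cong: if_cong)
  then show ?thesis by (rule holomorphic_on_subset) auto
qed

lemma mult_expm1_div: "z * expm1_div z = exp z - 1"
  by (simp add: expm1_div_def)

lemma expm1_div_derivative: "(expm1_div has_field_derivative deriv expm1_div z) (at z)"
  by (rule holomorphic_derivI[OF expm1_div_holomorphic open_UNIV]) auto

lemma expm1_div_ode: "z * deriv expm1_div z + expm1_div z = exp z"
proof -
  have "((\<lambda>z. z * expm1_div z) has_field_derivative z * deriv expm1_div z + 1 * expm1_div z) (at z)"
    by (rule derivative_eq_intros expm1_div_derivative refl)+ simp
  moreover have "((\<lambda>z. z * expm1_div z) has_field_derivative exp z) (at z)"
    unfolding mult_expm1_div by (auto intro!: derivative_eq_intros)
  ultimately show ?thesis using DERIV_unique by fastforce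
qed

text \<open>The nonzero zeros of exp z - 1 are multiples of 2 pi i, hence of modulus at least 2 pi.
  The threshold in the hypothesis on t3 has its origin here: at such a zero l would be in resonance
  with a frequency of the sawtooth.\<close>

lemma expm1_div_nonzero:
  assumes "norm z < 2 * pi" shows "expm1_div z \<noteq> 0"
proof
  assume "expm1_div z = 0"
  then have z: "z \<noteq> 0" "exp z = 1" by (auto simp: expm1_div_def split: if_splits)
  then obtain n :: int where n: "Re z = 0" "Im z = of_int (2 * n) * pi" by (auto simp: exp_eq_1)
  with z have "n \<noteq> 0" by (auto simp: complex_eq_iff)
  then have "1 \<le> \<bar>real_of_int n\<bar>" by linarith
  then have "2 * pi \<le> \<bar>Im z\<bar>" unfolding n by (simp add: abs_mult)
  then show False using abs_Im_le_cmod[of z] assms by linarith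
qed

text \<open>Numerator and denominator of the quotient both vanish at 0. Dividing each by z leaves an
  entire function over \<open>expm1_div (- z)\<close>, which has no zero in the disc. The equation
  is stated multiplied out so that it makes sense at 0.\<close>

lemma exists_todd_remainder:
  "\<exists>H. H holomorphic_on ball 0 (2 * pi) \<and> (\<forall>z\<in>ball 0 (2 * pi). H z * (1 - exp (- z)) = 1 - expm1_div (- z))"
proof -
  let ?q = "\<lambda>z. 1 - expm1_div (- z)"
  have q: "?q holomorphic_on UNIV"
    by (intro holomorphic_intros holomorphic_on_compose_gen[of uminus _ expm1_div UNIV, unfolded o_def]
          expm1_div_holomorphic) auto
  define G where "G = (\<lambda>z. if z = 0 then deriv ?q 0 else (?q z - ?q 0) / (z - 0))"
  have G: "G holomorphic_on UNIV" unfolding G_def by (rule pole_lemma_open[OF q open_UNIV])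
  have zG: "z * G z = ?q z" for z by (simp add: G_def expm1_div_def)
  have "(\<lambda>z. G z / expm1_div (- z)) holomorphic_on ball 0 (2 * pi)"
    using expm1_div_nonzero
    by (intro holomorphic_intros holomorphic_on_subset[OF G] expm1_div_holomorphic
          holomorphic_on_compose_gen[of uminus _ expm1_div UNIV, unfolded o_def]) auto
  moreover have "G z / expm1_div (- z) * (1 - exp (- z)) = ?q z" if "z \<in> ball 0 (2 * pi)" for z
  proof -
    have "1 - exp (- z) = z * expm1_div (- z)" using mult_expm1_div[of "- z"] by (simp add: algebra_simps)
    then show ?thesis using expm1_div_nonzero[of "- z"] that zG[of z] by (simp add: mult.commute)
  qed
  ultimately show ?thesis by blast
qed

text \<open>todd_rem extends 1 / (1 - exp (- z)) - 1 / z across the origin.\<close>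

definition todd_rem :: "complex \<Rightarrow> complex" where
  "todd_rem = (SOME H. H holomorphic_on ball 0 (2 * pi) \<and>
     (\<forall>z\<in>ball 0 (2 * pi). H z * (1 - exp (- z)) = 1 - expm1_div (- z)))"

lemma todd_rem_holomorphic: "todd_rem holomorphic_on ball 0 (2 * pi)"
  and todd_rem_eq: "norm z < 2 * pi \<Longrightarrow> todd_rem z * (1 - exp (- z)) = 1 - expm1_div (- z)"
  using someI_ex[OF exists_todd_remainder] unfolding todd_rem_def by auto

lemma todd_rem_derivative:
  assumes "norm z < 2 * pi"
  shows "(todd_rem has_field_derivative deriv todd_rem z) (at z)"
  by (rule holomorphic_derivI[OF todd_rem_holomorphic]) (use assms in auto)

text \<open>On [0, 1] the function v x = x - 1/2 + psol l x is the periodic solution of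
  v' + l v = l (x - 1/2), and psol' is the derivative of psol with respect to l.\<close>

definition psol :: "complex \<Rightarrow> real \<Rightarrow> complex" where
  "psol l x = exp (- l * of_real x) * todd_rem l - of_real x * expm1_div (- l * of_real x)"

definition psol' :: "complex \<Rightarrow> real \<Rightarrow> complex" where
  "psol' l x = - of_real x * exp (- l * of_real x) * todd_rem l + exp (- l * of_real x) * deriv todd_rem l
     + of_real x ^ 2 * deriv expm1_div (- l * of_real x)"

text \<open>A particular solution of the equation is x - 1/2 - 1/l; adding exp (- l x) / (1 - exp (-
  l)) makes the end values equal. In \<open>psol\<close> these terms are regrouped so that the poles
  at l = 0 cancel, and the periodicity reduces to \<open>todd_rem_eq\<close>.\<close>

lemma psol_match:
  assumes "norm l < 2 * pi"
  shows "psol l 1 + 1 / 2 = psol l 0 - 1 / 2"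
proof -
  have "psol l 1 - psol l 0 = - (todd_rem l * (1 - exp (- l))) - expm1_div (- l)"
    by (simp add: psol_def algebra_simps)
  also have "\<dots> = - 1" unfolding todd_rem_eq[OF assms] by simp
  finally show ?thesis by (simp add: algebra_simps)
qed

text \<open>The equation holds for constant l. Since l varies with u, the chain rule adds the term
  with l' and \<open>psol'\<close>, which is small because l varies slowly.\<close>

lemma psol_vector_derivative:
  assumes l: "(l has_vector_derivative l') (at u)" and n: "norm (l u) < 2 * pi"
  shows "((\<lambda>u. of_real (u - m - 1 / 2) + psol (l u) (u - m)) has_vector_derivative
     l u * of_real (u - m - 1 / 2) - l u * (of_real (u - m - 1 / 2) + psol (l u) (u - m))
     + l' * psol' (l u) (u - m)) (at u)"
proof -
  let ?v = "complex_of_real (u - m)"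
  let ?z = "- l u * ?v"
  have dv: "((\<lambda>u. complex_of_real (u - m)) has_vector_derivative 1) (at u)"
    by (auto intro!: derivative_eq_intros)
  have dv': "((\<lambda>u. complex_of_real (u - m - 1 / 2)) has_vector_derivative 1) (at u)"
    by (auto intro!: derivative_eq_intros)
  have dz: "((\<lambda>u. - l u * of_real (u - m)) has_vector_derivative (- l u * 1 + - l' * ?v)) (at u)"
    by (intro has_vector_derivative_mult has_vector_derivative_minus l dv)
  have ch: "((\<lambda>u. g (w u)) has_vector_derivative w' * g') (at u)"
    if "(w has_vector_derivative w') (at u)" "(g has_field_derivative g') (at (w u))" for g w :: "_ \<Rightarrow> complex" and w' g'
    using field_vector_diff_chain_at[OF that] by (simp add: o_def)
  have "((\<lambda>u. of_real (u - m - 1 / 2) + (exp (- l u * of_real (u - m)) * todd_rem (l u)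
        - of_real (u - m) * expm1_div (- l u * of_real (u - m)))) has_vector_derivative
     1 + ((exp ?z * (l' * deriv todd_rem (l u)) + ((- l u * 1 + - l' * ?v) * exp ?z) * todd_rem (l u))
       - (?v * ((- l u * 1 + - l' * ?v) * deriv expm1_div ?z) + 1 * expm1_div ?z))) (at u)"
    by (intro has_vector_derivative_add has_vector_derivative_diff has_vector_derivative_mult dv dv'
          ch[OF dz] ch[OF l] todd_rem_derivative n expm1_div_derivative DERIV_exp)
  moreover have "1 + ((exp ?z * (l' * deriv todd_rem (l u)) + ((- l u * 1 + - l' * ?v) * exp ?z) * todd_rem (l u))
       - (?v * ((- l u * 1 + - l' * ?v) * deriv expm1_div ?z) + 1 * expm1_div ?z)) =
     l u * of_real (u - m - 1 / 2) - l u * (of_real (u - m - 1 / 2) + psol (l u) (u - m))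
     + l' * psol' (l u) (u - m)"
  proof -
    have e1: "exp ?z = ?z * expm1_div ?z + 1" using mult_expm1_div[of ?z] by (simp add: algebra_simps)
    \<comment> \<open>The differentiated form of z * \<open>expm1_div\<close> z = exp z - 1 is what
      removes the derivative of \<open>expm1_div\<close> from the part that does not carry
      l'.\<close>
    have e2: "?z * deriv expm1_div ?z + expm1_div ?z = ?z * expm1_div ?z + 1"
      using expm1_div_ode[of ?z] e1 by simp
    show ?thesis
      using e2 unfolding psol_def psol'_def by (simp add: algebra_simps power2_eq_square)
  qed
  ultimately show ?thesis unfolding psol_def by simp
qed

text \<open>The closed disc of radius \<theta> is compact inside the disc of holomorphy, and l x
  stays in it for x in [0, 1]. The bound is therefore uniform in l, including l near 0.\<close>

lemma psol_bounds:
  assumes "\<theta> < 2 * pi"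
  shows "\<exists>B. \<forall>l x. norm l \<le> \<theta> \<longrightarrow> x \<in> {0..1} \<longrightarrow> norm (psol l x) \<le> B \<and> norm (psol' l x) \<le> B"
proof -
  have bnd: "\<exists>B. \<forall>z. norm z \<le> \<theta> \<longrightarrow> norm (f z) \<le> B" if "f holomorphic_on ball 0 (2 * pi)" for f :: "complex \<Rightarrow> complex"
  proof -
    have "continuous_on (cball 0 \<theta>) f"
      using holomorphic_on_imp_continuous_on[OF that] by (rule continuous_on_subset) (use assms in auto)
    then have "bounded (f ` cball 0 \<theta>)"
      by (intro compact_imp_bounded compact_continuous_image) auto
    then show ?thesis unfolding bounded_iff by (metis image_eqI mem_cball_0)
  qed
  obtain H0 where H0: "\<And>z. norm z \<le> \<theta> \<Longrightarrow> norm (todd_rem z) \<le> H0"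
    using bnd[OF todd_rem_holomorphic] by blast
  obtain H1 where H1: "\<And>z. norm z \<le> \<theta> \<Longrightarrow> norm (deriv todd_rem z) \<le> H1"
    using bnd[OF holomorphic_deriv[OF todd_rem_holomorphic open_ball]] by blast
  obtain Q0 where Q0: "\<And>z. norm z \<le> \<theta> \<Longrightarrow> norm (expm1_div z) \<le> Q0"
    using bnd[OF expm1_div_holomorphic] by blast
  obtain Q1 where Q1: "\<And>z. norm z \<le> \<theta> \<Longrightarrow> norm (deriv expm1_div z) \<le> Q1"
    using bnd[OF holomorphic_deriv[OF expm1_div_holomorphic open_ball]] by blast
  have "norm (psol l x) \<le> exp \<theta> * H0 + Q0 \<and> norm (psol' l x) \<le> exp \<theta> * H0 + exp \<theta> * H1 + Q1"
    if l: "norm l \<le> \<theta>" and x: "x \<in> {0..1}" for l x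
  proof -
    have "norm l * \<bar>x\<bar> \<le> \<theta> * 1" using l x by (intro mult_mono) (auto intro: order_trans[OF norm_ge_zero])
    then have z: "norm (- l * of_real x) \<le> \<theta>" by (simp add: norm_mult)
    have e: "norm (exp (- l * of_real x)) \<le> exp \<theta>"
      using norm_exp[of "- l * of_real x"] z by (meson exp_le_cancel_iff order_trans)
    have nn: "0 \<le> H0" "0 \<le> H1" "0 \<le> Q0" "0 \<le> Q1"
      using H0[OF l] H1[OF l] Q0[OF l] Q1[OF l] norm_ge_zero order_trans by blast+
    have a: "norm (exp (- l * of_real x) * todd_rem l) \<le> exp \<theta> * H0"
      "norm (exp (- l * of_real x) * deriv todd_rem l) \<le> exp \<theta> * H1"
      unfolding norm_mult by (intro mult_mono e H0[OF l] H1[OF l]; simp)+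
    have b: "norm (of_real x * expm1_div (- l * of_real x)) \<le> 1 * Q0"
      unfolding norm_mult by (intro mult_mono Q0[OF z]) (use x in auto)
    have c: "norm (of_real x ^ 2 * deriv expm1_div (- l * of_real x)) \<le> 1 * Q1"
      unfolding norm_mult by (intro mult_mono Q1[OF z]) (use x in \<open>auto simp: norm_power power_le_one\<close>)
    have d: "norm (- of_real x * (exp (- l * of_real x) * todd_rem l)) \<le> 1 * (exp \<theta> * H0)"
      unfolding norm_mult[of "- of_real x"] by (intro mult_mono a(1)) (use x in auto)
    show ?thesis
    proof
      show "norm (psol l x) \<le> exp \<theta> * H0 + Q0"
        unfolding psol_def using a(1) b norm_triangle_ineq4 by (metis (no_types, opaque_lifting) add_mono mult_1 order_trans)
      have "psol' l x = (- of_real x * (exp (- l * of_real x) * todd_rem l) + exp (- l * of_real x) * deriv todd_rem l)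
         + of_real x ^ 2 * deriv expm1_div (- l * of_real x)" by (simp add: psol'_def mult.assoc)
      also have "norm \<dots> \<le> (1 * (exp \<theta> * H0) + exp \<theta> * H1) + 1 * Q1"
        by (intro norm_triangle_mono c d a(2))
      finally show "norm (psol' l x) \<le> exp \<theta> * H0 + exp \<theta> * H1 + Q1" by simp
    qed
  qed
  then have "\<forall>l x. norm l \<le> \<theta> \<longrightarrow> x \<in> {0..1} \<longrightarrow>
     norm (psol l x) \<le> max (exp \<theta> * H0 + Q0) (exp \<theta> * H0 + exp \<theta> * H1 + Q1) \<and>
     norm (psol' l x) \<le> max (exp \<theta> * H0 + Q0) (exp \<theta> * H0 + exp \<theta> * H1 + Q1)"
    by (meson max.coboundedI1 max.coboundedI2)
  then show ?thesis by blast
qed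

section \<open>The first derivative test\<close>

text \<open>With f the kernel and v the periodic solution for the current l, the derivative of v f
  is the sawtooth times f' plus an error G. The large part of f', the one with l, is absorbed
  exactly by the equation for v; G contains only l' and the real part \<rho>, whose contributions
  integrate to a multiple of the modulus of f at y.\<close>

lemma sawtooth_kern_integral_finite_bound:
  assumes \<theta>: "0 \<le> \<theta>" "\<theta> < 2 * pi"
    and B: "\<And>l x. norm l \<le> \<theta> \<Longrightarrow> x \<in> {0..1} \<Longrightarrow> norm (psol l x) \<le> B \<and> norm (psol' l x) \<le> B"
    and pos: "0 \<le> Re a" "0 \<le> Re c" "0 < Re (a + c)" and y: "1 \<le> y" "0 \<le> r" "r \<le> y" "y \<le> z"
    and im: "\<bar>Im a\<bar> + \<bar>Im c\<bar> \<le> \<theta> * y"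
  shows "norm (LBINT u:{y..z}. of_real (per_bern 0 u) * (- a * kern r (a + 1) c u - c * kern r a (c + 1) u))
     \<le> (1 + B * (3 + \<theta>)) * norm (kern r a c y)"
proof -
  define T where "T = \<bar>Im a\<bar> + \<bar>Im c\<bar>"
  \<comment> \<open>The logarithmic derivative of the kernel is l - \<rho>: l is its imaginary part,
    which may be as large as \<theta>, and \<rho> \<ge> 0 describes the decay of the modulus
    N.\<close>
  define l where "l = (\<lambda>u. - \<i> * of_real (Im a / u + Im c / (u + r)))"
  define l' where "l' = (\<lambda>u. \<i> * of_real (Im a / u ^ 2 + Im c / (u + r) ^ 2))"
  define \<rho> where "\<rho> = (\<lambda>u. Re a / u + Re c / (u + r))"
  define N where "N = (\<lambda>u. u powr (- Re a) * (u + r) powr (- Re c))"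
  have norm_eq: "norm (kern r a c u) = N u" if "y \<le> u" for u
    using norm_kern[of u r a c] that y by (simp add: N_def)
  have B0: "0 \<le> B" using B[of 0 0] \<theta> norm_ge_zero order_trans by (metis atLeastAtMost_iff norm_zero order_refl zero_le_one)
  have T0: "0 \<le> T" by (simp add: T_def)
  have ln: "norm (l u) \<le> \<theta>" if "y \<le> u" for u
  proof -
    have "norm (l u) \<le> \<bar>Im a\<bar> / u + \<bar>Im c\<bar> / (u + r)"
      unfolding l_def norm_mult norm_of_real using that y
      by (simp, intro abs_triangle_ineq[THEN order_trans]) (simp add: abs_divide)
    also have "\<dots> \<le> \<bar>Im a\<bar> / y + \<bar>Im c\<bar> / y"
      using that y by (intro add_mono divide_left_mono) auto
    also have "\<dots> \<le> \<theta>" using im y by (simp add: field_simps)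
    finally show ?thesis .
  qed
  have l'n: "norm (l' u) \<le> T / u ^ 2" if "y \<le> u" for u
  proof -
    have "norm (l' u) \<le> \<bar>Im a\<bar> / u ^ 2 + \<bar>Im c\<bar> / (u + r) ^ 2"
      unfolding l'_def norm_mult norm_of_real using that y
      by (simp, intro abs_triangle_ineq[THEN order_trans]) (simp add: abs_divide)
    also have "\<dots> \<le> \<bar>Im a\<bar> / u ^ 2 + \<bar>Im c\<bar> / u ^ 2"
      using that y by (intro add_mono divide_left_mono power_mono) auto
    finally show ?thesis by (simp add: T_def add_divide_distrib)
  qed
  have dl: "(l has_vector_derivative l' u) (at u)" if "y \<le> u" for u
  proof -
    have "((\<lambda>u. Im a / u + Im c / (u + r)) has_real_derivative - (Im a / u ^ 2 + Im c / (u + r) ^ 2)) (at u)"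
      using that y by (auto intro!: derivative_eq_intros simp: power2_eq_square)
    from has_vector_derivative_mult_right[OF has_vector_derivative_of_real[OF this], of "- \<i>"]
    show ?thesis unfolding l_def l'_def by (rule has_vector_derivative_eq_rhs) (simp add: algebra_simps)
  qed
  have dkern: "- a * kern r (a + 1) c u - c * kern r a (c + 1) u = (l u - of_real (\<rho> u)) * kern r a c u"
    if "y \<le> u" for u
  proof -
    have "kern r a c u = of_real u * kern r (a + 1) c u"
      using kern_shift_a[of u r "a + 1" c] that y by simp
    then have 1: "kern r (a + 1) c u = kern r a c u / of_real u" using that y by simp
    have 2: "kern r a (c + 1) u = kern r a c u / of_real (u + r)"
    proof -
      have "complex_of_real (u + r) \<noteq> 0" using that y by (subst of_real_eq_0_iff) simp
      then show ?thesis using kern_shift_c[of u r a c] that y by (simp del: of_real_add)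
    qed
    have E: "l u - of_real (\<rho> u) = - a / of_real u - c / of_real (u + r)"
      unfolding l_def \<rho>_def
      by (simp add: complex_eq_iff Re_divide_of_real Im_divide_of_real del: of_real_add)
    show ?thesis unfolding E 1 2 by (simp add: algebra_simps)
  qed
  have dN: "(N has_real_derivative - \<rho> u * N u) (at u)" if "y \<le> u" for u
  proof -
    have d: "(N has_real_derivative (- Re a * u powr (- Re a - 1)) * (u + r) powr (- Re c)
       + (- Re c * (u + r) powr (- Re c - 1)) * u powr (- Re a)) (at u)"
      unfolding N_def using that y
      by (auto intro!: derivative_eq_intros)
    have p: "u powr (- Re a - 1) = u powr (- Re a) / u" "(u + r) powr (- Re c - 1) = (u + r) powr (- Re c) / (u + r)"
      using that y by (simp_all add: powr_diff)
    show ?thesis by (rule DERIV_cong[OF d]) (unfold p \<rho>_def N_def, simp add: algebra_simps)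
  qed
  have \<rho>0: "0 \<le> \<rho> u" if "y \<le> u" for u using that y pos by (simp add: \<rho>_def)
  have N0: "0 \<le> N u" for u by (simp add: N_def)
  have Nmono: "N u \<le> N y" if "y \<le> u" for u
    unfolding N_def using that y pos by (intro mult_mono powr_mono2') auto
  define k where "k = (\<lambda>(m::int) u. (of_real (u - of_int m - 1 / 2) + psol (l (max y u)) (u - of_int m)) * kern r a c (max y u))"
  define F where "F = (\<lambda>u. k \<lfloor>u\<rfloor> u)"
  have F: "F u = (of_real (per_bern 0 u) + psol (l u) (frac u)) * kern r a c u" if "y \<le> u" for u
    using that by (simp add: F_def k_def per_bern_0 frac_def max_def)
  define G where "G = (\<lambda>u. (l' u * psol' (l u) (frac u) - of_real (\<rho> u) * psol (l u) (frac u)) * kern r a c u)"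
  let ?f = "\<lambda>u. of_real (per_bern 0 u) * (- a * kern r (a + 1) c u - c * kern r a (c + 1) u)"
  have fr: "frac u \<in> {0..1}" for u :: real using frac_lt_1[of u] by simp
  have contF: "continuous_on {y..z} F"
  proof -
    have "continuous_on {of_int \<lfloor>y\<rfloor>..} F"
      unfolding F_def
    proof (rule continuous_on_floor_paste)
      fix m :: int
      have cl: "continuous_on {y..} l"
        by (intro continuous_at_imp_continuous_on ballI has_vector_derivative_continuous[OF dl]) simp
      have clm: "continuous_on S (\<lambda>u. l (max y u))" for S
        by (rule continuous_on_compose2[OF cl]) (auto intro!: continuous_intros)
      have ckm: "continuous_on S (\<lambda>u. kern r a c (max y u))" for S
        by (rule continuous_on_compose2[OF continuous_on_kern[of r "{y..}"]])
           (use y in \<open>auto intro!: continuous_intros\<close>)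
      have ct: "continuous_on S (\<lambda>u. todd_rem (l (max y u)))" for S
        by (rule continuous_on_compose2[OF holomorphic_on_imp_continuous_on[OF todd_rem_holomorphic] clm])
           (use order.strict_trans1[OF ln \<theta>(2)] in \<open>simp add: image_subset_iff\<close>)
      have ce: "continuous_on S (\<lambda>u. expm1_div (- l (max y u) * of_real (u - of_int m)))" for S
        by (rule continuous_on_compose2[OF holomorphic_on_imp_continuous_on[OF expm1_div_holomorphic[of UNIV]]])
           (auto intro!: continuous_intros clm)
      show "continuous_on {of_int m..of_int m + 1} (k m)"
        unfolding k_def psol_def by (intro continuous_intros ckm ct ce clm)
      have "norm (l (max y (of_int m + 1))) < 2 * pi" using ln[of "max y (of_int m + 1)"] \<theta> by simp
      from psol_match[OF this] show "k m (of_int m + 1) = k (m + 1) (of_int m + 1)"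
        by (simp add: k_def add.commute)
    qed
    then show ?thesis by (rule continuous_on_subset) (use y in \<open>auto intro: order_trans[OF of_int_floor_le]\<close>)
  qed
  have derF: "(F has_vector_derivative ?f u + G u) (at u)" if u: "y < u" "u \<notin> \<int>" for u
  proof -
    let ?m = "real_of_int \<lfloor>u\<rfloor>"
    have "((\<lambda>u. (of_real (u - ?m - 1 / 2) + psol (l u) (u - ?m)) * kern r a c u) has_vector_derivative
        (of_real (u - ?m - 1 / 2) + psol (l u) (u - ?m)) * (- a * kern r (a + 1) c u - c * kern r a (c + 1) u)
        + (l u * of_real (u - ?m - 1 / 2) - l u * (of_real (u - ?m - 1 / 2) + psol (l u) (u - ?m))
     + l' u * psol' (l u) (u - ?m)) * kern r a c u) (at u)"
      by (intro has_vector_derivative_mult psol_vector_derivative dl kern_has_vector_derivative)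
         (use u y ln[of u] \<theta> in auto)
    then have "((\<lambda>u. (of_real (u - ?m - 1 / 2) + psol (l u) (u - ?m)) * kern r a c u) has_vector_derivative
        ?f u + G u) (at u)"
    proof (rule has_vector_derivative_eq_rhs)
      have uy: "y \<le> u" using u by simp
      show "(of_real (u - ?m - 1 / 2) + psol (l u) (u - ?m)) * (- a * kern r (a + 1) c u - c * kern r a (c + 1) u)
        + (l u * of_real (u - ?m - 1 / 2) - l u * (of_real (u - ?m - 1 / 2) + psol (l u) (u - ?m))
          + l' u * psol' (l u) (u - ?m)) * kern r a c u = ?f u + G u"
        unfolding dkern[OF uy] G_def per_bern_0 frac_def by (simp add: algebra_simps)
    qed
    then have "(k \<lfloor>u\<rfloor> has_vector_derivative ?f u + G u) (at u)"
      by (rule has_vector_derivative_transform_within_open[of _ _ _ "{y<..}"])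
         (use u in \<open>auto simp: k_def max_def\<close>)
    from has_vector_derivative_floor[where k = k, OF u(2) this] show ?thesis unfolding F_def .
  qed
  have hi: "((\<lambda>u. ?f u + G u) has_integral (F z - F y)) {y..z}"
    by (rule fundamental_theorem_of_calculus_interior_strong[of "\<int> \<inter> {y..z}"])
       (use y derF contF finite_Ints_Int_Icc in auto)
  have sif: "set_integrable lborel {y..z} ?f"
  proof -
    have ip: "set_integrable lborel {y..z} (\<lambda>u. of_real (per_bern 0 u) * kern r a' c' u)"
      if "1 < Re (a' + c')" for a' c'
      by (rule set_integrable_subset[OF kern_integrable(1)[OF per_bern_measurable per_bern_0_bound, of y r a' c']])
         (use y that in auto)
    have "?f = (\<lambda>u. - a * (of_real (per_bern 0 u) * kern r (a + 1) c u) - c * (of_real (per_bern 0 u) * kern r a (c + 1) u))"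
      by (auto simp: algebra_simps)
    then show ?thesis
      by (simp only:) (intro set_integral_diff set_integrable_mult_right ip; use pos in simp)
  qed
  note fi = set_borel_integral_eq_integral[OF sif]
  have fhi: "(?f has_integral (LBINT u:{y..z}. ?f u)) {y..z}"
    using fi by (simp add: has_integral_integral)
  \<comment> \<open>Integrability of G is obtained as that of a difference, which spares a
    measurability argument for its fractional-part factors.\<close>
  have Ghi: "(G has_integral (F z - F y - (LBINT u:{y..z}. ?f u))) {y..z}"
    using has_integral_diff[OF hi fhi] by simp
  \<comment> \<open>W majorises G and has an explicit primitive: T / u^2 comes from l', with N u
    replaced by N y, and \<rho> N is minus the derivative of N.\<close>
  define W where "W = (\<lambda>u. B * (T * N y / u ^ 2 + \<rho> u * N u))"
  have Whi: "(W has_integral (- B * (T * N y / z + N z) - - B * (T * N y / y + N y))) {y..z}"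
  proof (rule fundamental_theorem_of_calculus[OF \<open>y \<le> z\<close>])
    fix u assume "u \<in> {y..z}"
    then have u: "y \<le> u" "0 < u" using y by auto
    have "((\<lambda>u. - B * (T * N y / u + N u)) has_real_derivative W u) (at u)"
      unfolding W_def using u
      by (auto intro!: derivative_eq_intros dN[OF u(1)] simp: power2_eq_square field_simps)
    then show "((\<lambda>u. - B * (T * N y / u + N u)) has_vector_derivative W u) (at u within {y..z})"
      by (simp add: has_real_derivative_iff_has_vector_derivative has_vector_derivative_at_within)
  qed
  have GW: "norm (G u) \<le> W u" if "u \<in> {y..z}" for u
  proof -
    have u: "y \<le> u" using that by simp
    note b = B[OF ln[OF u] fr[of u]]
    have "norm (G u) = norm (l' u * psol' (l u) (frac u) - of_real (\<rho> u) * psol (l u) (frac u)) * N u"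
      unfolding G_def norm_mult norm_eq[OF u] ..
    also have "norm (l' u * psol' (l u) (frac u) - of_real (\<rho> u) * psol (l u) (frac u)) \<le>
       T / u ^ 2 * B + \<rho> u * B"
      by (rule norm_triangle_le_diff, unfold norm_mult norm_of_real, intro add_mono mult_mono)
         (use l'n[OF u] b \<rho>0[OF u] T0 in auto)
    also have "(T / u ^ 2 * B + \<rho> u * B) * N u = B * (T * N u / u ^ 2 + \<rho> u * N u)"
      by (simp add: algebra_simps)
    also have "\<dots> \<le> W u"
      unfolding W_def using Nmono[OF u] T0 B0 \<rho>0[OF u]
      by (intro mult_left_mono add_mono divide_right_mono) auto
    finally show ?thesis using N0[of u] by (simp add: mult_right_mono)
  qed
  have "norm (F z - F y - (LBINT u:{y..z}. ?f u)) \<le> - B * (T * N y / z + N z) - - B * (T * N y / y + N y)"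
    using integral_norm_bound_integral[of G "{y..z}" W] Ghi Whi GW
    by (auto simp: has_integral_iff)
  also have "\<dots> \<le> B * (T * N y / y + N y)"
    using B0 T0 N0 y by (simp add: field_simps)
  also have "T * N y / y \<le> \<theta> * N y"
    using im y N0[of y] mult_right_mono[OF im N0[of y]] by (simp add: T_def field_simps)
  finally have 1: "norm (F z - F y - (LBINT u:{y..z}. ?f u)) \<le> B * (\<theta> * N y + N y)"
    using B0 by (simp add: mult_left_mono)
  have Fb: "norm (F u) \<le> (1 / 2 + B) * N y" if u: "y \<le> u" for u
  proof -
    have "norm (F u) = norm (of_real (per_bern 0 u) + psol (l u) (frac u)) * N u"
      unfolding F[OF u] norm_mult norm_eq[OF u] ..
    also have "\<dots> \<le> (1 / 2 + B) * N y"
      using B[OF ln[OF u] fr[of u]] per_bern_0_bound[of u] Nmono[OF u] N0 B0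
      by (intro mult_mono norm_triangle_le add_mono) auto
    finally show ?thesis .
  qed
  \<comment> \<open>The two end values of F contribute 1/2 + B each and G contributes B (\<theta> +
    1), which adds up to 1 + B (3 + \<theta>).\<close>
  have "norm (LBINT u:{y..z}. ?f u) = norm (F z - F y - (F z - F y - (LBINT u:{y..z}. ?f u)))" by simp
  also have "\<dots> \<le> ((1 / 2 + B) * N y + (1 / 2 + B) * N y) + B * (\<theta> * N y + N y)"
    by (intro norm_triangle_le_diff add_mono 1 Fb) (use y in auto)
  also have "\<dots> = (1 + B * (3 + \<theta>)) * norm (kern r a c y)"
    unfolding norm_eq[OF order_refl] by (simp add: algebra_simps)
  finally show ?thesis .
qed

text \<open>The previous bound does not involve z, so it passes to the limit; the extra 1/2 in K is
  the boundary value of the sawtooth. K depends on \<theta> alone, which provides the uniformity in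
  t3.\<close>

lemma sawtooth_kern_integral_bound:
  assumes \<theta>: "0 \<le> \<theta>" "\<theta> < 2 * pi"
  obtains K where "0 \<le> K" "\<And>a c r y. \<lbrakk>0 \<le> Re a; 0 \<le> Re c; 0 < Re (a + c); 1 \<le> y; 0 \<le> r; r \<le> y;
      \<bar>Im a\<bar> + \<bar>Im c\<bar> \<le> \<theta> * y\<rbrakk> \<Longrightarrow>
      norm (ktail r a c y - kreg r a c y) \<le> K * y powr (- Re (a + c))"
proof -
  obtain B where B: "\<And>l x. norm l \<le> \<theta> \<Longrightarrow> x \<in> {0..1} \<Longrightarrow> norm (psol l x) \<le> B \<and> norm (psol' l x) \<le> B"
    using psol_bounds[OF \<theta>(2)] by blast
  have "norm (psol 0 0) \<le> B" using B[of 0 0] \<theta> by simp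
  then have B0: "0 \<le> B" using norm_ge_zero order_trans by blast
  define K where "K = 1 / 2 + (1 + B * (3 + \<theta>))"
  have "0 \<le> K" using B0 \<theta> by (simp add: K_def)
  moreover have "norm (ktail r a c y - kreg r a c y) \<le> K * y powr (- Re (a + c))"
    if h: "0 \<le> Re a" "0 \<le> Re c" "0 < Re (a + c)" "1 \<le> y" "0 \<le> r" "r \<le> y" "\<bar>Im a\<bar> + \<bar>Im c\<bar> \<le> \<theta> * y" for a c r y
  proof -
    let ?f = "\<lambda>u. of_real (per_bern 0 u) * (- a * kern r (a + 1) c u - c * kern r a (c + 1) u)"
    have i1: "set_integrable lborel {y..} (\<lambda>u. of_real (per_bern 0 u) * kern r (a + 1) c u)"
      and i2: "set_integrable lborel {y..} (\<lambda>u. of_real (per_bern 0 u) * kern r a (c + 1) u)"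
      by (rule kern_integrable(1)[OF per_bern_measurable per_bern_0_bound]; use h in simp)+
    have f_eq: "?f = (\<lambda>u. (- a) * (of_real (per_bern 0 u) * kern r (a + 1) c u) - c * (of_real (per_bern 0 u) * kern r a (c + 1) u))"
      by (auto simp: algebra_simps)
    have si: "set_integrable lborel {y..} ?f"
      unfolding f_eq by (intro set_integral_diff set_integrable_mult_right i1 i2)
    have val: "(LBINT u:{y..}. ?f u) = - a * kint (per_bern 0) r (a + 1) c y - c * kint (per_bern 0) r a (c + 1) y"
    proof -
      have "set_integrable lborel {y..} (\<lambda>u. - a * (of_real (per_bern 0 u) * kern r (a + 1) c u))"
        "set_integrable lborel {y..} (\<lambda>u. c * (of_real (per_bern 0 u) * kern r a (c + 1) u))"
        by (intro set_integrable_mult_right i1 i2)+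
      then show ?thesis
        unfolding f_eq kint_def by (simp only: set_integral_diff(2) set_integral_mult_right)
    qed
    have "((\<lambda>z. LBINT u:{y..z}. ?f u) \<longlongrightarrow> (LBINT u:{y..}. ?f u)) at_top"
      by (rule tendsto_set_lebesgue_integral_at_top[OF _ si]) auto
    moreover have "\<forall>\<^sub>F z in at_top. norm (LBINT u:{y..z}. ?f u) \<le> (1 + B * (3 + \<theta>)) * norm (kern r a c y)"
      using eventually_ge_at_top[of y]
      by eventually_elim (rule sawtooth_kern_integral_finite_bound[OF \<theta> B h(1-6) _ h(7)])
    ultimately have 1: "norm (LBINT u:{y..}. ?f u) \<le> (1 + B * (3 + \<theta>)) * norm (kern r a c y)"
      by (intro tendsto_upperbound[OF tendsto_norm]) auto
    have "ktail r a c y - kreg r a c y = of_real (per_bern 0 y) * kern r a c y + (LBINT u:{y..}. ?f u)"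
      unfolding val ktail_def by simp
    also have "norm \<dots> \<le> 1 / 2 * norm (kern r a c y) + (1 + B * (3 + \<theta>)) * norm (kern r a c y)"
      by (intro norm_triangle_mono 1) (simp only: norm_mult norm_of_real, intro mult_right_mono per_bern_0_bound norm_ge_zero)
    also have "\<dots> = K * norm (kern r a c y)" by (simp add: K_def algebra_simps)
    also have "norm (kern r a c y) \<le> y powr (- Re a) * y powr (- Re c)"
      using h by (subst norm_kern) (auto intro!: mult_left_mono powr_mono2')
    also have "y powr (- Re a) * y powr (- Re c) = y powr (- Re (a + c))"
      by (simp flip: powr_add)
    finally show ?thesis using \<open>0 \<le> K\<close> by (simp add: mult_left_mono)
  qed
  ultimately show ?thesis using that by blast
qed

section \<open>Power sums as the special case r = 0, c = 0\<close>

lemma kreg_0: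
  "kreg 0 (of_real s) 0 y = of_real (y powr (1 - s) / (s - 1))" if "0 < y"
proof -
  have "complex_of_real y powr (1 - of_real s) = of_real (y powr (1 - s))"
    using that powr_of_real[of y "1 - s"] by simp
  then show ?thesis using that by (simp add: kreg_def)
qed

lemma nat_floor_ge_half:
  assumes "1 \<le> x" shows "0 < nat \<lfloor>x\<rfloor>" "real (nat \<lfloor>x\<rfloor>) \<le> x" "x \<le> 2 * real (nat \<lfloor>x\<rfloor>)"
proof -
  have "1 \<le> \<lfloor>x\<rfloor>" using assms by simp
  then show "0 < nat \<lfloor>x\<rfloor>" "real (nat \<lfloor>x\<rfloor>) \<le> x" "x \<le> 2 * real (nat \<lfloor>x\<rfloor>)"
    by linarith+
qed

lemma powr_tail_sum_bound:
  assumes s: "1 < s"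
  obtains C where "0 \<le> C" "\<And>x. 1 \<le> x \<Longrightarrow> (\<Sum>\<^sub>\<infinity>n\<in>{nat \<lfloor>x\<rfloor><..}. real n powr (- s)) \<le> C * x powr (1 - s)"
proof -
  obtain K where K: "0 \<le> K" "\<And>a c r y. \<lbrakk>0 \<le> Re a; 0 \<le> Re c; 0 < Re (a + c); 1 \<le> y; 0 \<le> r; r \<le> y;
      \<bar>Im a\<bar> + \<bar>Im c\<bar> \<le> 0 * y\<rbrakk> \<Longrightarrow> norm (ktail r a c y - kreg r a c y) \<le> K * y powr (- Re (a + c))"
    using sawtooth_kern_integral_bound[of 0] pi_gt_zero by (metis mult_pos_pos order_refl zero_less_numeral)
  \<comment> \<open>The exponent s is real, so the sawtooth bound is used with \<theta> = 0; the
    term 1 / (s - 1) comes from \<open>kreg_0\<close>, and the power of 2 from replacing N by the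
    smaller x / 2.\<close>
  define C where "C = (K + 1 / (s - 1)) * 2 powr (s - 1)"
  have "(\<Sum>\<^sub>\<infinity>n\<in>{nat \<lfloor>x\<rfloor><..}. real n powr (- s)) \<le> C * x powr (1 - s)" if x: "1 \<le> x" for x
  proof -
    define N where "N = nat \<lfloor>x\<rfloor>"
    note N = nat_floor_ge_half[OF x, folded N_def]
    let ?t = "ktail 0 (of_real s) 0 (real N)"
    have hs: "((\<lambda>n. kern 0 (of_real s) 0 (of_nat n)) has_sum ?t) {N<..}"
      by (rule kern_has_sum) (use N s in auto)
    have "kern 0 (of_real s) 0 (real n) = of_real (real n powr (- s))" if "n \<in> {N<..}" for n
      using that powr_of_real[of "real n" "- s"] by (simp add: kern_def)
    from has_sum_cong[THEN iffD1, OF this hs]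
    have "((\<lambda>n. complex_of_real (real n powr (- s))) has_sum ?t) {N<..}" .
    from has_sum_unique[OF has_sum_of_real[OF has_sum_infsum[OF powr_summable_on[OF s]]] this]
    have "complex_of_real (\<Sum>\<^sub>\<infinity>n\<in>{N<..}. real n powr (- s)) = ?t" .
    then have "(\<Sum>\<^sub>\<infinity>n\<in>{N<..}. real n powr (- s)) \<le> norm ?t"
      by (metis abs_ge_self norm_of_real)
    also have "\<dots> = norm ((?t - kreg 0 (of_real s) 0 (real N)) + kreg 0 (of_real s) 0 (real N))" by simp
    also have "\<dots> \<le> K * real N powr (- Re (of_real s + 0)) + real N powr (1 - s) / (s - 1)"
      by (intro norm_triangle_mono K(2)) (use N s in \<open>auto simp: kreg_0 norm_divide simp flip: of_real_diff\<close>)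
    also have "\<dots> \<le> K * real N powr (1 - s) + real N powr (1 - s) / (s - 1)"
      using K(1) N by (intro add_right_mono mult_left_mono powr_mono) auto
    also have "\<dots> = (K + 1 / (s - 1)) * real N powr (1 - s)" by (simp add: algebra_simps)
    also have "real N powr (1 - s) \<le> (x / 2) powr (1 - s)"
      using N x s by (intro powr_mono2') auto
    also have "(x / 2) powr (1 - s) = 2 powr (s - 1) * x powr (1 - s)"
      using x by (simp add: powr_divide powr_diff field_simps)
    finally show ?thesis
      unfolding C_def N_def[symmetric] using K(1) s by (simp add: mult.assoc mult_left_mono)
  qed
  moreover have "0 \<le> C" using K s by (simp add: C_def)
  ultimately show ?thesis using that by blast
qed

lemma harmonic_sum_le: "0 < N \<Longrightarrow> (\<Sum>n\<in>{1..N}. real n powr (- 1)) \<le> 1 + ln (real N)"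
proof (induction N rule: nat_induct_non_zero)
  case (Suc n)
  have "ln (real n / real (Suc n)) \<le> real n / real (Suc n) - 1"
    using Suc.hyps by (intro ln_le_minus_one) auto
  then have "1 / real (Suc n) \<le> ln (real (Suc n)) - ln (real n)"
    using Suc.hyps by (simp add: ln_div field_simps)
  then show ?case using Suc.IH by (simp add: powr_minus_divide)
qed simp

text \<open>The order of the sum of n to the power -s over n \<le> x. At s = 1 it is 1 + ln x
  instead of ln x because x = 1 is allowed, where the logarithm vanishes but the sum does
  not.\<close>

definition powr_growth :: "real \<Rightarrow> real \<Rightarrow> real" where
  "powr_growth s x = (if s > 1 then 1 else if s = 1 then 1 + ln x else x powr (1 - s))"

text \<open>It lets the contribution of n > x, which always has the size of a power of x, be
  absorbed in the error term of each of the three cases.\<close>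

lemma powr_growth_ge: "1 \<le> x \<Longrightarrow> x powr (1 - s) \<le> powr_growth s x"
proof -
  assume x: "1 \<le> x"
  show ?thesis
  proof (cases "1 < s")
    case True
    have "x powr (1 - s) \<le> x powr 0" using x True by (intro powr_mono) auto
    then show ?thesis using True x by (simp add: powr_growth_def)
  next
    case False
    then show ?thesis using x ln_ge_zero[OF x] by (auto simp: powr_growth_def)
  qed
qed

lemma powr_partial_sum_bound:
  obtains C where "0 \<le> C" "\<And>x. 1 \<le> x \<Longrightarrow> (\<Sum>n\<in>{1..nat \<lfloor>x\<rfloor>}. real n powr (- s)) \<le> C * powr_growth s x"
proof -
  consider "1 < s" | "s = 1" | "s \<le> 0" | "0 < s" "s < 1" by linarith
  then show ?thesis
  proof cases
    case 1
    show ?thesis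
    proof (rule that[of "\<Sum>\<^sub>\<infinity>n. real n powr (- s)"])
      show "0 \<le> (\<Sum>\<^sub>\<infinity>n. real n powr (- s))" by (rule infsum_nonneg) simp
      show "(\<Sum>n\<in>{1..nat \<lfloor>x\<rfloor>}. real n powr (- s)) \<le> (\<Sum>\<^sub>\<infinity>n. real n powr (- s)) * powr_growth s x" for x
        using finite_sum_le_infsum[OF powr_summable_on[OF 1, of UNIV], of "{1..nat \<lfloor>x\<rfloor>}"] 1
        by (simp add: powr_growth_def)
    qed
  next
    case 2
    show ?thesis
    proof (rule that[of 1])
      fix x :: real assume x: "1 \<le> x"
      note N = nat_floor_ge_half[OF x]
      have "ln (real (nat \<lfloor>x\<rfloor>)) \<le> ln x" using N x by (intro ln_mono) auto
      then show "(\<Sum>n\<in>{1..nat \<lfloor>x\<rfloor>}. real n powr (- s)) \<le> 1 * powr_growth s x"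
        using harmonic_sum_le[OF N(1)] 2 by (simp add: powr_growth_def)
    qed simp
  next
    case 3
    show ?thesis
    proof (rule that[of 1])
      fix x :: real assume x: "1 \<le> x"
      note N = nat_floor_ge_half[OF x]
      have "(\<Sum>n\<in>{1..nat \<lfloor>x\<rfloor>}. real n powr (- s)) \<le> (\<Sum>n\<in>{1..nat \<lfloor>x\<rfloor>}. x powr (- s))"
      proof (intro sum_mono powr_mono2)
        fix n assume "n \<in> {1..nat \<lfloor>x\<rfloor>}"
        then have "real n \<le> real (nat \<lfloor>x\<rfloor>)" by simp
        then show "real n \<le> x" using N(2) by linarith
      qed (use 3 in auto)
      also have "\<dots> \<le> x * x powr (- s)" using N by (simp add: mult_right_mono)
      also have "\<dots> = x powr (1 - s)" using x by (simp add: powr_diff powr_minus_divide)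
      finally show "(\<Sum>n\<in>{1..nat \<lfloor>x\<rfloor>}. real n powr (- s)) \<le> 1 * powr_growth s x"
        using 3 by (simp add: powr_growth_def)
    qed simp
  next
    case 4
    obtain K where K: "0 \<le> K" "\<And>a c r y. \<lbrakk>0 \<le> Re a; 0 \<le> Re c; 0 < Re (a + c); 1 \<le> y; 0 \<le> r; r \<le> y;
        \<bar>Im a\<bar> + \<bar>Im c\<bar> \<le> 0 * y\<rbrakk> \<Longrightarrow> norm (ktail r a c y - kreg r a c y) \<le> K * y powr (- Re (a + c))"
      using sawtooth_kern_integral_bound[of 0] pi_gt_zero by (metis mult_pos_pos order_refl zero_less_numeral)
    define D where "D = K + 1 / (1 - s)"
    have D: "norm (ktail 0 (of_real s) 0 y) \<le> D * y powr (1 - s)" if y: "1 \<le> y" for y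
    proof -
      have "norm (ktail 0 (of_real s) 0 y) = norm ((ktail 0 (of_real s) 0 y - kreg 0 (of_real s) 0 y) + kreg 0 (of_real s) 0 y)"
        by simp
      also have "\<dots> \<le> K * y powr (- Re (of_real s + 0)) + y powr (1 - s) / (1 - s)"
        by (intro norm_triangle_mono K(2)) (use y 4 in \<open>auto simp: kreg_0 norm_divide simp flip: of_real_diff\<close>)
      also have "\<dots> \<le> K * y powr (1 - s) + y powr (1 - s) / (1 - s)"
        using K(1) y by (intro add_right_mono mult_left_mono powr_mono) auto
      finally show ?thesis by (simp add: D_def algebra_simps)
    qed
    have D0: "0 \<le> D" using K 4 by (simp add: D_def)
    show ?thesis
    \<comment> \<open>For 0 < s < 1 the series diverges, but a partial sum is still a difference of
      two values of \<open>ktail\<close>: each of them costs D, and the summand n = 1 costs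
      1.\<close>
    proof (rule that[of "1 + D + D"])
      fix x :: real assume x: "1 \<le> x"
      define N where "N = nat \<lfloor>x\<rfloor>"
      note N = nat_floor_ge_half[OF x, folded N_def]
      have k: "kern 0 (of_real s) 0 (real n) = of_real (real n powr (- s))" if "0 < n" for n
        using that powr_of_real[of "real n" "- s"] by (simp add: kern_def)
      have "ktail 0 (of_real s) 0 1 = (\<Sum>m\<in>{1<..N}. kern 0 (of_real s) 0 (of_nat m)) + ktail 0 (of_real s) 0 (real N)"
        using ktail_split[of 1 0 "real N" "of_real s" 0] N 4 by simp
      also have "(\<Sum>m\<in>{1<..N}. kern 0 (of_real s) 0 (of_nat m)) = complex_of_real (\<Sum>m\<in>{1<..N}. real m powr (- s))"
        unfolding of_real_sum by (intro sum.cong refl k) auto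
      finally have "complex_of_real (\<Sum>m\<in>{1<..N}. real m powr (- s)) = ktail 0 (of_real s) 0 1 - ktail 0 (of_real s) 0 (real N)"
        by simp
      then have "(\<Sum>m\<in>{1<..N}. real m powr (- s)) \<le> norm (ktail 0 (of_real s) 0 1 - ktail 0 (of_real s) 0 (real N))"
        by (metis abs_ge_self norm_of_real)
      also have "\<dots> \<le> D * 1 powr (1 - s) + D * real N powr (1 - s)"
        by (intro norm_triangle_le_diff add_mono D) (use N in auto)
      also have "\<dots> \<le> D * x powr (1 - s) + D * x powr (1 - s)"
        using D0 N x 4 by (intro add_mono mult_left_mono powr_mono2) auto
      finally have "(\<Sum>m\<in>{1<..N}. real m powr (- s)) \<le> (D + D) * x powr (1 - s)" by (simp add: algebra_simps)
      moreover have "{1..N} = insert 1 {1<..N}" using N by auto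
      moreover have "1 \<le> x powr (1 - s)" using x 4 by (intro ge_one_powr_ge_zero) auto
      ultimately show "(\<Sum>n\<in>{1..nat \<lfloor>x\<rfloor>}. real n powr (- s)) \<le> (1 + D + D) * powr_growth s x"
        using 4 unfolding N_def[symmetric] by (simp add: powr_growth_def algebra_simps)
    qed (use D0 in auto)
  qed
qed

section \<open>The approximate formula\<close>

lemma has_sum_minus:
  fixes f g :: "'a \<Rightarrow> complex"
  assumes "(f has_sum s) A" "(g has_sum t) A"
  shows "((\<lambda>x. f x - g x) has_sum (s - t)) A"
  using has_sum_add[OF assms(1) has_sum_cmult_right[OF assms(2), of "- 1"]] by simp

lemma summable_on_powr_kreg:
  assumes "0 < Re (a + c)" "2 < Re (a + b + c)"
  shows "(\<lambda>n::nat. 1 / of_nat n powr (a + b + c - 1)) summable_on A"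
    "0 \<notin> A \<Longrightarrow> (\<lambda>n. 1 / of_nat n powr (b - 1) * kint (\<lambda>_. 1) (real n) a (c + 1) (real n)) summable_on A"
proof -
  show "(\<lambda>n::nat. 1 / of_nat n powr (a + b + c - 1)) summable_on A"
  proof (rule summable_on_powr_bound(2)[of "Re (a + b + c) - 1" _ _ 1])
    show "norm (1 / complex_of_nat n powr (a + b + c - 1)) \<le> 1 * real n powr (- (Re (a + b + c) - 1))" for n
      unfolding powr_minus_divide by (simp add: norm_divide norm_powr_real_powr)
  qed (use assms in simp)
  show "(\<lambda>n. 1 / of_nat n powr (b - 1) * kint (\<lambda>_. 1) (real n) a (c + 1) (real n)) summable_on A" if "0 \<notin> A"
  proof (rule summable_on_powr_bound(2)[of "Re (a + (b - 1) + (c + 1)) - 1"])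
    fix n assume "n \<in> A"
    then have "0 < n" using that by (metis gr0I)
    from kint_term_bound[of "\<lambda>_. 1" 1 n a "c + 1" "b - 1", OF _ _ this]
    show "norm (1 / of_nat n powr (b - 1) * kint (\<lambda>_. 1) (real n) a (c + 1) (real n)) \<le>
      1 * 2 powr \<bar>Re (c + 1)\<bar> / (Re (a + (c + 1)) - 1) * real n powr (- (Re (a + (b - 1) + (c + 1)) - 1))"
      unfolding powr_minus_divide[symmetric] using assms by simp
  qed (use assms in simp)
qed

lemma powr_neg_eq: "1 / of_nat n powr (b - 1) = of_nat n * of_nat n powr (- b :: complex)" if "0 < n"
proof -
  have "of_nat n powr (1 + (- b)) = of_nat n * complex_of_nat n powr (- b)"
    unfolding powr_add using that by simp
  moreover have "1 / of_nat n powr (b - 1) = complex_of_nat n powr (- (b - 1))"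
    by (simp only: powr_minus_divide)
  ultimately show ?thesis by simp
qed

text \<open>The two summands of \<open>kreg\<close> are the two main terms for n \<le> x; the factor
  r = n in front of the integral changes the exponent of n from -b to 1 - b.\<close>

lemma kreg_term_y:
  assumes "0 < n"
  shows "of_nat n powr (- b) * kreg (real n) a c y =
    of_real y powr (1 - a) / (a + c - 1) * (1 / (of_nat n powr b * of_real (y + real n) powr c))
    + c / (a + c - 1) * (1 / of_nat n powr (b - 1) * kint (\<lambda>_. 1) (real n) a (c + 1) y)"
  unfolding powr_neg_eq[OF assms] kreg_def
  by (simp add: powr_minus_divide add_divide_distrib algebra_simps)

lemma kreg_term_n:
  assumes "0 < n"
  shows "of_nat n powr (- b) * kreg (real n) a c (real n) =
    2 powr (- c) / (a + c - 1) * (1 / of_nat n powr (a + b + c - 1))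
    + c / (a + c - 1) * (1 / of_nat n powr (b - 1) * kint (\<lambda>_. 1) (real n) a (c + 1) (real n))"
proof -
  have "complex_of_real (real n + real n) powr c = 2 powr c * of_nat n powr c"
    using powr_times_real[of 2 "of_nat n" c] by simp
  moreover have "1 / of_nat n powr (a + b + c - 1) = of_nat n powr (1 - a) * (1 / (of_nat n powr b * complex_of_nat n powr c))"
  proof -
    have "1 / complex_of_nat n powr (a + b + c - 1) = of_nat n powr ((1 - a) + (- b) + (- c))"
      unfolding powr_minus_divide[symmetric] by (simp add: algebra_simps)
    also have "\<dots> = of_nat n powr (1 - a) * of_nat n powr (- b) * of_nat n powr (- c)"
      unfolding powr_add ..
    finally show ?thesis by (simp add: powr_minus_divide)
  qed
  ultimately show ?thesis
    unfolding kreg_term_y[OF assms] by (simp add: powr_minus_divide)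
qed

lemma kint_one_eq: "kint (\<lambda>_. 1) r a c y = (LBINT u:{y..}. 1 / (of_real u powr a * of_real (u + r) powr c))"
  by (simp add: kint_def kern_def powr_minus_divide)

text \<open>The expansion is started at y for n \<le> x and at n for n > x. Either starting point is
  at least max x n, so one sawtooth bound, with one constant, controls all remainders. Quantifying K
  before t3, x and y expresses on what the implied constants may depend.\<close>

theorem theorem2p2:
  fixes s1 s2 :: complex and \<sigma>3 C :: real
  assumes "Re s1 \<ge> 0" and "C > 1" and "\<sigma>3 > max 0 (2 - Re s1 - Re s2)"
  shows "\<exists>K::real. \<forall>(t3::real) (x::real) (y::real).
    (let s3 = Complex \<sigma>3 t3 in
      1 \<le> x \<and> x \<le> y \<and> s1 + s3 \<noteq> 1 \<and>
      \<bar>t3\<bar> \<le> 2 * pi * x / C - \<bar>Im s1\<bar> \<and>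
      ((Im s1 \<ge> 0 \<and> t3 \<ge> 0 \<and> (Im s1, t3) \<noteq> (0, 0)) \<or>
       (Im s1 \<le> 0 \<and> t3 \<le> 0 \<and> (Im s1, t3) \<noteq> (0, 0)))
      \<longrightarrow>
      norm (zeta_AV2 s1 s2 s3
        - (\<Sum>n\<in>{1..nat \<lfloor>x\<rfloor>}. \<Sum>m\<in>{n<..nat \<lfloor>y\<rfloor>}.
             1 / (of_nat m powr s1 * of_nat n powr s2 * of_nat (m + n) powr s3))
        - of_real y powr (1 - s1) / (s1 + s3 - 1) *
            (\<Sum>n\<in>{1..nat \<lfloor>x\<rfloor>}. 1 / (of_nat n powr s2 * of_real (y + real n) powr s3))
        - s3 / (s1 + s3 - 1) *
            (\<Sum>n\<in>{1..nat \<lfloor>x\<rfloor>}. 1 / of_nat n powr (s2 - 1) *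
               (LBINT u:{y..}. 1 / (of_real u powr s1 * of_real (u + real n) powr (s3 + 1))))
        - 2 powr (- s3) / (s1 + s3 - 1) *
            infsum (\<lambda>n::nat. 1 / of_nat n powr (s1 + s2 + s3 - 1)) {n. real n > x}
        - s3 / (s1 + s3 - 1) *
            infsum (\<lambda>n::nat. 1 / of_nat n powr (s2 - 1) *
               (LBINT u:{real n..}. 1 / (of_real u powr s1 * of_real (u + real n) powr (s3 + 1))))
              {n. real n > x})
      \<le> K * (if Re s2 > 1 then x powr (- Re s1 - \<sigma>3)
             else if Re s2 = 1 then x powr (- Re s1 - \<sigma>3) * (1 + ln x)
             else x powr (1 - Re s1 - Re s2 - \<sigma>3)))"
proof -
  \<comment> \<open>The hypothesis on t3 says that |t1| + |t3| \<le> \<theta> x, and C > 1 gives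
    \<theta> < 2 pi.\<close>
  define \<theta> where "\<theta> = 2 * pi / C"
  define S where "S = Re s1 + \<sigma>3"
  have \<theta>: "0 \<le> \<theta>" "\<theta> < 2 * pi" using assms(2) by (auto simp: \<theta>_def field_simps)
  have \<sigma>3: "0 < \<sigma>3" "0 < S" "2 < Re s2 + S" using assms(1,3) by (auto simp: S_def)
  obtain K where K: "0 \<le> K" "\<And>a c r y. \<lbrakk>0 \<le> Re a; 0 \<le> Re c; 0 < Re (a + c); 1 \<le> y; 0 \<le> r; r \<le> y;
      \<bar>Im a\<bar> + \<bar>Im c\<bar> \<le> \<theta> * y\<rbrakk> \<Longrightarrow> norm (ktail r a c y - kreg r a c y) \<le> K * y powr (- Re (a + c))"
    using sawtooth_kern_integral_bound[OF \<theta>] by blast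
  obtain C1 where C1: "0 \<le> C1"
    "\<And>x. 1 \<le> x \<Longrightarrow> (\<Sum>n\<in>{1..nat \<lfloor>x\<rfloor>}. real n powr (- Re s2)) \<le> C1 * powr_growth (Re s2) x"
    using powr_partial_sum_bound by blast
  obtain C2 where C2: "0 \<le> C2"
    "\<And>x. 1 \<le> x \<Longrightarrow> (\<Sum>\<^sub>\<infinity>n\<in>{nat \<lfloor>x\<rfloor><..}. real n powr (- (Re s2 + S))) \<le> C2 * x powr (1 - (Re s2 + S))"
    using powr_tail_sum_bound[of "Re s2 + S"] \<sigma>3 by auto
  have growth: "(if Re s2 > 1 then x powr (- Re s1 - \<sigma>3)
             else if Re s2 = 1 then x powr (- Re s1 - \<sigma>3) * (1 + ln x)
             else x powr (1 - Re s1 - Re s2 - \<sigma>3)) = x powr (- S) * powr_growth (Re s2) x" if "1 \<le> x" for x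
  proof -
    have e: "- Re s1 - \<sigma>3 = - S" "1 - Re s1 - Re s2 - \<sigma>3 = - S + (1 - Re s2)" by (simp_all add: S_def)
    show ?thesis unfolding powr_growth_def e powr_add by simp
  qed
  show ?thesis
    unfolding Let_def
  \<comment> \<open>The product K * C1 accounts for the remainders with n \<le> x and K * C2 for
    those with n > x.\<close>
  proof (intro exI[of _ "K * C1 + K * C2"] allI impI, elim conjE, goal_cases)
    case (1 t3 x y)
    define s3 where "s3 = Complex \<sigma>3 t3"
    note x = 1(1) and xy = 1(2) and ne = 1(3) and t3 = 1(4)
    have ne': "s1 + s3 \<noteq> 1" using ne by (simp add: s3_def)
    have re3: "Re s3 = \<sigma>3" "Im s3 = t3" by (simp_all add: s3_def)
    have Re: "Re (s1 + s3) = S" "Re (s1 + s2 + s3) = Re s2 + S" by (simp_all add: re3 S_def)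
    have im: "\<bar>Im s1\<bar> + \<bar>Im s3\<bar> \<le> \<theta> * z" if "x \<le> z" for z
    proof -
      have "\<bar>Im s1\<bar> + \<bar>Im s3\<bar> \<le> \<theta> * x" using t3 by (simp add: \<theta>_def re3)
      also have "\<dots> \<le> \<theta> * z" using that \<theta> by (intro mult_left_mono)
      finally show ?thesis .
    qed
    define N where "N = nat \<lfloor>x\<rfloor>"
    note N = nat_floor_ge_half[OF x, folded N_def]
    have N_less: "N < n \<longleftrightarrow> x < real n" for n
      unfolding N_def using x by (auto simp: nat_less_iff floor_less_iff)
    have setN: "{n. x < real n} = {N<..}" using N_less by auto
    have err: "norm (ktail (real n) s1 s3 z - kreg (real n) s1 s3 z) \<le> K * z powr (- S)"
      if "x \<le> z" "real n \<le> z" for n z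
      using K(2)[of s1 s3 z "real n"] that x im[of z] assms(1) \<sigma>3 by (simp add: Re re3 del: plus_complex.simps)
    let ?kt = "\<lambda>n z. of_nat n powr (- s2) * ktail (real n) s1 s3 z"
    let ?kr = "\<lambda>n z. of_nat n powr (- s2) * kreg (real n) s1 s3 z"
    let ?I1 = "\<lambda>n::nat. 1 / of_nat n powr (s1 + s2 + s3 - 1) :: complex"
    let ?I2 = "\<lambda>n. 1 / of_nat n powr (s2 - 1) * kint (\<lambda>_. 1) (real n) s1 (s3 + 1) (real n)"
    have hs: "((\<lambda>n. ?kt n (real n)) has_sum zeta_AV2 s1 s2 s3) {1..}"
      by (rule zeta_AV2_has_sum) (use ne' \<sigma>3 in \<open>auto simp: Re simp del: plus_complex.simps\<close>)
    have sN: "(\<lambda>n. ?kt n (real n)) summable_on {N<..}"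
      by (rule summable_on_subset_banach[of _ "{1..}"]) (use hs N in \<open>auto simp: summable_on_def\<close>)
    have "(\<Sum>\<^sub>\<infinity>n\<in>{1..N} \<union> {N<..}. ?kt n (real n)) = (\<Sum>\<^sub>\<infinity>n\<in>{1..N}. ?kt n (real n)) + (\<Sum>\<^sub>\<infinity>n\<in>{N<..}. ?kt n (real n))"
      by (rule infsum_Un_disjoint) (use sN in auto)
    moreover have "{1..N} \<union> {N<..} = {1..}" using N by auto
    ultimately have zeta: "zeta_AV2 s1 s2 s3 = (\<Sum>n\<in>{1..N}. ?kt n (real n)) + (\<Sum>\<^sub>\<infinity>n\<in>{N<..}. ?kt n (real n))"
      using infsumI[OF hs] by simp
    \<comment> \<open>Moving the starting point of \<open>ktail\<close> from n to y splits off the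
      finite double sum of the formula.\<close>
    have low: "(\<Sum>n\<in>{1..N}. ?kt n (real n)) = (\<Sum>n\<in>{1..N}. \<Sum>m\<in>{n<..nat \<lfloor>y\<rfloor>}.
             1 / (of_nat m powr s1 * of_nat n powr s2 * of_nat (m + n) powr s3)) + (\<Sum>n\<in>{1..N}. ?kt n y)"
      unfolding sum.distrib[symmetric]
    proof (rule sum.cong[OF refl])
      fix n assume n: "n \<in> {1..N}"
      have ny: "0 < n" "real n \<le> y" using n N xy by auto
      have "ktail (real n) s1 s3 (real n) = (\<Sum>m\<in>{n<..nat \<lfloor>y\<rfloor>}. kern (real n) s1 s3 (of_nat m)) + ktail (real n) s1 s3 y"
        using ktail_split[of "real n" "real n" y s1 s3] ny ne' \<sigma>3(2) Re(1) by simp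
      moreover have "of_nat n powr (- s2) * kern (real n) s1 s3 (of_nat m) =
         1 / (of_nat m powr s1 * of_nat n powr s2 * of_nat (m + n) powr s3)" for m
        by (simp add: kern_def powr_minus_divide)
      ultimately show "?kt n (real n) = (\<Sum>m\<in>{n<..nat \<lfloor>y\<rfloor>}.
           1 / (of_nat m powr s1 * of_nat n powr s2 * of_nat (m + n) powr s3)) + ?kt n y"
        by (simp add: distrib_left sum_distrib_left)
    qed
    have lowr: "(\<Sum>n\<in>{1..N}. ?kr n y) = of_real y powr (1 - s1) / (s1 + s3 - 1) *
            (\<Sum>n\<in>{1..N}. 1 / (of_nat n powr s2 * of_real (y + real n) powr s3))
       + s3 / (s1 + s3 - 1) * (\<Sum>n\<in>{1..N}. 1 / of_nat n powr (s2 - 1) * kint (\<lambda>_. 1) (real n) s1 (s3 + 1) y)"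
      unfolding sum_distrib_left sum.distrib[symmetric] by (intro sum.cong refl kreg_term_y) simp
    have sI1: "?I1 summable_on {N<..}"
      by (rule summable_on_powr_kreg) (use \<sigma>3 in \<open>auto simp: Re simp del: plus_complex.simps\<close>)
    have sI2: "?I2 summable_on {N<..}"
      by (rule summable_on_powr_kreg) (use \<sigma>3 in \<open>auto simp: Re simp del: plus_complex.simps\<close>)
    have hr: "((\<lambda>n. ?kr n (real n)) has_sum (2 powr (- s3) / (s1 + s3 - 1) * infsum ?I1 {N<..}
        + s3 / (s1 + s3 - 1) * infsum ?I2 {N<..})) {N<..}"
    proof (rule has_sum_cong[THEN iffD2])
      show "?kr n (real n) = 2 powr (- s3) / (s1 + s3 - 1) * ?I1 n + s3 / (s1 + s3 - 1) * ?I2 n"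
        if "n \<in> {N<..}" for n
        by (rule kreg_term_n) (use that in auto)
      show "((\<lambda>n. 2 powr (- s3) / (s1 + s3 - 1) * ?I1 n + s3 / (s1 + s3 - 1) * ?I2 n) has_sum
        (2 powr (- s3) / (s1 + s3 - 1) * infsum ?I1 {N<..} + s3 / (s1 + s3 - 1) * infsum ?I2 {N<..})) {N<..}"
        by (intro has_sum_add has_sum_cmult_right has_sum_infsum sI1 sI2)
    qed
    define E1 where "E1 = (\<Sum>n\<in>{1..N}. ?kt n y - ?kr n y)"
    define E2 where "E2 = (\<Sum>\<^sub>\<infinity>n\<in>{N<..}. ?kt n (real n) - ?kr n (real n))"
    have hd: "((\<lambda>n. ?kt n (real n) - ?kr n (real n)) has_sum (\<Sum>\<^sub>\<infinity>n\<in>{N<..}. ?kt n (real n)) -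
        (2 powr (- s3) / (s1 + s3 - 1) * infsum ?I1 {N<..} + s3 / (s1 + s3 - 1) * infsum ?I2 {N<..})) {N<..}"
      by (rule has_sum_minus[OF has_sum_infsum[OF sN] hr])
    have E2: "E2 = (\<Sum>\<^sub>\<infinity>n\<in>{N<..}. ?kt n (real n)) -
        (2 powr (- s3) / (s1 + s3 - 1) * infsum ?I1 {N<..} + s3 / (s1 + s3 - 1) * infsum ?I2 {N<..})"
      unfolding E2_def by (rule infsumI[OF hd])
    have E1: "E1 = (\<Sum>n\<in>{1..N}. ?kt n y) - (\<Sum>n\<in>{1..N}. ?kr n y)"
      unfolding E1_def by (rule sum_subtractf)
    have bd: "norm (?kt n z - ?kr n z) \<le> real n powr (- Re s2) * (K * z powr (- S))"
      if "x \<le> z" "real n \<le> z" for n z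
      unfolding right_diff_distrib[symmetric] norm_mult
      by (intro mult_mono err that) (auto simp: norm_powr_real_powr)
    have "norm E1 \<le> (\<Sum>n\<in>{1..N}. K * y powr (- S) * real n powr (- Re s2))"
      unfolding E1_def
    proof (rule sum_norm_le)
      fix n assume "n \<in> {1..N}"
      then have "real n \<le> y" using N xy by auto
      from bd[OF xy this] show "norm (?kt n y - ?kr n y) \<le> K * y powr (- S) * real n powr (- Re s2)"
        by (simp add: mult_ac)
    qed
    also have "\<dots> = K * y powr (- S) * (\<Sum>n\<in>{1..N}. real n powr (- Re s2))"
      by (simp add: sum_distrib_left)
    \<comment> \<open>Since S > 0 and y \<ge> x, the power of y is at most that of x, and the
      estimate no longer depends on y.\<close>
    also have "\<dots> \<le> K * x powr (- S) * (C1 * powr_growth (Re s2) x)"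
      unfolding N_def using K(1) x xy \<sigma>3
      by (intro mult_mono C1(2) mult_left_mono powr_mono2' mult_nonneg_nonneg sum_nonneg) auto
    finally have B1: "norm E1 \<le> K * C1 * (x powr (- S) * powr_growth (Re s2) x)" by (simp add: mult_ac)
    have "norm E2 \<le> (\<Sum>\<^sub>\<infinity>n\<in>{N<..}. K * real n powr (- (Re s2 + S)))"
      unfolding E2_def
    proof (rule norm_infsum_le)
      show "((\<lambda>n. ?kt n (real n) - ?kr n (real n)) has_sum (\<Sum>\<^sub>\<infinity>n\<in>{N<..}. ?kt n (real n) - ?kr n (real n))) {N<..}"
        using hd by (intro has_sum_infsum) (auto simp: summable_on_def)
      show "((\<lambda>n. K * real n powr (- (Re s2 + S))) has_sum (\<Sum>\<^sub>\<infinity>n\<in>{N<..}. K * real n powr (- (Re s2 + S)))) {N<..}"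
        by (intro has_sum_infsum summable_on_cmult_right powr_summable_on) (use \<sigma>3 in auto)
      fix n assume "n \<in> {N<..}"
      then have "x \<le> real n" using N_less by (simp add: less_imp_le)
      have "real n powr (- Re s2) * (K * real n powr (- S)) = K * real n powr (- (Re s2 + S))"
        using powr_add[of "real n" "- Re s2" "- S"] by simp
      with bd[OF \<open>x \<le> real n\<close> order_refl] show "norm (?kt n (real n) - ?kr n (real n)) \<le> K * real n powr (- (Re s2 + S))"
        by (simp only:)
    qed
    also have "\<dots> = K * (\<Sum>\<^sub>\<infinity>n\<in>{N<..}. real n powr (- (Re s2 + S)))"
      by (rule infsum_cmult_right')
    also have "\<dots> \<le> K * (C2 * x powr (1 - (Re s2 + S)))"
      unfolding N_def by (intro mult_left_mono C2(2) x K(1))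
    also have "1 - (Re s2 + S) = - S + (1 - Re s2)" by simp
    also have "x powr (- S + (1 - Re s2)) = x powr (- S) * x powr (1 - Re s2)"
      by (rule powr_add)
    also have "K * (C2 * (x powr (- S) * x powr (1 - Re s2))) \<le> K * (C2 * (x powr (- S) * powr_growth (Re s2) x))"
      by (intro mult_left_mono powr_growth_ge x K(1) C2(1)) auto
    finally have B2: "norm E2 \<le> K * C2 * (x powr (- S) * powr_growth (Re s2) x)" by (simp add: mult_ac)
    have B: "norm (E1 + E2) \<le> (K * C1 + K * C2) * (x powr (- S) * powr_growth (Re s2) x)"
      using norm_triangle_mono[OF B1 B2] by (simp add: distrib_right)
    \<comment> \<open>What is left is additive regrouping; stating it for variables keeps the large
      terms opaque.\<close>
    have lin: "p + t + r - p - u - v - d - e = (t - (u + v)) + (r - (d + e))"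
      for p t r u v d e :: complex by simp
    have "zeta_AV2 s1 s2 s3
        - (\<Sum>n\<in>{1..N}. \<Sum>m\<in>{n<..nat \<lfloor>y\<rfloor>}.
             1 / (of_nat m powr s1 * of_nat n powr s2 * of_nat (m + n) powr s3))
        - of_real y powr (1 - s1) / (s1 + s3 - 1) *
            (\<Sum>n\<in>{1..N}. 1 / (of_nat n powr s2 * of_real (y + real n) powr s3))
        - s3 / (s1 + s3 - 1) *
            (\<Sum>n\<in>{1..N}. 1 / of_nat n powr (s2 - 1) * kint (\<lambda>_. 1) (real n) s1 (s3 + 1) y)
        - 2 powr (- s3) / (s1 + s3 - 1) * infsum ?I1 {N<..}
        - s3 / (s1 + s3 - 1) * infsum ?I2 {N<..} = E1 + E2"
      unfolding zeta low E1 E2 lowr by (rule lin)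
    note eq = this[unfolded kint_one_eq, folded setN, unfolded N_def s3_def]
    show ?case unfolding eq growth[OF x] using B by simp
  qed
qed

end
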